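(* Let $0<q<1$, $\nu>-1$, and let $p,r,s\ge 1$ be real numbers with $\frac1p+\frac1r-1=\frac1s$. Let $f\in\mathcal{L}_{q,p,\nu}$ and $g\in\mathcal{L}_{q,r,\nu}$. Then $f\ast_q g$ exists, and: (i) $f\ast_q g(x)=c_{q,\nu}\int_0^\infty T_{q,x}^{\nu}f(y)\,g(y)\,y^{2\nu+1}d_qy$ for all $x\in\mathbb{R}_q^+$; (ii) $f\ast_q g\in\mathcal{L}_{q,s,\nu}$; (iii) $\mathcal{F}_{q,\nu}(f\ast_q g)=\mathcal{F}_{q,\nu}(f)\times\mathcal{F}_{q,\nu}(g)$; (iv) if $s\ge 2$, then $\|f\ast_q g\|_{q,s,\nu}\le B_{q,\nu}\|f\|_{q,p,\nu}\|g\|_{q,r,\nu}$; (v) if $T_{q,x}^{\nu}$ is a positive operator (for all $x\in\mathbb{R}_q^+$), then $\|f\ast_q g\|_{q,s,\nu}\le c_{q,\nu}\|f\|_{q,p,\nu}\|g\|_{q,r,\nu}$.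
   Context: $\mathbb{R}_q^+=\{q^n: n\in\mathbb{Z}\}$. For $a\in\mathbb{C}$, $(a;q^2)_n=\prod_{k=0}^{n-1}(1-aq^{2k})$ and $(a;q^2)_\infty=\prod_{k\ge 0}(1-aq^{2k})$. Jackson integral: $\int_0^\infty f(t)\,d_qt=(1-q)\sum_{n\in\mathbb{Z}}q^nf(q^n)$. For $1\le p<\infty$, $\mathcal{L}_{q,p,\nu}$ is the space of functions $f:\mathbb{R}_q^+\to\mathbb{R}$ with $\|f\|_{q,p,\nu}=\left(\int_0^\infty|f(x)|^px^{2\nu+1}d_qx\right)^{1/p}<\infty$. Normalized $q$-Bessel function: $j_\nu(x,q^2)=\sum_{n=0}^\infty(-1)^n\frac{q^{n(n+1)}}{(q^{2\nu+2};q^2)_n(q^2;q^2)_n}x^{2n}$. Constants: $c_{q,\nu}=\frac{1}{1-q}\frac{(q^{2\nu+2};q^2)_\infty}{(q^2;q^2)_\infty}$ and $B_{q,\nu}=\frac{1}{1-q}\frac{(-q^2;q^2)_\infty(-q^{2\nu+2};q^2)_\infty}{(q^2;q^2)_\infty}$. The $q$-Bessel Fourier transform is $\mathcal{F}_{q,\nu}f(x)=c_{q,\nu}\int_0^\infty f(t)j_\nu(xt,q^2)t^{2\nu+1}d_qt$, $x\in\mathbb{R}_q^+$. The $q$-translation operator is $T_{q,x}^\nu f(y)=c_{q,\nu}\int_0^\infty\mathcal{F}_{q,\nu}f(t)\,j_\nu(yt,q^2)j_\nu(xt,q^2)t^{2\nu+1}d_qt$ for $x,y\in\mathbb{R}_q^+$;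 it is called positive if $T_{q,x}^\nu f\ge 0$ whenever $f\ge 0$. The $q$-convolution product is $f\ast_q g=\mathcal{F}_{q,\nu}\left[\mathcal{F}_{q,\nu}f\times\mathcal{F}_{q,\nu}g\right]$ (pointwise product inside the bracket). *)

theory Defs
  imports "HOL-Analysis.Analysis"
begin

text \<open>\<open>qpoch a b n\<close> and \<open>qpoch_inf a b\<close> are the q-shifted factorials of \<open>a\<close> to the base \<open>b\<close>.\<close>

definition qpoch :: "'a::real_normed_field \<Rightarrow> 'a \<Rightarrow> nat \<Rightarrow> 'a" where
  "qpoch a b n = (\<Prod>k<n. 1 - a * b ^ k)"

definition qpoch_inf :: "'a::real_normed_field \<Rightarrow> 'a \<Rightarrow> 'a" where
  "qpoch_inf a b = prodinf (\<lambda>k. 1 - a * b ^ k)"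

definition Rq :: "real \<Rightarrow> real set" where
  "Rq q = range (\<lambda>n::int. q powi n)"

text \<open>
  Functions on \<open>Rq q\<close> are modelled as functions of type \<^typ>\<open>real \<Rightarrow> real\<close>; every notion
  below only depends on their values on \<open>Rq q\<close>. Unordered summability over the integers is
  absolute summability, so the Jackson integral is the absolutely convergent one.
\<close>

definition jackson_integrable :: "real \<Rightarrow> (real \<Rightarrow> real) \<Rightarrow> bool" where
  "jackson_integrable q f \<longleftrightarrow> (\<lambda>n::int. q powi n * f (q powi n)) summable_on UNIV"

definition jackson_integral :: "real \<Rightarrow> (real \<Rightarrow> real) \<Rightarrow> real" where
  "jackson_integral q f = (1 - q) * (\<Sum>\<^sub>\<infinity>n::int. q powi n * f (q powi n))"

definition Lq :: "real \<Rightarrow> real \<Rightarrow> real \<Rightarrow> (real \<Rightarrow> real) set" where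
  "Lq q p \<nu> = {f. jackson_integrable q (\<lambda>x. \<bar>f x\<bar> powr p * x powr (2 * \<nu> + 1))}"

definition Lq_norm :: "real \<Rightarrow> real \<Rightarrow> real \<Rightarrow> (real \<Rightarrow> real) \<Rightarrow> real" where
  "Lq_norm q p \<nu> f =
     (jackson_integral q (\<lambda>x. \<bar>f x\<bar> powr p * x powr (2 * \<nu> + 1))) powr (1 / p)"

text \<open>\<open>q_bessel_j q \<nu> x\<close> is \<open>j\<^sub>\<nu>(x, q\<^sup>2)\<close>.\<close>

definition q_bessel_j :: "real \<Rightarrow> real \<Rightarrow> real \<Rightarrow> real" where
  "q_bessel_j q \<nu> x =
     (\<Sum>n. (- 1) ^ n * (q ^ (n * (n + 1)) /
            (qpoch (q powr (2 * \<nu> + 2)) (q\<^sup>2) n * qpoch (q\<^sup>2) (q\<^sup>2) n)) * x ^ (2 * n))"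

definition c_const :: "real \<Rightarrow> real \<Rightarrow> real" where
  "c_const q \<nu> =
     1 / (1 - q) * (qpoch_inf (q powr (2 * \<nu> + 2)) (q\<^sup>2) / qpoch_inf (q\<^sup>2) (q\<^sup>2))"

definition B_const :: "real \<Rightarrow> real \<Rightarrow> real" where
  "B_const q \<nu> =
     1 / (1 - q) * (qpoch_inf (- (q\<^sup>2)) (q\<^sup>2) * qpoch_inf (- (q powr (2 * \<nu> + 2))) (q\<^sup>2)
                    / qpoch_inf (q\<^sup>2) (q\<^sup>2))"

definition q_fourier :: "real \<Rightarrow> real \<Rightarrow> (real \<Rightarrow> real) \<Rightarrow> real \<Rightarrow> real" where
  "q_fourier q \<nu> f x =
     c_const q \<nu> * jackson_integral q (\<lambda>t. f t * q_bessel_j q \<nu> (x * t) * t powr (2 * \<nu> + 1))"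

definition q_fourier_exists :: "real \<Rightarrow> real \<Rightarrow> (real \<Rightarrow> real) \<Rightarrow> bool" where
  "q_fourier_exists q \<nu> f \<longleftrightarrow>
     (\<forall>x\<in>Rq q. jackson_integrable q (\<lambda>t. f t * q_bessel_j q \<nu> (x * t) * t powr (2 * \<nu> + 1)))"

definition q_translation :: "real \<Rightarrow> real \<Rightarrow> real \<Rightarrow> (real \<Rightarrow> real) \<Rightarrow> real \<Rightarrow> real" where
  "q_translation q \<nu> x f y =
     c_const q \<nu> * jackson_integral q
       (\<lambda>t. q_fourier q \<nu> f t * q_bessel_j q \<nu> (y * t) * q_bessel_j q \<nu> (x * t) * t powr (2 * \<nu> + 1))"

definition q_translation_exists :: "real \<Rightarrow> real \<Rightarrow> real \<Rightarrow> (real \<Rightarrow> real) \<Rightarrow> bool" where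
  "q_translation_exists q \<nu> x f \<longleftrightarrow>
     q_fourier_exists q \<nu> f \<and>
     (\<forall>y\<in>Rq q. jackson_integrable q
       (\<lambda>t. q_fourier q \<nu> f t * q_bessel_j q \<nu> (y * t) * q_bessel_j q \<nu> (x * t) * t powr (2 * \<nu> + 1)))"

text \<open>
  Positivity is tested on the union of the spaces \<open>Lq q p \<nu>\<close>, \<open>1 \<le> p\<close>: for an arbitrary
  \<open>f\<close> the integrals may diverge, and then their formal values carry no information.
\<close>

definition q_translation_positive :: "real \<Rightarrow> real \<Rightarrow> real \<Rightarrow> bool" where
  "q_translation_positive q \<nu> x \<longleftrightarrow>
     (\<forall>p\<ge>1. \<forall>f\<in>Lq q p \<nu>. (\<forall>t\<in>Rq q. 0 \<le> f t) \<longrightarrow> (\<forall>y\<in>Rq q. 0 \<le> q_translation q \<nu> x f y))"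

definition q_conv :: "real \<Rightarrow> real \<Rightarrow> (real \<Rightarrow> real) \<Rightarrow> (real \<Rightarrow> real) \<Rightarrow> real \<Rightarrow> real" where
  "q_conv q \<nu> f g = q_fourier q \<nu> (\<lambda>t. q_fourier q \<nu> f t * q_fourier q \<nu> g t)"

definition q_conv_exists :: "real \<Rightarrow> real \<Rightarrow> (real \<Rightarrow> real) \<Rightarrow> (real \<Rightarrow> real) \<Rightarrow> bool" where
  "q_conv_exists q \<nu> f g \<longleftrightarrow>
     q_fourier_exists q \<nu> f \<and> q_fourier_exists q \<nu> g \<and>
     q_fourier_exists q \<nu> (\<lambda>t. q_fourier q \<nu> f t * q_fourier q \<nu> g t)"

end

theory Submission
  imports Defs
begin

text \<open>On \<open>x = q\<^sup>n\<close> everything becomes a sum over the integers, with \<open>Q = q\<^sup>2\<close> and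
  \<open>Z = q\<^bsup>2\<nu>+2\<^esup>\<close>: the weight is \<open>Z\<^sup>n\<close>, and up to the factor
  \<open>(Z; Q)\<^sub>\<infinity> / (Q; Q)\<^sub>\<infinity>\<close> the Bessel function is
  \<open>\<phi>\<^sub>n = \<Sum>\<^sub>l e\<^sub>l h\<^sub>n\<^sub>+\<^sub>l\<close>, where \<open>e\<^sub>l\<close> are the Taylor coefficients of \<open>(Zx; Q)\<^sub>\<infinity>\<close>
  and \<open>h\<^sub>n\<close> those of \<open>1 / (x; Q)\<^sub>\<infinity>\<close>. Changing \<open>Z\<close> to \<open>ZQ\<close> and \<open>ZQ\<^sup>2\<close> gives a recurrence for
  \<open>\<Sum>\<^sub>n Z\<^sup>n \<phi>\<^sub>n\<^sub>+\<^sub>a \<phi>\<^sub>n\<^sub>+\<^sub>b\<close>, whose limit \<open>Z \<rightarrow> 0\<close> is the orthogonality relation, and a recurrence with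
  positive coefficients for the heat kernel \<open>\<Sum>\<^sub>n h\<^sub>n Z\<^sup>n \<phi>\<^sub>n\<^sub>+\<^sub>a \<phi>\<^sub>n\<^sub>+\<^sub>b\<close>, which is therefore nonnegative;
  its rows have total mass at most \<open>1 / (Q; Q)\<^sub>\<infinity>\<close>. Expanding one of the three factors of the
  product kernel \<open>\<Sum>\<^sub>n Z\<^sup>n \<phi>\<^sub>n\<^sub>+\<^sub>a \<phi>\<^sub>n\<^sub>+\<^sub>b \<phi>\<^sub>n\<^sub>+\<^sub>d\<close> in the \<open>h\<^sub>n\<close> bounds the absolute row sums of that
  kernel by \<open>(-Z; Q)\<^sub>\<infinity> / (Q; Q)\<^sub>\<infinity>\<close>, which is at most \<open>(1 - q) B\<close>; if the translation is positive, the kernel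
  is nonnegative and its row sums are exactly \<open>(1 - q) c\<close>. The norm estimates are Young's inequality
  for this kernel, and the remaining claims follow by exchanging
  absolutely convergent sums.\<close>

section \<open>Unordered sums\<close>

text \<open>The obstacle is sign: the product kernel may oscillate, and then its row sums say
  nothing about its absolute row sums. Replacing one of its three Bessel factors by \<open>h\<close>
  gives a kernel that is nonnegative for every \<open>0 < Z < 1\<close>; all signs then sit in
  \<open>ecoeff\<close>, whose absolute series sums to (-Z; Q)_inf. The recurrences work because
  \<open>phi_shift\<close> writes \<open>phi Z\<close>, and \<open>phi_diff\<close> writes
  \<open>phi (Z * Q * Q)\<close>, through the same sequence \<open>phi (Z * Q)\<close>; the two
  quadratic expressions so obtained differ by 1 - Z times a telescoping difference. Under the weight
  \<open>h\<close> this difference no longer telescopes, and what remains is again a heat kernel. As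
  \<open>Z\<close> tends to 0, \<open>phi\<close> tends to \<open>h\<close> and the sums concentrate
  at index 0, so the limit is explicit. Row sums are reached by moving the index of a test factor to
  infinity, where \<open>phi\<close> tends to a positive constant. The absolute kernel bounds serve
  twice: for the norm estimates, and for the exchange of sums behind the transform of a
  convolution.\<close>

lemma summable_on_bounded_by:
  fixes f g :: "'a \<Rightarrow> real"
  assumes "g summable_on A" "\<And>x. x \<in> A \<Longrightarrow> \<bar>f x\<bar> \<le> g x"
  shows "f summable_on A" "(\<lambda>x. \<bar>f x\<bar>) summable_on A" "\<bar>infsum f A\<bar> \<le> infsum g A"
proof -
  show a: "(\<lambda>x. \<bar>f x\<bar>) summable_on A"
    using Infinite_Sum.abs_summable_on_comparison_test'[OF assms(1), of f] assms(2) by simp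
  then show b: "f summable_on A"
    using abs_summable_summable[of f A] by simp
  have "\<bar>infsum f A\<bar> \<le> (\<Sum>\<^sub>\<infinity>x\<in>A. \<bar>f x\<bar>)"
    using Infinite_Sum.norm_infsum_bound[of f A] a by simp
  also have "\<dots> \<le> infsum g A"
    by (intro infsum_mono a assms)
  finally show "\<bar>infsum f A\<bar> \<le> infsum g A" .
qed

lemma summable_on_abs_real: "(f :: 'a \<Rightarrow> real) summable_on A \<Longrightarrow> (\<lambda>x. \<bar>f x\<bar>) summable_on A"
  using summable_on_iff_abs_summable_on_real by force

lemma summable_on_Times_bounded_by:
  fixes f g :: "'a \<Rightarrow> 'b \<Rightarrow> real"
  assumes "\<And>x y. x \<in> A \<Longrightarrow> y \<in> B \<Longrightarrow> \<bar>f x y\<bar> \<le> g x y"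
    and "\<And>x. x \<in> A \<Longrightarrow> (\<lambda>y. g x y) summable_on B"
    and "\<And>x. x \<in> A \<Longrightarrow> (\<Sum>\<^sub>\<infinity>y\<in>B. g x y) \<le> u x" and "u summable_on A"
  shows "(\<lambda>(x, y). f x y) summable_on A \<times> B"
proof -
  have g0: "g x y \<ge> 0" if "x \<in> A" "y \<in> B" for x y
    using assms(1)[OF that] by linarith
  have "(\<lambda>x. \<Sum>\<^sub>\<infinity>y\<in>B. g x y) summable_on A"
    by (rule summable_on_bounded_by(1)[OF assms(4)]) (simp add: infsum_nonneg g0 assms(3))
  then have "(\<lambda>(x, y). g x y) summable_on A \<times> B"
    using assms(2) g0 by (intro summable_on_SigmaI[where g = "\<lambda>x. \<Sum>\<^sub>\<infinity>y\<in>B. g x y"]) auto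
  then show ?thesis
    by (rule summable_on_bounded_by(1)) (use assms(1) in auto)
qed

lemma summable_on_Times_mult:
  fixes u :: "'a \<Rightarrow> real" and v :: "'b \<Rightarrow> real"
  assumes "u summable_on A" "v summable_on B"
  shows "(\<lambda>(x, y). u x * v y) summable_on A \<times> B"
proof (rule summable_on_Times_bounded_by[where g = "\<lambda>x y. \<bar>u x\<bar> * \<bar>v y\<bar>" and u = "\<lambda>x. \<bar>u x\<bar> * (\<Sum>\<^sub>\<infinity>y\<in>B. \<bar>v y\<bar>)"])
  show "(\<lambda>y. \<bar>u x\<bar> * \<bar>v y\<bar>) summable_on B" for x
    by (intro summable_on_cmult_right summable_on_abs_real assms)
  show "(\<Sum>\<^sub>\<infinity>y\<in>B. \<bar>u x\<bar> * \<bar>v y\<bar>) \<le> \<bar>u x\<bar> * (\<Sum>\<^sub>\<infinity>y\<in>B. \<bar>v y\<bar>)" for x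
    by (subst infsum_cmult_right) (use assms summable_on_abs_real in auto)
  show "(\<lambda>x. \<bar>u x\<bar> * (\<Sum>\<^sub>\<infinity>y\<in>B. \<bar>v y\<bar>)) summable_on A"
    by (intro summable_on_cmult_left summable_on_abs_real assms)
qed (simp add: abs_mult)

lemma infsum_swap_bounded_by:
  fixes f :: "'a \<Rightarrow> 'b \<Rightarrow> real"
  assumes "\<And>x y. \<bar>f x y\<bar> \<le> g x y" and "\<And>x. g x summable_on UNIV"
    and "\<And>x. (\<Sum>\<^sub>\<infinity>y. g x y) \<le> u x" and "u summable_on UNIV"
  shows "(\<Sum>\<^sub>\<infinity>x. \<Sum>\<^sub>\<infinity>y. f x y) = (\<Sum>\<^sub>\<infinity>y. \<Sum>\<^sub>\<infinity>x. f x y)"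
  by (rule infsum_swap_banach, rule summable_on_Times_bounded_by[where g = g and u = u]) (use assms in auto)

text \<open>Dominated convergence for the counting measure: the unordered sums are rewritten as
  integrals over \<open>count_space UNIV\<close>.\<close>

lemma infsum_tendsto_dominated:
  fixes f :: "nat \<Rightarrow> 'a \<Rightarrow> real"
  assumes "\<And>x. (\<lambda>m. f m x) \<longlonglongrightarrow> g x" and "\<And>m x. \<bar>f m x\<bar> \<le> w x" and "w summable_on UNIV"
  shows "(\<lambda>m. \<Sum>\<^sub>\<infinity>x. f m x) \<longlonglongrightarrow> (\<Sum>\<^sub>\<infinity>x. g x)"
proof -
  have w: "integrable (count_space UNIV) w"
    using summable_on_abs_real[OF assms(3)] abs_summable_equivalent[of w UNIV]
    by (simp add: Infinite_Set_Sum.abs_summable_on_def)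
  have conv: "infsum k UNIV = integral\<^sup>L (count_space UNIV) k" if "integrable (count_space UNIV) k"
    for k :: "'a \<Rightarrow> real"
    using that infsetsum_infsum[of k UNIV]
    by (simp add: infsetsum_def Infinite_Set_Sum.abs_summable_on_def)
  have "(\<lambda>m. integral\<^sup>L (count_space UNIV) (f m)) \<longlonglongrightarrow> integral\<^sup>L (count_space UNIV) g"
    by (rule integral_dominated_convergence[where w = w]) (use assms w in auto)
  moreover have "integrable (count_space UNIV) (f m)" for m
    by (rule integrable_dominated_convergence2[where w = w and f = g]) (use assms w in auto)
  moreover have "integrable (count_space UNIV) g"
    by (rule integrable_dominated_convergence[where w = w and s = f]) (use assms w in auto)
  ultimately show ?thesis
    by (simp add: conv)
qed

lemma bij_int_add: "bij (\<lambda>n::int. n + a)"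
  by (rule bij_betwI[where g = "\<lambda>n. n - a"]) auto

lemma summable_on_int_shift:
  "(\<lambda>n::int. f (n + a)) summable_on UNIV \<longleftrightarrow> f summable_on UNIV"
  using summable_on_reindex_bij_betw[OF bij_int_add] .

lemma infsum_int_shift: "(\<Sum>\<^sub>\<infinity>n::int. f (n + a)) = (\<Sum>\<^sub>\<infinity>n. f n)"
  using infsum_reindex_bij_betw[OF bij_int_add] .

text \<open>The standard majorant for lattice sums in this proof; each half-line is reindexed by the
  naturals.\<close>

lemma summable_on_int_geometric:
  fixes \<rho> :: real
  assumes "0 \<le> \<rho>" "\<rho> < 1"
  shows "(\<lambda>n::int. \<rho> ^ nat \<bar>n\<bar>) summable_on UNIV"
proof -
  have s: "(\<lambda>n::nat. \<rho> ^ n) summable_on UNIV"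
    using assms by (subst summable_on_UNIV_nonneg_real_iff) (auto intro: summable_geometric)
  have b: "bij_betw int UNIV {0..}" "bij_betw (\<lambda>n. - int (Suc n)) UNIV {..<0}"
    by (rule bij_betwI[where g = nat], simp_all)
      (rule bij_betwI[where g = "\<lambda>n. nat (- n) - 1"], auto)
  have s': "(\<lambda>n::nat. \<rho> ^ Suc n) summable_on UNIV"
    using summable_on_cmult_right[OF s, of \<rho>] by simp
  have "(\<lambda>n::int. \<rho> ^ nat \<bar>n\<bar>) summable_on {0..}"
    using s summable_on_reindex_bij_betw[OF b(1), of "\<lambda>n. \<rho> ^ nat \<bar>n\<bar>"] by simp
  moreover have "(\<lambda>n::int. \<rho> ^ nat \<bar>n\<bar>) summable_on {..<0}"
    using s' summable_on_reindex_bij_betw[OF b(2), of "\<lambda>n. \<rho> ^ nat \<bar>n\<bar>"] by (simp add: nat_add_distrib)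
  ultimately have "(\<lambda>n::int. \<rho> ^ nat \<bar>n\<bar>) summable_on {0..} \<union> {..<0}"
    by (intro summable_on_Un_disjoint) auto
  also have "{0..} \<union> {..<0} = (UNIV :: int set)"
    by auto
  finally show ?thesis .
qed

lemma summable_on_mult_bounded:
  fixes f g :: "'a \<Rightarrow> real"
  assumes "f summable_on A" "\<And>x. x \<in> A \<Longrightarrow> \<bar>g x\<bar> \<le> B"
  shows "(\<lambda>x. f x * g x) summable_on A"
proof (rule summable_on_bounded_by(1))
  show "(\<lambda>x. \<bar>f x\<bar> * B) summable_on A"
    by (intro summable_on_cmult_left summable_on_abs_real assms)
  show "\<bar>f x * g x\<bar> \<le> \<bar>f x\<bar> * B" if "x \<in> A" for x
    using assms(2)[OF that] by (simp add: abs_mult mult_left_mono)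
qed

text \<open>The zeros below \<open>j\<close> match the series for \<open>phi\<close>: for
  \<open>n < 0\<close> the factors \<open>h (n + int l)\<close> vanish until \<open>l\<close>
  reaches \<open>- n\<close>.\<close>

lemma infsum_geometric_from:
  fixes x :: real
  assumes "0 \<le> x" "x < 1"
  shows "(\<lambda>l. if j \<le> l then x ^ (l - j) else 0) summable_on UNIV"
    and "(\<Sum>\<^sub>\<infinity>l. if j \<le> l then x ^ (l - j) else 0) = 1 / (1 - x)"
proof -
  have "((\<lambda>l. x ^ l) has_sum (1 / (1 - x))) UNIV"
    using norm_summable_imp_has_sum[of "\<lambda>l. x ^ l"] geometric_sums[of x] assms
    by (simp add: power_abs summable_geometric)
  moreover have "bij_betw (\<lambda>i. i + j) UNIV {j..}"
    by (rule bij_betwI[where g = "\<lambda>i. i - j"]) auto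
  ultimately have "((\<lambda>l. x ^ (l - j)) has_sum (1 / (1 - x))) {j..}"
    using has_sum_reindex_bij_betw[of "\<lambda>i. i + j" UNIV "{j..}" "\<lambda>l. x ^ (l - j)"] by simp
  then have "((\<lambda>l. if j \<le> l then x ^ (l - j) else 0) has_sum (1 / (1 - x))) UNIV"
    by (rule has_sum_cong_neutral[THEN iffD1, rotated -1]) auto
  then show "(\<lambda>l. if j \<le> l then x ^ (l - j) else 0) summable_on UNIV"
    and "(\<Sum>\<^sub>\<infinity>l. if j \<le> l then x ^ (l - j) else 0) = 1 / (1 - x)"
    by (auto simp: summable_on_def infsumI)
qed

lemma infsum_diff_real:
  fixes f g :: "'a \<Rightarrow> real"
  assumes "f summable_on A" "g summable_on A"
  shows "(\<Sum>\<^sub>\<infinity>x\<in>A. f x - g x) = infsum f A - infsum g A"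
  using infsum_add[OF assms(1) summable_on_uminus[THEN iffD2, OF assms(2)]] by (simp add: infsum_uminus)

lemma abs_mult_le:
  fixes x y B C :: real
  shows "\<bar>x\<bar> \<le> B \<Longrightarrow> \<bar>y\<bar> \<le> C \<Longrightarrow> \<bar>x * y\<bar> \<le> B * C"
  unfolding abs_mult by (rule mult_mono) auto

lemma tendsto_zero_bounded_by:
  fixes f g :: "nat \<Rightarrow> real"
  assumes "g \<longlonglongrightarrow> 0" "\<And>k. \<bar>f k\<bar> \<le> g k"
  shows "f \<longlonglongrightarrow> 0"
  by (rule Lim_null_comparison[OF _ assms(1)]) (use assms(2) in simp)

lemma infsum_swap_product:
  fixes f :: "'a \<Rightarrow> 'b \<Rightarrow> real"
  assumes "\<And>x y. \<bar>f x y\<bar> \<le> u x * v y" and "u summable_on UNIV" and "v summable_on UNIV"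
  shows "(\<Sum>\<^sub>\<infinity>x. \<Sum>\<^sub>\<infinity>y. f x y) = (\<Sum>\<^sub>\<infinity>y. \<Sum>\<^sub>\<infinity>x. f x y)"
proof (rule infsum_swap_banach, rule summable_on_bounded_by(1))
  show "(\<lambda>(x, y). u x * v y) summable_on UNIV \<times> UNIV"
    by (rule summable_on_Times_mult[OF assms(2,3)])
qed (use assms(1) in auto)

lemma infsum_sum_real:
  fixes f :: "'a \<Rightarrow> 'b \<Rightarrow> real"
  assumes "\<And>x. x \<in> J \<Longrightarrow> f x summable_on A"
  shows "(\<lambda>y. \<Sum>x\<in>J. f x y) summable_on A" "(\<Sum>\<^sub>\<infinity>y\<in>A. \<Sum>x\<in>J. f x y) = (\<Sum>x\<in>J. \<Sum>\<^sub>\<infinity>y\<in>A. f x y)"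
proof -
  have "(\<lambda>y. \<Sum>x\<in>J. f x y) summable_on A \<and> (\<Sum>\<^sub>\<infinity>y\<in>A. \<Sum>x\<in>J. f x y) = (\<Sum>x\<in>J. \<Sum>\<^sub>\<infinity>y\<in>A. f x y)"
    using assms by (induction J rule: infinite_finite_induct) (auto simp: infsum_add summable_on_add)
  then show "(\<lambda>y. \<Sum>x\<in>J. f x y) summable_on A"
    "(\<Sum>\<^sub>\<infinity>y\<in>A. \<Sum>x\<in>J. f x y) = (\<Sum>x\<in>J. \<Sum>\<^sub>\<infinity>y\<in>A. f x y)"
    by auto
qed

lemma summable_on_finite_sums_le:
  fixes f :: "'a \<Rightarrow> real"
  assumes "\<And>x. 0 \<le> f x" and "\<And>J. finite J \<Longrightarrow> sum f J \<le> b"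
  shows "f summable_on UNIV" "infsum f UNIV \<le> b"
proof -
  show s: "f summable_on UNIV"
    using assms by (intro nonneg_bdd_above_summable_on) (auto simp: bdd_above_def)
  show "infsum f UNIV \<le> b"
    by (rule infsum_le_finite_sums[OF s]) (use assms in auto)
qed

lemma infsum_Times_mult:
  fixes u :: "'a \<Rightarrow> real" and v :: "'b \<Rightarrow> real"
  assumes "u summable_on UNIV" "v summable_on UNIV"
  shows "(\<Sum>\<^sub>\<infinity>(x, y). u x * v y) = infsum u UNIV * infsum v UNIV"
  using infsum_Sigma'_banach[OF summable_on_Times_mult[OF assms]]
  by (simp add: infsum_cmult_right' infsum_cmult_left')

section \<open>Young's inequality for a kernel with bounded marginals\<close>

text \<open>Weighted arithmetic-geometric mean by concavity: \<open>ln\<close> lies below its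
  tangent at the weighted mean \<open>m\<close>, and the linear parts add up to zero.\<close>

lemma powr_prod3_le:
  fixes u v w :: real
  assumes "0 < u" "0 < v" "0 < w" "0 \<le> \<alpha>" "0 \<le> \<beta>" "0 \<le> \<gamma>" "\<alpha> + \<beta> + \<gamma> = 1"
  shows "u powr \<alpha> * v powr \<beta> * w powr \<gamma> \<le> \<alpha> * u + \<beta> * v + \<gamma> * w"
proof -
  define m where "m = \<alpha> * u + \<beta> * v + \<gamma> * w"
  have nn: "0 \<le> \<alpha> * u" "0 \<le> \<beta> * v" "0 \<le> \<gamma> * w"
    using assms by simp_all
  have "0 < \<alpha> * u \<or> 0 < \<beta> * v \<or> 0 < \<gamma> * w"
    using assms by (auto simp: zero_less_mult_iff)
  then have "m > 0"
    unfolding m_def using nn by linarith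
  have ln: "t * ln x \<le> t * (x / m - 1 + ln m)" if "0 < x" "0 \<le> t" for x t
    using that ln_le_minus_one[of "x / m"] \<open>m > 0\<close> by (intro mult_left_mono) (auto simp: ln_div)
  have "\<alpha> * ln u + \<beta> * ln v + \<gamma> * ln w
      \<le> \<alpha> * (u / m - 1 + ln m) + \<beta> * (v / m - 1 + ln m) + \<gamma> * (w / m - 1 + ln m)"
    using ln[of u \<alpha>] ln[of v \<beta>] ln[of w \<gamma>] assms by linarith
  also have "\<dots> = m / m + (\<alpha> + \<beta> + \<gamma>) * (ln m - 1)"
  proof -
    have "m / m = (\<alpha> * u + \<beta> * v + \<gamma> * w) / m"
      by (simp only: m_def)
    then show ?thesis
      by (simp add: algebra_simps add_divide_distrib)
  qed
  also have "\<dots> = ln m"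
    using \<open>m > 0\<close> assms by simp
  finally have "exp (\<alpha> * ln u + \<beta> * ln v + \<gamma> * ln w) \<le> exp (ln m)"
    by simp
  then show ?thesis
    using assms \<open>m > 0\<close> by (simp add: m_def powr_def exp_add)
qed

lemma infsum_nonneg_pos:
  fixes x :: "'a \<Rightarrow> real"
  assumes "\<And>i. 0 \<le> x i" "x summable_on UNIV" "0 < x j"
  shows "0 < infsum x UNIV"
proof -
  have "sum x {j} \<le> infsum x UNIV"
    by (rule finite_sum_le_infsum) (use assms in auto)
  then show ?thesis
    using assms(3) by simp
qed

text \<open>Dividing \<open>x\<close>, \<open>y\<close>, \<open>z\<close> by their sums reduces the
  claim to the pointwise mean inequality, whose right-hand sides add up to 1. The assumption
  \<open>zero\<close> makes these sums positive as soon as \<open>t\<close> is nonzero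
  somewhere.\<close>

lemma holder3_infsum:
  fixes x y z t :: "'a \<Rightarrow> real"
  assumes nonneg: "\<And>i. 0 \<le> x i" "\<And>i. 0 \<le> y i" "\<And>i. 0 \<le> z i" "\<And>i. 0 \<le> t i"
    and sums: "x summable_on UNIV" "y summable_on UNIV" "z summable_on UNIV"
    and exps: "0 \<le> \<alpha>" "0 \<le> \<beta>" "0 \<le> \<gamma>" "\<alpha> + \<beta> + \<gamma> = 1"
    and le: "\<And>i. t i \<le> x i powr \<alpha> * y i powr \<beta> * z i powr \<gamma>"
    and zero: "\<And>i. t i \<noteq> 0 \<Longrightarrow> 0 < x i \<and> 0 < y i \<and> 0 < z i"
  shows "t summable_on UNIV"
    and "infsum t UNIV \<le> infsum x UNIV powr \<alpha> * infsum y UNIV powr \<beta> * infsum z UNIV powr \<gamma>"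
proof -
  define N where "N = infsum x UNIV powr \<alpha> * infsum y UNIV powr \<beta> * infsum z UNIV powr \<gamma>"
  have "t summable_on UNIV \<and> infsum t UNIV \<le> N"
  proof (cases "\<exists>i. t i \<noteq> 0")
    case False
    then have "t = (\<lambda>_. 0)"
      by auto
    then show ?thesis
      by (simp add: N_def)
  next
    case True
    then obtain j where "0 < x j" "0 < y j" "0 < z j"
      using zero by blast
    then have pos: "0 < infsum x UNIV" "0 < infsum y UNIV" "0 < infsum z UNIV"
      using infsum_nonneg_pos[OF nonneg(1) sums(1)] infsum_nonneg_pos[OF nonneg(2) sums(2)]
        infsum_nonneg_pos[OF nonneg(3) sums(3)] by simp_all
    then have N: "N > 0"
      by (simp add: N_def)
    define g where "g = (\<lambda>i. N * (\<alpha> * (x i / infsum x UNIV) + \<beta> * (y i / infsum y UNIV) + \<gamma> * (z i / infsum z UNIV)))"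
    have scaled: "((\<lambda>i. c * (v i / infsum v UNIV)) has_sum c) UNIV"
      if "v summable_on UNIV" "0 < infsum v UNIV" for c and v :: "'a \<Rightarrow> real"
      using has_sum_cmult_right[OF has_sum_infsum[OF that(1)], of "c / infsum v UNIV"] that(2) by simp
    have "(g has_sum (N * (\<alpha> + \<beta> + \<gamma>))) UNIV"
      unfolding g_def
      by (rule has_sum_cmult_right[OF has_sum_add[OF has_sum_add[OF scaled[OF sums(1) pos(1)]
            scaled[OF sums(2) pos(2)]] scaled[OF sums(3) pos(3)]]])
    then have g: "(g has_sum N) UNIV"
      using exps(4) by simp
    have tg: "t i \<le> g i" for i
    proof (cases "t i = 0")
      case True
      then show ?thesis
        using N pos nonneg exps by (simp add: g_def less_imp_le)
    next
      case False
      then have p: "0 < x i" "0 < y i" "0 < z i"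
        using zero by blast+
      have "x i powr \<alpha> * y i powr \<beta> * z i powr \<gamma>
          = N * ((x i / infsum x UNIV) powr \<alpha> * (y i / infsum y UNIV) powr \<beta> * (z i / infsum z UNIV) powr \<gamma>)"
        using p pos by (simp add: N_def powr_divide less_imp_le)
      also have "\<dots> \<le> g i"
        unfolding g_def using p pos exps N by (intro mult_left_mono powr_prod3_le) auto
      finally show ?thesis
        using le[of i] by linarith
    qed
    have "t summable_on UNIV" "\<bar>infsum t UNIV\<bar> \<le> infsum g UNIV"
      using summable_on_bounded_by[OF has_sum_imp_summable[OF g], of t] tg nonneg by auto
    then show ?thesis
      using infsumI[OF g] by auto
  qed
  then show "t summable_on UNIV"
    and "infsum t UNIV \<le> infsum x UNIV powr \<alpha> * infsum y UNIV powr \<beta> * infsum z UNIV powr \<gamma>"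
    by (auto simp: N_def)
qed

text \<open>Bounded row sums control the double sum, whose value does not depend on the order of
  summation. The variants serve the three Hoelder factors in \<open>young_kernel\<close>, each of
  which is summed in a different order.\<close>

lemma tonelli_le:
  fixes g :: "'a \<Rightarrow> 'b \<Rightarrow> real"
  assumes "\<And>x y. 0 \<le> g x y" "\<And>x. g x summable_on UNIV" "\<And>x. infsum (g x) UNIV \<le> u x" "u summable_on UNIV"
  shows "(\<lambda>(x, y). g x y) summable_on UNIV" "(\<lambda>(y, x). g x y) summable_on UNIV"
    "(\<Sum>\<^sub>\<infinity>(x, y). g x y) \<le> infsum u UNIV" "(\<Sum>\<^sub>\<infinity>(y, x). g x y) \<le> infsum u UNIV"
    "\<And>y. (\<lambda>x. g x y) summable_on UNIV"
    "(\<lambda>y. \<Sum>\<^sub>\<infinity>x. g x y) summable_on UNIV" "(\<Sum>\<^sub>\<infinity>y. \<Sum>\<^sub>\<infinity>x. g x y) \<le> infsum u UNIV"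
proof -
  have s: "(\<lambda>(x, y). g x y) summable_on UNIV \<times> UNIV"
    by (rule summable_on_Times_bounded_by[where g = g and u = u]) (use assms in auto)
  have s': "(\<lambda>(y, x). g x y) summable_on UNIV \<times> UNIV"
    using s summable_on_swap[of "\<lambda>(x, y). g x y" UNIV UNIV] by simp
  show "(\<lambda>(x, y). g x y) summable_on UNIV" "(\<lambda>(y, x). g x y) summable_on UNIV"
    using s s' by simp_all
  have sx: "(\<lambda>x. infsum (g x) UNIV) summable_on UNIV"
    using summable_on_Sigma_banach[OF s] by simp
  have "(\<Sum>\<^sub>\<infinity>(x, y). g x y) = (\<Sum>\<^sub>\<infinity>x. infsum (g x) UNIV)"
    using infsum_Sigma'_banach[OF s] by simp
  also have "\<dots> \<le> infsum u UNIV"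
    by (intro infsum_mono sx assms)
  finally show 1: "(\<Sum>\<^sub>\<infinity>(x, y). g x y) \<le> infsum u UNIV" .
  show "\<And>y. (\<lambda>x. g x y) summable_on UNIV"
    using summable_on_SigmaD1[OF s'] by auto
  show "(\<lambda>y. \<Sum>\<^sub>\<infinity>x. g x y) summable_on UNIV"
    using summable_on_Sigma_banach[OF s'] by simp
  have 2: "(\<Sum>\<^sub>\<infinity>y. \<Sum>\<^sub>\<infinity>x. g x y) = (\<Sum>\<^sub>\<infinity>(y, x). g x y)"
    using infsum_Sigma'_banach[OF s'] by simp
  have 3: "(\<Sum>\<^sub>\<infinity>y. \<Sum>\<^sub>\<infinity>x. g x y) = (\<Sum>\<^sub>\<infinity>(x, y). g x y)"
    using infsum_swap_banach[OF s'] infsum_Sigma'_banach[OF s] by simp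
  show "(\<Sum>\<^sub>\<infinity>(y, x). g x y) \<le> infsum u UNIV" "(\<Sum>\<^sub>\<infinity>y. \<Sum>\<^sub>\<infinity>x. g x y) \<le> infsum u UNIV"
    using 1 2 3 by simp_all
qed

text \<open>For fixed \<open>a\<close>, Hoelder with exponents 1/s, 1 - 1/r, 1 - 1/p is applied to
  the products F^p G^r K, F^p K and G^r K. The last two sums are bounded through the marginals in
  \<open>d\<close> and in \<open>b\<close>; the first is summed over \<open>a\<close> at the end and
  uses the remaining marginal.\<close>

lemma young_kernel:
  fixes F G \<mu> :: "'a \<Rightarrow> real" and K :: "'a \<Rightarrow> 'a \<Rightarrow> 'a \<Rightarrow> real"
  assumes exps: "1 \<le> p" "1 \<le> r" "1 \<le> s" "1 / p + 1 / r - 1 = 1 / s"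
    and nonneg: "\<And>n. 0 \<le> F n" "\<And>n. 0 \<le> G n" "\<And>n. 0 < \<mu> n" "\<And>a b d. 0 \<le> K a b d"
    and lp: "(\<lambda>n. \<mu> n * F n powr p) summable_on UNIV" "(\<lambda>n. \<mu> n * G n powr r) summable_on UNIV"
    and K: "\<And>b d. (\<lambda>a. \<mu> a * K a b d) summable_on UNIV" "\<And>b d. (\<Sum>\<^sub>\<infinity>a. \<mu> a * K a b d) \<le> M"
      "\<And>a d. (\<lambda>b. \<mu> b * K a b d) summable_on UNIV" "\<And>a d. (\<Sum>\<^sub>\<infinity>b. \<mu> b * K a b d) \<le> M"
      "\<And>a b. (\<lambda>d. \<mu> d * K a b d) summable_on UNIV" "\<And>a b. (\<Sum>\<^sub>\<infinity>d. \<mu> d * K a b d) \<le> M"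
  defines "C \<equiv> \<lambda>a. \<Sum>\<^sub>\<infinity>(b, d). \<mu> b * \<mu> d * F b * G d * K a b d"
  shows "\<And>a. (\<lambda>(b, d). \<mu> b * \<mu> d * F b * G d * K a b d) summable_on UNIV"
    and "(\<lambda>a. \<mu> a * C a powr s) summable_on UNIV"
    and "(\<Sum>\<^sub>\<infinity>a. \<mu> a * C a powr s) powr (1 / s)
      \<le> M * (\<Sum>\<^sub>\<infinity>n. \<mu> n * F n powr p) powr (1 / p) * (\<Sum>\<^sub>\<infinity>n. \<mu> n * G n powr r) powr (1 / r)"
proof -
  define P where "P = (\<Sum>\<^sub>\<infinity>n. \<mu> n * F n powr p)"
  define R where "R = (\<Sum>\<^sub>\<infinity>n. \<mu> n * G n powr r)"
  define X where "X = (\<lambda>a (b, d). (\<mu> b * F b powr p) * (\<mu> d * G d powr r) * (\<mu> a * K a b d))"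
  define Y where "Y = (\<lambda>a (b, d). (\<mu> b * F b powr p) * (\<mu> d * K a b d))"
  define W where "W = (\<lambda>a (b, d). (\<mu> d * G d powr r) * (\<mu> b * K a b d))"
  define T where "T = (\<lambda>a (b, d). \<mu> a powr (1 / s) * (\<mu> b * \<mu> d * F b * G d * K a b d))"
  define \<beta> where "\<beta> = 1 - 1 / r"
  define \<gamma> where "\<gamma> = 1 - 1 / p"
  note \<mu>0 = nonneg(3)[THEN less_imp_le]
  have P0: "P \<ge> 0" and R0: "R \<ge> 0"
    unfolding P_def R_def by (intro infsum_nonneg mult_nonneg_nonneg \<mu>0 powr_ge_zero)+
  \<comment> \<open>Any marginal sum is nonnegative, so one index is enough;
    \<open>undefined\<close> supplies it.\<close>
  have M0: "M \<ge> 0"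
    using K(2)[of undefined undefined] infsum_nonneg[of UNIV "\<lambda>a. \<mu> a * K a undefined undefined"] \<mu>0 nonneg(4)
    by (meson mult_nonneg_nonneg order_trans)
  have bg: "0 \<le> \<beta>" "0 \<le> \<gamma>" "1 / s + \<beta> + \<gamma> = 1" "0 < 1 / s"
    using exps by (auto simp: \<beta>_def \<gamma>_def)
  have Xx: "(\<lambda>a. X a bd) summable_on UNIV"
    "(\<Sum>\<^sub>\<infinity>a. X a bd) \<le> (case bd of (b, d) \<Rightarrow> (\<mu> b * F b powr p) * (\<mu> d * G d powr r)) * M" for bd
  proof -
    obtain b d where bd: "bd = (b, d)"
      by (cases bd)
    show "(\<lambda>a. X a bd) summable_on UNIV"
      unfolding X_def bd prod.case by (intro summable_on_cmult_right K)
    show "(\<Sum>\<^sub>\<infinity>a. X a bd) \<le> (case bd of (b, d) \<Rightarrow> (\<mu> b * F b powr p) * (\<mu> d * G d powr r)) * M"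
      unfolding X_def bd prod.case infsum_cmult_right'
      by (intro mult_left_mono K mult_nonneg_nonneg \<mu>0 powr_ge_zero)
  qed
  have Xu: "(\<lambda>bd. (case bd of (b, d) \<Rightarrow> (\<mu> b * F b powr p) * (\<mu> d * G d powr r)) * M) summable_on UNIV"
    using summable_on_Times_mult[OF lp] by (intro summable_on_cmult_left) simp
  have Xinf: "(\<Sum>\<^sub>\<infinity>bd. (case bd of (b, d) \<Rightarrow> (\<mu> b * F b powr p) * (\<mu> d * G d powr r)) * M) = P * R * M"
    unfolding infsum_cmult_left' using infsum_Sigma'_banach[OF summable_on_Times_mult[OF lp]]
    by (simp add: infsum_cmult_right' infsum_cmult_left' P_def R_def)
  have X0: "0 \<le> X a bd" for a bd
    by (cases bd) (auto simp: X_def intro!: mult_nonneg_nonneg \<mu>0 nonneg)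
  note Xt = tonelli_le[of "\<lambda>bd a. X a bd", OF X0 Xx Xu, unfolded Xinf]
  have Yt: "Y a summable_on UNIV" "infsum (Y a) UNIV \<le> P * M" for a
  proof -
    have *: "(\<lambda>d. (\<mu> b * F b powr p) * (\<mu> d * K a b d)) summable_on UNIV"
      "(\<Sum>\<^sub>\<infinity>d. (\<mu> b * F b powr p) * (\<mu> d * K a b d)) \<le> (\<mu> b * F b powr p) * M" for b
      unfolding infsum_cmult_right'
      by (intro summable_on_cmult_right K) (intro mult_left_mono K mult_nonneg_nonneg \<mu>0 powr_ge_zero)
    have **: "0 \<le> (\<mu> b * F b powr p) * (\<mu> d * K a b d)" for b d
      by (intro mult_nonneg_nonneg \<mu>0 nonneg powr_ge_zero)
    note t = tonelli_le[of "\<lambda>b d. (\<mu> b * F b powr p) * (\<mu> d * K a b d)", OF ** * summable_on_cmult_left[OF lp(1)]]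
    show "Y a summable_on UNIV" "infsum (Y a) UNIV \<le> P * M"
      using t(1,3) unfolding Y_def infsum_cmult_left' P_def by simp_all
  qed
  have Wt: "W a summable_on UNIV" "infsum (W a) UNIV \<le> R * M" for a
  proof -
    have *: "(\<lambda>b. (\<mu> d * G d powr r) * (\<mu> b * K a b d)) summable_on UNIV"
      "(\<Sum>\<^sub>\<infinity>b. (\<mu> d * G d powr r) * (\<mu> b * K a b d)) \<le> (\<mu> d * G d powr r) * M" for d
      unfolding infsum_cmult_right'
      by (intro summable_on_cmult_right K) (intro mult_left_mono K mult_nonneg_nonneg \<mu>0 powr_ge_zero)
    have **: "0 \<le> (\<mu> d * G d powr r) * (\<mu> b * K a b d)" for b d
      by (intro mult_nonneg_nonneg \<mu>0 nonneg powr_ge_zero)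
    note t = tonelli_le[of "\<lambda>d b. (\<mu> d * G d powr r) * (\<mu> b * K a b d)", OF ** * summable_on_cmult_left[OF lp(2)]]
    show "W a summable_on UNIV" "infsum (W a) UNIV \<le> R * M"
      using t(2,4) unfolding W_def infsum_cmult_left' R_def by simp_all
  qed
  have Y0: "0 \<le> Y a bd" and W0: "0 \<le> W a bd" and T0: "0 \<le> T a bd" for a bd
    by (cases bd; auto simp: Y_def W_def T_def intro!: mult_nonneg_nonneg \<mu>0 nonneg)+
  have T: "T a summable_on UNIV"
    "infsum (T a) UNIV \<le> infsum (X a) UNIV powr (1 / s) * infsum (Y a) UNIV powr \<beta> * infsum (W a) UNIV powr \<gamma>" for a
  proof -
    have X: "X a summable_on UNIV"
      using Xt(5)[of a] by simp
    have pos: "0 < X a bd \<and> 0 < Y a bd \<and> 0 < W a bd" if "T a bd \<noteq> 0" for bd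
    proof -
      obtain b d where bd: "bd = (b, d)"
        by (cases bd)
      have "F b > 0" "G d > 0" "K a b d > 0"
        using that nonneg by (auto simp: T_def bd less_le)
      then show ?thesis
        using nonneg(3) by (simp add: X_def Y_def W_def bd)
    qed
    have le: "T a bd \<le> X a bd powr (1 / s) * Y a bd powr \<beta> * W a bd powr \<gamma>" for bd
    proof (cases "T a bd = 0")
      case True
      then show ?thesis
        by simp
    next
      case False
      obtain b d where bd: "bd = (b, d)"
        by (cases bd)
      have p: "F b > 0" "G d > 0" "K a b d > 0"
        using False nonneg by (auto simp: T_def bd less_le)
      \<comment> \<open>With these identities the powers of \<open>F b\<close> and of
        \<open>G d\<close> in the product of the three factors collapse to the first power.\<close>
      have e1: "p / s + p * \<beta> = 1" "r / s + r * \<gamma> = 1"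
      proof -
        have "p / s + p * \<beta> = p * (1 / s + 1 - 1 / r)" "r / s + r * \<gamma> = r * (1 / s + 1 - 1 / p)"
          by (simp_all add: \<beta>_def \<gamma>_def algebra_simps)
        moreover have "1 / s + 1 - 1 / r = 1 / p" "1 / s + 1 - 1 / p = 1 / r"
          using exps(4) by linarith+
        ultimately show "p / s + p * \<beta> = 1" "r / s + r * \<gamma> = 1"
          using exps by simp_all
      qed
      have "X a bd powr (1 / s) * Y a bd powr \<beta> * W a bd powr \<gamma>
          = \<mu> a powr (1 / s) * (\<mu> b powr (1 / s) * \<mu> b powr \<beta> * \<mu> b powr \<gamma>)
            * (\<mu> d powr (1 / s) * \<mu> d powr \<beta> * \<mu> d powr \<gamma>)
            * (F b powr (p / s) * F b powr (p * \<beta>)) * (G d powr (r / s) * G d powr (r * \<gamma>))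
            * (K a b d powr (1 / s) * K a b d powr \<beta> * K a b d powr \<gamma>)"
        using p \<mu>0 by (simp add: X_def Y_def W_def bd powr_mult powr_powr mult_ac less_imp_le)
      also have "\<dots> = T a bd"
      proof -
        have "\<beta> * p + p / s = 1" "\<gamma> * r + r / s = 1" "\<gamma> + (\<beta> + 1 / s) = 1"
          using e1 bg(3) by (simp_all add: add_ac mult_ac)
        then show ?thesis
          using p nonneg(3)[of b] nonneg(3)[of d]
          by (simp add: powr_add[symmetric] T_def bd add_ac mult_ac)
      qed
      finally show ?thesis
        by simp
    qed
    show "T a summable_on UNIV"
      "infsum (T a) UNIV \<le> infsum (X a) UNIV powr (1 / s) * infsum (Y a) UNIV powr \<beta> * infsum (W a) UNIV powr \<gamma>"
      using holder3_infsum[of "X a" "Y a" "W a" "T a" "1 / s" \<beta> \<gamma>] X0 Y0 W0 T0 X Yt(1) Wt(1) bg le pos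
      by (auto simp: less_imp_le)
  qed
  have TC: "(\<lambda>(b, d). \<mu> b * \<mu> d * F b * G d * K a b d) = (\<lambda>bd. (1 / \<mu> a powr (1 / s)) * T a bd)" for a
    using nonneg(3)[of a] by (auto simp: T_def fun_eq_iff)
  show sC: "\<And>a. (\<lambda>(b, d). \<mu> b * \<mu> d * F b * G d * K a b d) summable_on UNIV"
    unfolding TC by (intro summable_on_cmult_right T)
  have C0: "C a \<ge> 0" for a
    unfolding C_def by (intro infsum_nonneg) (auto intro!: mult_nonneg_nonneg \<mu>0 nonneg)
  \<comment> \<open>The bounds for the \<open>Y\<close> and \<open>W\<close> sums, raised to the
    power \<open>s\<close>. They do not depend on \<open>a\<close>, so \<open>CX\<close> can be
    summed over \<open>a\<close>.\<close>
  define c where "c = (P * M) powr (\<beta> * s) * (R * M) powr (\<gamma> * s)"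
  have CX: "\<mu> a * C a powr s \<le> infsum (X a) UNIV * c" for a
  proof -
    have "\<mu> a powr (1 / s) * C a = infsum (T a) UNIV"
      unfolding C_def TC infsum_cmult_right' using nonneg(3)[of a] by simp
    also have "\<dots> \<le> infsum (X a) UNIV powr (1 / s) * (P * M) powr \<beta> * (R * M) powr \<gamma>"
      by (rule order_trans[OF T(2)])
        (intro mult_mono powr_mono2 Yt Wt infsum_nonneg mult_nonneg_nonneg powr_ge_zero order_refl bg Y0 W0)
    finally have "(\<mu> a powr (1 / s) * C a) powr s \<le> (infsum (X a) UNIV powr (1 / s) * (P * M) powr \<beta> * (R * M) powr \<gamma>) powr s"
      using C0 exps by (intro powr_mono2) auto
    moreover have "(\<mu> a powr (1 / s) * C a) powr s = \<mu> a * C a powr s"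
      using C0[of a] \<mu>0[of a] nonneg(3)[of a] exps by (simp add: powr_mult powr_powr)
    moreover have "(infsum (X a) UNIV powr (1 / s) * (P * M) powr \<beta> * (R * M) powr \<gamma>) powr s = infsum (X a) UNIV * c"
      using infsum_nonneg[of UNIV "X a"] X0 exps by (simp add: c_def powr_mult powr_powr mult_ac)
    ultimately show ?thesis
      by simp
  qed
  have Xc: "(\<lambda>a. infsum (X a) UNIV * c) summable_on UNIV"
    using Xt(6) by (intro summable_on_cmult_left) simp
  show "(\<lambda>a. \<mu> a * C a powr s) summable_on UNIV"
    by (rule summable_on_bounded_by(1)[OF Xc]) (use CX \<mu>0 in \<open>auto simp: abs_mult\<close>)
  have "(\<Sum>\<^sub>\<infinity>a. \<mu> a * C a powr s) \<le> (\<Sum>\<^sub>\<infinity>a. infsum (X a) UNIV * c)"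
    using summable_on_bounded_by(3)[OF Xc, of "\<lambda>a. \<mu> a * C a powr s"] CX \<mu>0 by (auto simp: abs_mult)
  also have "\<dots> \<le> P * R * M * c"
    unfolding infsum_cmult_left' using Xt(7) by (intro mult_right_mono) (auto simp: c_def)
  finally have "(\<Sum>\<^sub>\<infinity>a. \<mu> a * C a powr s) powr (1 / s) \<le> (P * R * M * c) powr (1 / s)"
    using exps by (intro powr_mono2 infsum_nonneg mult_nonneg_nonneg \<mu>0) auto
  \<comment> \<open>\<open>powr\<close> vanishes at base 0, so both sides are 0 in the degenerate
    case; otherwise the exponents of each base are added.\<close>
  also have "(P * R * M * c) powr (1 / s) = M * P powr (1 / p) * R powr (1 / r)"
  proof (cases "P = 0 \<or> R = 0 \<or> M = 0")
    case True
    then show ?thesis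
      by auto
  next
    case False
    then have pos: "P > 0" "R > 0" "M > 0"
      using P0 R0 M0 by auto
    have "(P * R * M * c) powr (1 / s) = (P powr (1 / s) * P powr \<beta>) * (R powr (1 / s) * R powr \<gamma>)
        * (M powr (1 / s) * M powr \<beta> * M powr \<gamma>)"
      using pos exps by (simp add: c_def powr_mult powr_powr mult_ac)
    also have "\<dots> = M * P powr (1 / p) * R powr (1 / r)"
    proof -
      have "1 / s + \<beta> = 1 / p" "1 / s + \<gamma> = 1 / r"
        using exps(4) by (simp_all add: \<beta>_def \<gamma>_def)
      then show ?thesis
        using pos bg(3) by (simp add: powr_add[symmetric])
    qed
    finally show ?thesis .
  qed
  finally show "(\<Sum>\<^sub>\<infinity>a. \<mu> a * C a powr s) powr (1 / s)
      \<le> M * (\<Sum>\<^sub>\<infinity>n. \<mu> n * F n powr p) powr (1 / p) * (\<Sum>\<^sub>\<infinity>n. \<mu> n * G n powr r) powr (1 / r)"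
    by (simp add: P_def R_def)
qed

section \<open>Euler's expansion of the q-factorial\<close>

locale q_base =
  fixes Q :: real
  assumes Q_pos: "0 < Q" and Q_lt1: "Q < 1"
begin

lemma Q_power_le1: "Q ^ n \<le> 1" "Q ^ Suc n < 1"
  using Q_pos Q_lt1 power_Suc_less_one[of Q n] by (auto intro: power_le_one)

lemma convergent_prod_qpoch: "convergent_prod (\<lambda>k. 1 - x * Q ^ k)"
proof -
  have "summable (\<lambda>k. norm ((1 - x * Q ^ k) - 1))"
    using Q_pos Q_lt1 summable_mult[OF summable_geometric[of Q], of "\<bar>x\<bar>"] by (simp add: abs_mult)
  then show ?thesis
    by (intro abs_convergent_prod_imp_convergent_prod summable_imp_abs_convergent_prod)
qed

lemma qpoch_tendsto: "(\<lambda>n. qpoch x Q n) \<longlonglongrightarrow> qpoch_inf x Q"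
proof -
  have "(\<lambda>n. qpoch x Q (Suc n)) \<longlonglongrightarrow> qpoch_inf x Q"
    using convergent_prod_LIMSEQ[OF convergent_prod_qpoch[of x]]
    by (simp add: qpoch_def qpoch_inf_def lessThan_Suc_atMost)
  then show ?thesis
    by (simp only: filterlim_sequentially_Suc)
qed

lemma qpoch_Suc: "qpoch x Q (Suc n) = qpoch x Q n * (1 - x * Q ^ n)"
  by (simp add: qpoch_def)

lemma qpoch_0 [simp]: "qpoch x Q 0 = 1"
  by (simp add: qpoch_def)

lemma factor_pos: "0 \<le> x \<Longrightarrow> x < 1 \<Longrightarrow> 0 < 1 - x * Q ^ k"
  using Q_power_le1(1)[of k] Q_pos mult_right_le_one_le[of x "Q ^ k"] by simp

lemma qpoch_pos: "0 \<le> x \<Longrightarrow> x < 1 \<Longrightarrow> 0 < qpoch x Q n"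
  by (auto simp: qpoch_def intro!: prod_pos factor_pos)

lemma qpoch_inf_pos: "0 \<le> x \<Longrightarrow> x < 1 \<Longrightarrow> 0 < qpoch_inf x Q"
proof -
  assume x: "0 \<le> x" "x < 1"
  have "qpoch_inf x Q \<noteq> 0"
    unfolding qpoch_inf_def
    by (rule prodinf_nonzero[OF convergent_prod_qpoch]) (metis factor_pos[OF x] less_irrefl)
  moreover have "0 \<le> qpoch_inf x Q"
    by (rule LIMSEQ_le_const[OF qpoch_tendsto]) (use qpoch_pos[OF x] in \<open>auto intro: less_imp_le\<close>)
  ultimately show ?thesis
    by simp
qed

lemma qpoch_inf_le_qpoch: "0 \<le> x \<Longrightarrow> x < 1 \<Longrightarrow> qpoch_inf x Q \<le> qpoch x Q n"
proof -
  assume x: "0 \<le> x" "x < 1"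
  have "decseq (qpoch x Q)"
    using qpoch_pos[OF x] x Q_pos
    by (intro decseq_SucI) (auto simp: qpoch_Suc intro!: mult_right_le_one_le simp: factor_pos less_imp_le)
  then show ?thesis
    using decseq_ge qpoch_tendsto by blast
qed

lemma qpoch_inf_ge1: "x \<le> 0 \<Longrightarrow> 1 \<le> qpoch_inf x Q"
proof (rule LIMSEQ_le_const[OF qpoch_tendsto], intro exI allI impI)
  fix n assume "x \<le> 0"
  then show "1 \<le> qpoch x Q n"
    using Q_pos unfolding qpoch_def by (intro prod_ge_1) (auto simp: mult_nonpos_nonneg)
qed

text \<open>The exponent l (l - 1) / 2 is kept as a sum, so that passing to \<open>Suc l\<close>
  adds exactly \<open>l\<close>.\<close>

definition ecoeff :: "nat \<Rightarrow> real" where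
  "ecoeff l = (-1) ^ l * Q ^ (\<Sum>i<l. i) / qpoch Q Q l"

lemma qpoch_Q_pos: "0 < qpoch Q Q l"
  using qpoch_pos Q_pos Q_lt1 by simp

lemma ecoeff_Suc: "ecoeff (Suc l) * (1 - Q ^ Suc l) = - (Q ^ l * ecoeff l)"
  using qpoch_Q_pos[of l] Q_power_le1(2)[of l]
  by (simp add: ecoeff_def qpoch_Suc power_add divide_simps)

lemma ecoeff_0 [simp]: "ecoeff 0 = 1"
  by (simp add: ecoeff_def)

lemma abs_ecoeff: "\<bar>ecoeff l\<bar> = (-1) ^ l * ecoeff l"
  using qpoch_Q_pos[of l] Q_pos by (simp add: ecoeff_def abs_mult power_abs power_mult_distrib[symmetric])

text \<open>The triangular exponent is at least l - 1, hence the 1 / Q; the denominators are bounded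
  below by their limit.\<close>

lemma abs_ecoeff_le: "\<bar>ecoeff l\<bar> \<le> 1 / (Q * qpoch_inf Q Q) * Q ^ l"
proof -
  have "l \<le> Suc (\<Sum>i<l. i)"
    by (induction l) auto
  then have "Q ^ Suc (\<Sum>i<l. i) \<le> Q ^ l"
    using Q_pos Q_lt1 by (intro power_decreasing) auto
  then have "Q ^ (\<Sum>i<l. i) \<le> Q ^ l / Q"
    using Q_pos by (simp add: field_simps)
  then have "Q ^ (\<Sum>i<l. i) / qpoch Q Q l \<le> Q ^ l / Q / qpoch_inf Q Q"
    using Q_pos Q_lt1 by (intro frac_le qpoch_inf_le_qpoch qpoch_inf_pos) auto
  then show ?thesis
    using qpoch_Q_pos[of l] Q_pos by (simp add: ecoeff_def abs_mult)
qed

lemma summable_ecoeff: "summable (\<lambda>l. \<bar>ecoeff l\<bar> * \<bar>x\<bar> ^ l)"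
proof -
  have "(\<lambda>l. Q ^ l * \<bar>x\<bar>) \<longlonglongrightarrow> 0 * \<bar>x\<bar>"
    using Q_pos Q_lt1 by (intro tendsto_mult LIMSEQ_realpow_zero tendsto_const) auto
  \<comment> \<open>Consecutive terms have ratio Q^l |x| / (1 - Q^(l+1)), and the denominator is at
    least 1 - Q; this threshold brings the ratio down to 1/2.\<close>
  then have "\<forall>\<^sub>F l in sequentially. Q ^ l * \<bar>x\<bar> < (1 - Q) / 2"
    using Q_lt1 order_tendstoD(2)[of "\<lambda>l. Q ^ l * \<bar>x\<bar>" 0 sequentially "(1 - Q) / 2"] by simp
  then obtain N where N: "\<And>l. l \<ge> N \<Longrightarrow> Q ^ l * \<bar>x\<bar> < (1 - Q) / 2"
    by (auto simp: eventually_sequentially)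
  show ?thesis
  proof (rule summable_ratio_test[of "1 / 2" N])
    fix l assume l: "N \<le> l"
    have p: "0 < 1 - Q ^ Suc l" "1 - Q \<le> 1 - Q ^ Suc l"
      using Q_power_le1 Q_pos mult_left_le[of "Q ^ l" Q] by auto
    have "\<bar>ecoeff (Suc l)\<bar> * (1 - Q ^ Suc l) = Q ^ l * \<bar>ecoeff l\<bar>"
      using arg_cong[OF ecoeff_Suc[of l], of abs] p Q_pos by (simp add: abs_mult)
    from arg_cong[OF this, of "\<lambda>t. t * \<bar>x\<bar>"]
    have "\<bar>ecoeff (Suc l)\<bar> * \<bar>x\<bar> * (1 - Q ^ Suc l) = (Q ^ l * \<bar>x\<bar>) * \<bar>ecoeff l\<bar>"
      by (simp only: mult_ac)
    also have "\<dots> \<le> ((1 - Q) / 2) * \<bar>ecoeff l\<bar>"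
      by (rule mult_right_mono) (use N[OF l] in auto)
    also have "\<dots> \<le> ((1 - Q ^ Suc l) / 2) * \<bar>ecoeff l\<bar>"
      by (rule mult_right_mono) (use p(2) in auto)
    also have "\<dots> = \<bar>ecoeff l\<bar> / 2 * (1 - Q ^ Suc l)"
      by simp
    finally have "\<bar>ecoeff (Suc l)\<bar> * \<bar>x\<bar> \<le> \<bar>ecoeff l\<bar> / 2"
      by (rule mult_right_le_imp_le) (rule p(1))
    from mult_right_mono[OF this, of "\<bar>x\<bar> ^ l"]
    show "norm (\<bar>ecoeff (Suc l)\<bar> * \<bar>x\<bar> ^ Suc l) \<le> 1 / 2 * norm (\<bar>ecoeff l\<bar> * \<bar>x\<bar> ^ l)"
      by (simp add: abs_mult mult_ac)
  qed simp
qed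

lemma summable_ecoeff': "summable (\<lambda>l. ecoeff l * x ^ l)"
  by (rule summable_norm_cancel) (use summable_ecoeff[of x] in \<open>simp add: abs_mult power_abs\<close>)

definition euler :: "real \<Rightarrow> real" where
  "euler x = (\<Sum>l. ecoeff l * x ^ l)"

text \<open>In \<open>euler x - euler (Q * x)\<close> the coefficients become
  \<open>ecoeff l * (1 - Q ^ l)\<close>, which \<open>ecoeff_Suc\<close> turns into a shifted copy
  of the original ones.\<close>

lemma euler_rec: "euler x = (1 - x) * euler (Q * x)"
proof -
  have s: "summable (\<lambda>l. ecoeff l * (1 - Q ^ l) * x ^ l)"
    using summable_diff[OF summable_ecoeff'[of x] summable_ecoeff'[of "Q * x"]]
    by (simp add: algebra_simps power_mult_distrib)
  have "euler x - euler (Q * x) = (\<Sum>l. ecoeff l * (1 - Q ^ l) * x ^ l)"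
    unfolding euler_def suminf_diff[OF summable_ecoeff' summable_ecoeff']
    by (simp add: algebra_simps power_mult_distrib)
  also have "\<dots> = (\<Sum>l. ecoeff (Suc l) * (1 - Q ^ Suc l) * x ^ Suc l)"
    using suminf_split_head[OF s] by simp
  also have "\<dots> = (\<Sum>l. - x * (ecoeff l * (Q * x) ^ l))"
    unfolding ecoeff_Suc by (simp add: algebra_simps power_mult_distrib)
  also have "\<dots> = - x * euler (Q * x)"
    unfolding euler_def by (rule suminf_mult[OF summable_ecoeff'])
  finally show ?thesis
    by (simp add: algebra_simps)
qed

lemma euler_qpoch: "euler x = qpoch x Q n * euler (x * Q ^ n)"
proof (induction n)
  case (Suc n)
  then show ?case
    using euler_rec[of "x * Q ^ n"] by (simp add: qpoch_Suc mult_ac)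
qed simp

text \<open>Iterating the functional equation splits off \<open>qpoch x Q n\<close> and drives the
  argument to 0, where the power series is continuous with value 1.\<close>

lemma euler_eq: "euler x = qpoch_inf x Q"
proof -
  have "isCont (\<lambda>x. \<Sum>l. ecoeff l * x ^ l) 0"
    by (rule isCont_powser[where K = 1]) (use summable_ecoeff'[of 1] in auto)
  then have "isCont euler 0"
    by (simp add: euler_def[abs_def])
  moreover have "(\<lambda>n. x * Q ^ n) \<longlonglongrightarrow> x * 0"
    using Q_pos Q_lt1 by (intro tendsto_mult LIMSEQ_realpow_zero tendsto_const) auto
  ultimately have "(\<lambda>n. euler (x * Q ^ n)) \<longlonglongrightarrow> euler 0"
    by (intro isCont_tendsto_compose[of 0 euler]) auto
  from tendsto_mult[OF qpoch_tendsto[of x] this]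
  have "(\<lambda>n. euler x) \<longlonglongrightarrow> qpoch_inf x Q * euler 0"
    by (simp only: euler_qpoch[of x, symmetric])
  moreover have "euler 0 = 1"
    unfolding euler_def using powser_zero[of ecoeff] by simp
  ultimately show ?thesis
    by (metis LIMSEQ_const_iff mult.right_neutral)
qed

section \<open>The coefficients of 1 / (x; Q)_inf, extended by zero to the integers\<close>

definition H :: real where "H = 1 / qpoch_inf Q Q"

definition h :: "int \<Rightarrow> real" where
  "h n = (if n < 0 then 0 else 1 / qpoch Q Q (nat n))"

lemma H_pos: "0 < H"
  using qpoch_inf_pos Q_pos Q_lt1 by (simp add: H_def)

lemma h_nonneg: "0 \<le> h n" and h_le: "h n \<le> H"
  using qpoch_Q_pos[of "nat n"] H_pos qpoch_inf_le_qpoch[of Q "nat n"] qpoch_inf_pos[of Q] Q_pos Q_lt1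
  by (auto simp: h_def H_def divide_simps)

text \<open>This is the functional equation of 1 / (x; Q)_inf under x to Qx, read off
  coefficientwise. The extension by zero makes it hold at every integer: at 0 it reads 1 - 0 =
  1.\<close>

lemma h_diff: "h n - h (n - 1) = Q powi n * h n"
proof (cases "n \<le> 0")
  case True
  then show ?thesis
    by (cases "n = 0") (auto simp: h_def)
next
  case False
  define k where "k = nat (n - 1)"
  with False have k: "n = int (Suc k)"
    by simp
  have e: "h n = 1 / qpoch Q Q (Suc k)" "h (n - 1) = 1 / qpoch Q Q k" "Q powi n = Q ^ Suc k"
    unfolding k power_int_of_nat by (simp_all add: h_def nat_add_distrib)
  have "1 / (u * (1 - v)) - 1 / u = v * (1 / (u * (1 - v)))" if "0 < u" "v < 1" for u v :: real
    using that by (simp add: divide_simps)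
  from this[OF qpoch_Q_pos[of k] Q_power_le1(2)[of k]] show ?thesis
    unfolding e qpoch_Suc by simp
qed

text \<open>The closed form (Q^(n+1); Q)_inf / (Q; Q)_inf explains the extension by zero: for
  \<open>n < 0\<close> the product contains the factor 1 - Q^0. It is the bridge from the Bessel
  series to \<open>phi\<close> in \<open>bessel_has_sum\<close>.\<close>

lemma h_eq_euler: "h n = H * euler (Q powi (n + 1))"
proof (cases "n < 0")
  case True
  define m where "m = nat (- n - 1)"
  have "euler (Q powi (n + 1)) = qpoch (Q powi (n + 1)) Q (Suc m) * euler (Q powi (n + 1) * Q ^ Suc m)"
    by (rule euler_qpoch)
  moreover have "Q powi (n + 1) * Q ^ m = 1"
  proof -
    have "Q powi (n + 1) * Q powi int m = Q powi (n + 1 + int m)"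
      using Q_pos by (subst power_int_add) auto
    also have "n + 1 + int m = 0"
      using True by (simp add: m_def)
    finally show ?thesis
      by simp
  qed
  ultimately show ?thesis
    using True by (simp add: h_def qpoch_Suc)
next
  case False
  then have "euler Q = qpoch Q Q (nat n) * euler (Q powi (n + 1))"
    using euler_qpoch[of Q "nat n"] by (simp add: power_int_nonneg_exp nat_add_distrib)
  then show ?thesis
    using False qpoch_Q_pos[of "nat n"] qpoch_inf_pos[of Q] Q_pos Q_lt1
    by (auto simp: h_def H_def euler_eq field_simps)
qed

lemma h_tendsto: "(\<lambda>m. h (n + int m)) \<longlonglongrightarrow> H"
proof -
  have "(\<lambda>m. 1 / qpoch Q Q m) \<longlonglongrightarrow> H"
    unfolding H_def using qpoch_inf_pos[of Q] Q_pos Q_lt1 by (intro tendsto_divide tendsto_const qpoch_tendsto) auto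
  then have "(\<lambda>m. h (int m)) \<longlonglongrightarrow> H"
    by (simp add: h_def)
  then have "(\<lambda>m. h (n + int (m + nat \<bar>n\<bar>))) \<longlonglongrightarrow> H"
  proof -
    assume l: "(\<lambda>m. h (int m)) \<longlonglongrightarrow> H"
    have "(\<lambda>m. h (int (m + nat (n + \<bar>n\<bar>)))) \<longlonglongrightarrow> H"
      by (rule LIMSEQ_ignore_initial_segment[OF l])
    moreover have "int (m + nat (n + \<bar>n\<bar>)) = n + int (m + nat \<bar>n\<bar>)" for m
      by linarith
    ultimately show ?thesis
      by (simp only:)
  qed
  then show ?thesis
    using LIMSEQ_offset[of "\<lambda>m. h (n + int m)" "nat \<bar>n\<bar>"] by simp
qed

lemma ecoeff_summable_on: "(\<lambda>l. \<bar>ecoeff l\<bar> * \<bar>x\<bar> ^ l) summable_on UNIV"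
  using summable_ecoeff by (subst summable_on_UNIV_nonneg_real_iff) auto

lemma euler_has_sum: "((\<lambda>l. ecoeff l * x ^ l) has_sum euler x) UNIV"
  unfolding euler_def using norm_summable_imp_has_sum[OF _ summable_sums[OF summable_ecoeff']]
  summable_ecoeff by (simp add: abs_mult power_abs)

lemma infsum_abs_ecoeff: "0 \<le> x \<Longrightarrow> (\<Sum>\<^sub>\<infinity>l. \<bar>ecoeff l\<bar> * x ^ l) = euler (- x)"
  using infsumI[OF euler_has_sum[of "- x"]] by (simp add: abs_ecoeff power_minus[of x] mult_ac)

section \<open>The normalized q-Bessel function on the q-lattice\<close>

text \<open>Apart from normalisation, the Bessel series after an exchange of summation
  (\<open>bessel_has_sum\<close>). In this form \<open>Z\<close> enters only through the powers
  \<open>Z ^ l\<close>, which is what the recurrences in \<open>Z\<close> exploit.\<close>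

definition phi :: "real \<Rightarrow> int \<Rightarrow> real" where
  "phi Z n = (\<Sum>\<^sub>\<infinity>l. ecoeff l * Z ^ l * h (n + int l))"

lemma phi_summable_on: "(\<lambda>l. ecoeff l * Z ^ l * h (n + int l)) summable_on UNIV"
  using summable_on_mult_bounded[OF has_sum_imp_summable[OF euler_has_sum], of "\<lambda>l. h (n + int l)" H]
    h_nonneg h_le by simp

text \<open>One \<open>H\<close> bounds \<open>h\<close>, the factor H / Q comes from
  \<open>abs_ecoeff_le\<close>, and 1 / (1 - Q) is the sum of the remaining geometric
  series.\<close>

definition A :: real where "A = H * H / (Q * (1 - Q))"

lemma A_pos: "0 < A"
  using H_pos Q_pos Q_lt1 by (simp add: A_def)

lemma abs_phi_term_le:
  assumes "0 \<le> Z"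
  shows "\<bar>ecoeff l * Z ^ l * h (n + int l)\<bar> \<le> H * H / Q * (Z * Q) ^ l"
proof -
  have "\<bar>ecoeff l\<bar> * \<bar>h (n + int l)\<bar> \<le> (1 / (Q * qpoch_inf Q Q) * Q ^ l) * H"
    using abs_ecoeff_le[of l] h_nonneg[of "n + int l"] h_le[of "n + int l"] by (intro mult_mono) auto
  from mult_right_mono[OF this, of "Z ^ l"] assms show ?thesis
    by (simp add: abs_mult power_mult_distrib H_def mult_ac)
qed

text \<open>For \<open>n < 0\<close> the terms with \<open>l < - n\<close> vanish together with
  \<open>h\<close>, so the factor (ZQ)^(-n) comes out of the geometric majorant. This decay beats
  the growth of the weight \<open>Z powi n\<close> at minus infinity.\<close>

lemma abs_phi_decay:
  assumes "0 \<le> Z" "Z \<le> 1"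
  shows "\<bar>phi Z n\<bar> \<le> A * (Z * Q) ^ nat (- n)"
proof -
  define j where "j = nat (- n)"
  define g where "g = (\<lambda>l. if j \<le> l then Q ^ (l - j) else 0)"
  have g: "g summable_on UNIV" "infsum g UNIV = 1 / (1 - Q)"
    using infsum_geometric_from[of Q j] Q_pos Q_lt1 by (simp_all add: g_def)
  have "\<bar>phi Z n\<bar> \<le> (\<Sum>\<^sub>\<infinity>l. (H * H / Q * (Z * Q) ^ j) * g l)"
    unfolding phi_def
  proof (rule summable_on_bounded_by(3))
    fix l
    show "\<bar>ecoeff l * Z ^ l * h (n + int l)\<bar> \<le> (H * H / Q * (Z * Q) ^ j) * g l"
    proof (cases "j \<le> l")
      case True
      have "\<bar>ecoeff l * Z ^ l * h (n + int l)\<bar> \<le> H * H / Q * ((Z * Q) ^ j * (Z * Q) ^ (l - j))"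
        using abs_phi_term_le[OF assms(1), of l n] True by (simp flip: power_add)
      also have "\<dots> \<le> H * H / Q * ((Z * Q) ^ j * Q ^ (l - j))"
        using assms Q_pos H_pos by (intro mult_left_mono power_mono mult_left_le_one_le) auto
      finally show ?thesis
        using True by (simp add: g_def mult_ac)
    next
      case False
      then have "h (n + int l) = 0"
        by (auto simp: h_def j_def)
      then show ?thesis
        using False by (simp add: g_def)
    qed
  qed (intro summable_on_cmult_right g)
  also have "\<dots> = A * (Z * Q) ^ j"
    using g by (subst infsum_cmult_right) (auto simp: A_def)
  finally show ?thesis
    by (simp add: j_def)
qed

lemma abs_phi_le_A: "0 \<le> Z \<Longrightarrow> Z \<le> 1 \<Longrightarrow> \<bar>phi Z n\<bar> \<le> A"
proof -
  assume Z: "0 \<le> Z" "Z \<le> 1"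
  have "A * (Z * Q) ^ nat (- n) \<le> A"
    using A_pos Z Q_pos Q_lt1 by (intro mult_left_le power_le_one mult_le_one) auto
  then show ?thesis
    using abs_phi_decay[OF Z, of n] by linarith
qed

text \<open>The term at \<open>l = 0\<close> is \<open>h n\<close> and all others carry a factor
  \<open>Z\<close>. Uniformity in \<open>n\<close> is what the limit \<open>Z\<close> to 0
  needs.\<close>

lemma abs_phi_minus_h_le:
  assumes "0 \<le> Z" "Z \<le> 1"
  shows "\<bar>phi Z n - h n\<bar> \<le> A * Z"
proof -
  define t where "t = (\<lambda>l. ecoeff l * Z ^ l * h (n + int l))"
  define d where "d = (\<lambda>l::nat. if l = 0 then h n else 0)"
  have d: "(d has_sum h n) UNIV"
    using has_sum_finite_neutralI[of "{0}" UNIV d "h n"] by (simp add: d_def)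
  have "phi Z n - h n = (\<Sum>\<^sub>\<infinity>l. t l - d l)"
    using infsum_diff_real[OF phi_summable_on has_sum_imp_summable[OF d], of Z n] infsumI[OF d]
    by (simp add: phi_def t_def)
  also have "\<bar>\<dots>\<bar> \<le> (\<Sum>\<^sub>\<infinity>l. H * H / Q * Z * Q ^ l)"
  proof (rule summable_on_bounded_by(3))
    show "(\<lambda>l. H * H / Q * Z * Q ^ l) summable_on UNIV"
      using infsum_geometric_from(1)[of Q 0] Q_pos Q_lt1 by (intro summable_on_cmult_right) simp
    fix l
    show "\<bar>t l - d l\<bar> \<le> H * H / Q * Z * Q ^ l"
    proof (cases l)
      case 0
      then show ?thesis
        using assms H_pos Q_pos by (simp add: t_def d_def)
    next
      case (Suc k)
      have "\<bar>t l\<bar> \<le> H * H / Q * (Z * Q) ^ l"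
        using abs_phi_term_le[OF assms(1)] by (simp add: t_def)
      also have "\<dots> \<le> H * H / Q * (Z * Q ^ l)"
        using assms Q_pos H_pos power_le_one[of Z k] unfolding Suc power_mult_distrib
        by (intro mult_left_mono mult_right_mono) (auto intro: mult_left_le)
      finally show ?thesis
        using Suc by (simp add: d_def)
    qed
  qed
  also have "\<dots> = A * Z"
    using infsum_geometric_from[of Q 0] Q_pos Q_lt1 by (subst infsum_cmult_right) (auto simp: A_def)
  finally show ?thesis .
qed

lemma phi_tendsto: "(\<lambda>m. phi Z (n + int m)) \<longlonglongrightarrow> H * euler Z"
proof -
  have "(\<lambda>m. phi Z (n + int m)) \<longlonglongrightarrow> (\<Sum>\<^sub>\<infinity>l. ecoeff l * Z ^ l * H)"
    unfolding phi_def
  proof (rule infsum_tendsto_dominated[where w = "\<lambda>l. \<bar>ecoeff l\<bar> * \<bar>Z\<bar> ^ l * H"])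
    show "(\<lambda>m. ecoeff l * Z ^ l * h (n + int m + int l)) \<longlonglongrightarrow> ecoeff l * Z ^ l * H" for l
      using h_tendsto[of "n + int l"] by (intro tendsto_mult tendsto_const) (simp add: algebra_simps)
    show "\<bar>ecoeff l * Z ^ l * h (n + int m + int l)\<bar> \<le> \<bar>ecoeff l\<bar> * \<bar>Z\<bar> ^ l * H" for l m
      using h_nonneg[of "n + int m + int l"] h_le[of "n + int m + int l"]
      by (simp add: abs_mult power_abs mult_left_mono)
    show "(\<lambda>l. \<bar>ecoeff l\<bar> * \<bar>Z\<bar> ^ l * H) summable_on UNIV"
      by (intro summable_on_cmult_left ecoeff_summable_on)
  qed
  also have "(\<Sum>\<^sub>\<infinity>l. ecoeff l * Z ^ l * H) = H * euler Z"
    using infsumI[OF has_sum_cmult_left[OF euler_has_sum[of Z], of H]] by (simp add: mult_ac)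
  finally show ?thesis .
qed

text \<open>Termwise from \<open>h_diff\<close>: the factor Q^l that it produces turns Z^l into
  (ZQ)^l.\<close>

lemma phi_diff: "phi Z n - phi Z (n - 1) = Q powi n * phi (Z * Q) n"
proof -
  have "phi Z n - phi Z (n - 1)
      = (\<Sum>\<^sub>\<infinity>l. ecoeff l * Z ^ l * h (n + int l) - ecoeff l * Z ^ l * h (n - 1 + int l))"
    unfolding phi_def by (rule infsum_diff_real[symmetric]; rule phi_summable_on)
  also have "\<dots> = (\<Sum>\<^sub>\<infinity>l. Q powi n * (ecoeff l * (Z * Q) ^ l * h (n + int l)))"
  proof (rule infsum_cong)
    fix l
    have "h (n + int l) - h (n - 1 + int l) = Q powi n * Q ^ l * h (n + int l)"
      using h_diff[of "n + int l"] Q_pos by (simp add: algebra_simps power_int_add)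
    from arg_cong[OF this, of "\<lambda>t. ecoeff l * Z ^ l * t"]
    show "ecoeff l * Z ^ l * h (n + int l) - ecoeff l * Z ^ l * h (n - 1 + int l)
        = Q powi n * (ecoeff l * (Z * Q) ^ l * h (n + int l))"
      by (simp add: right_diff_distrib power_mult_distrib mult_ac)
  qed
  also have "\<dots> = Q powi n * phi (Z * Q) n"
    unfolding phi_def by (intro infsum_cmult_right phi_summable_on)
  finally show ?thesis .
qed

text \<open>The companion relation comes from the other factor: passing from \<open>Z\<close> to
  \<open>Z * Q\<close> puts 1 - Q^l on the coefficients, and \<open>ecoeff_Suc\<close> converts this
  into an index shift.\<close>

lemma phi_shift: "phi Z n = phi (Z * Q) n - Z * phi (Z * Q) (n + 1)"
proof -
  have "phi Z n - phi (Z * Q) n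
      = (\<Sum>\<^sub>\<infinity>l. ecoeff l * Z ^ l * h (n + int l) - ecoeff l * (Z * Q) ^ l * h (n + int l))"
    unfolding phi_def by (rule infsum_diff_real[symmetric]; rule phi_summable_on)
  also have "\<dots> = (\<Sum>\<^sub>\<infinity>l. ecoeff l * (1 - Q ^ l) * (Z ^ l * h (n + int l)))"
    by (rule infsum_cong) (simp add: power_mult_distrib algebra_simps)
  also have "\<dots> = (\<Sum>\<^sub>\<infinity>l\<in>range Suc. ecoeff l * (1 - Q ^ l) * (Z ^ l * h (n + int l)))"
  proof (rule infsum_cong_neutral)
    show "ecoeff l * (1 - Q ^ l) * (Z ^ l * h (n + int l)) = 0" if "l \<in> UNIV - range Suc" for l
      using that by (cases l) auto
  qed auto
  also have "\<dots> = (\<Sum>\<^sub>\<infinity>l. ecoeff (Suc l) * (1 - Q ^ Suc l) * (Z ^ Suc l * h (n + int (Suc l))))"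
    by (subst infsum_reindex) (auto simp: o_def)
  also have "\<dots> = (\<Sum>\<^sub>\<infinity>l. - Z * (ecoeff l * (Z * Q) ^ l * h (n + 1 + int l)))"
    unfolding ecoeff_Suc by (rule infsum_cong) (simp add: power_mult_distrib algebra_simps)
  also have "\<dots> = - Z * phi (Z * Q) (n + 1)"
    unfolding phi_def by (intro infsum_cmult_right phi_summable_on)
  finally show ?thesis
    by simp
qed

text \<open>For \<open>n >= 0\<close> the weight decays; for \<open>n < 0\<close> it grows, but
  together with \<open>abs_phi_decay\<close> at most Q^(-n) is left. Fractional
  \<open>\<theta>\<close> is needed because a sequence satisfying \<open>lp Z p\<close> is bounded
  by a multiple of Z^(-n/p), which leaves only Z^((1 - 1/p) n) of the weight.\<close>

lemma powr_phi_le: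
  fixes Z \<theta> :: real
  assumes "0 < \<zeta>" "\<zeta> \<le> Z" "Z < 1" "0 < \<theta>" "\<theta> \<le> 1"
  shows "\<zeta> powr (\<theta> * n) * \<bar>phi \<zeta> n\<bar> \<le> A * max (Z powr \<theta>) Q ^ nat \<bar>n\<bar>"
proof (cases "n \<ge> 0")
  case True
  have "\<zeta> powr (\<theta> * n) = (\<zeta> powr \<theta>) ^ nat n"
    using assms(1) True by (simp add: powr_powr[symmetric] powr_int)
  also have "\<dots> \<le> max (Z powr \<theta>) Q ^ nat n"
    using assms powr_mono2[of \<theta> \<zeta> Z] by (intro power_mono) auto
  finally have "\<zeta> powr (\<theta> * n) * \<bar>phi \<zeta> n\<bar> \<le> max (Z powr \<theta>) Q ^ nat n * A"
    using assms abs_phi_le_A[of \<zeta> n] Q_pos by (intro mult_mono) auto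
  then show ?thesis
    using True by (simp add: mult_ac)
next
  case False
  define j where "j = nat (- n)"
  have n: "n = - int j"
    using False by (simp add: j_def)
  have e: "\<zeta> powr (\<theta> * n) = (\<zeta> powr (- \<theta>)) ^ j"
    using assms(1) by (simp add: n powr_power mult.commute)
  have "\<zeta> powr (\<theta> * n) * \<bar>phi \<zeta> n\<bar> \<le> (\<zeta> powr (- \<theta>)) ^ j * (A * (\<zeta> * Q) ^ j)"
    unfolding e using abs_phi_decay[of \<zeta> n] assms by (intro mult_left_mono) (auto simp: j_def)
  also have "(\<zeta> powr (- \<theta>)) ^ j * (A * (\<zeta> * Q) ^ j) = A * (\<zeta> powr (1 - \<theta>) * Q) ^ j"
  proof -
    have "\<zeta> powr (1 - \<theta>) = \<zeta> powr (- \<theta>) * \<zeta>"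
      using assms(1) by (simp add: powr_diff powr_minus divide_inverse mult.commute)
    then show ?thesis
      by (simp add: power_mult_distrib mult_ac)
  qed
  also have "\<dots> \<le> A * max (Z powr \<theta>) Q ^ j"
  proof -
    have "\<zeta> powr (1 - \<theta>) \<le> 1"
      using assms powr_mono2[of "1 - \<theta>" \<zeta> 1] by simp
    then have "\<zeta> powr (1 - \<theta>) * Q \<le> max (Z powr \<theta>) Q"
      using Q_pos by (intro max.coboundedI2 mult_left_le_one_le) auto
    then show ?thesis
      using A_pos Q_pos by (intro mult_left_mono power_mono) auto
  qed
  finally show ?thesis
    using False by (simp add: j_def)
qed

lemma summable_max_powr:
  fixes Z \<theta> :: real
  assumes "0 < Z" "Z < 1" "0 < \<theta>"
  shows "(\<lambda>n::int. max (Z powr \<theta>) Q ^ nat \<bar>n\<bar>) summable_on UNIV"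
  using assms Q_pos Q_lt1 powr_less_mono2[of \<theta> Z 1] by (intro summable_on_int_geometric) auto

lemma summable_powr_phi:
  fixes Z \<theta> :: real
  assumes "0 < Z" "Z < 1" "0 < \<theta>" "\<theta> \<le> 1"
  shows "(\<lambda>n::int. Z powr (\<theta> * n) * \<bar>phi Z n\<bar>) summable_on UNIV"
  by (rule summable_on_bounded_by(1)[OF summable_on_cmult_right[OF summable_max_powr[of Z \<theta>], of A]])
    (use assms powr_phi_le[of Z Z \<theta>] in \<open>auto simp: abs_mult\<close>)

lemma powr_phi_le_A:
  fixes Z \<theta> :: real
  assumes "0 < Z" "Z < 1" "0 < \<theta>" "\<theta> \<le> 1"
  shows "Z powr (\<theta> * n) * \<bar>phi Z n\<bar> \<le> A"
proof -
  have "A * max (Z powr \<theta>) Q ^ nat \<bar>n\<bar> \<le> A"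
    using A_pos Q_pos Q_lt1 assms powr_less_mono2[of \<theta> Z 1] by (intro mult_left_le power_le_one) auto
  then show ?thesis
    using powr_phi_le[of Z Z \<theta> n] assms by simp
qed

lemma summable_powr_phi_shift:
  fixes Z \<theta> :: real
  assumes "0 < Z" "Z < 1" "0 < \<theta>" "\<theta> \<le> 1"
  shows "(\<lambda>n::int. Z powr (\<theta> * n) * \<bar>phi Z (n + m)\<bar>) summable_on UNIV"
    and "(\<Sum>\<^sub>\<infinity>n. Z powr (\<theta> * real_of_int n) * \<bar>phi Z (n + m)\<bar>)
      = Z powr (- (\<theta> * real_of_int m)) * (\<Sum>\<^sub>\<infinity>n. Z powr (\<theta> * real_of_int n) * \<bar>phi Z n\<bar>)"
proof -
  define t where "t = (\<lambda>n::int. Z powr (\<theta> * n) * \<bar>phi Z n\<bar>)"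
  have t: "t summable_on UNIV"
    unfolding t_def by (rule summable_powr_phi[OF assms])
  have e: "Z powr (\<theta> * n) * \<bar>phi Z (n + m)\<bar> = Z powr (- (\<theta> * real_of_int m)) * t (n + m)" for n
    using assms(1) by (simp add: t_def powr_add[symmetric] algebra_simps)
  show "(\<lambda>n::int. Z powr (\<theta> * n) * \<bar>phi Z (n + m)\<bar>) summable_on UNIV"
    unfolding e using t by (intro summable_on_cmult_right) (simp add: summable_on_int_shift)
  have "(\<Sum>\<^sub>\<infinity>n. Z powr (\<theta> * real_of_int n) * \<bar>phi Z (n + m)\<bar>)
      = Z powr (- (\<theta> * real_of_int m)) * (\<Sum>\<^sub>\<infinity>n. t (n + m))"
    unfolding e using t by (intro infsum_cmult_right) (simp add: summable_on_int_shift)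
  then show "(\<Sum>\<^sub>\<infinity>n. Z powr (\<theta> * real_of_int n) * \<bar>phi Z (n + m)\<bar>)
      = Z powr (- (\<theta> * real_of_int m)) * (\<Sum>\<^sub>\<infinity>n. Z powr (\<theta> * real_of_int n) * \<bar>phi Z n\<bar>)"
    by (simp add: infsum_int_shift) (simp add: t_def)
qed

text \<open>Weight and \<open>phi\<close> have separate parameters here, since
  \<open>phi_norm_rec\<close> sums \<open>phi (Z * Q)\<close> against the weight
  \<open>Z powi n\<close>.\<close>

lemma powi_phi_le:
  assumes "0 < Z" "Z < 1" "0 \<le> \<zeta>" "\<zeta> \<le> Z"
  shows "Z powi n * \<bar>phi \<zeta> n\<bar> \<le> A * max Z Q ^ nat \<bar>n\<bar>"
proof (cases "n \<ge> 0")
  case True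
  have "Z powi n * \<bar>phi \<zeta> n\<bar> \<le> max Z Q ^ nat n * A"
    using assms True abs_phi_le_A[of \<zeta> n] by (intro mult_mono) (auto simp: power_int_nonneg_exp power_mono)
  then show ?thesis
    using True by (simp add: mult_ac)
next
  case False
  define j where "j = nat (- n)"
  have n: "n = - int j"
    using False by (simp add: j_def)
  have "Z powi n * \<bar>phi \<zeta> n\<bar> \<le> Z powi n * (A * (\<zeta> * Q) ^ j)"
    using abs_phi_decay[of \<zeta> n] assms by (intro mult_left_mono) (auto simp: j_def)
  also have "\<dots> \<le> Z powi n * (A * (Z * Q) ^ j)"
    using assms A_pos Q_pos by (intro mult_left_mono power_mono mult_right_mono) auto
  also have "\<dots> = A * Q ^ j"
    using assms by (simp add: n power_int_minus power_mult_distrib)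
  also have "\<dots> \<le> A * max Z Q ^ j"
    using A_pos Q_pos by (intro mult_left_mono power_mono) auto
  finally show ?thesis
    using False by (simp add: j_def)
qed

lemma summable_max_power:
  assumes "0 < Z" "Z < 1"
  shows "(\<lambda>n::int. max Z Q ^ nat \<bar>n\<bar>) summable_on UNIV"
  using assms Q_pos Q_lt1 by (intro summable_on_int_geometric) auto

lemma summable_powi_phi:
  assumes "0 < Z" "Z < 1" "0 \<le> \<zeta>" "\<zeta> \<le> Z"
  shows "(\<lambda>n. Z powi n * phi \<zeta> (n + a)) summable_on UNIV"
proof -
  have "(\<lambda>n. Z powi n * phi \<zeta> n) summable_on UNIV"
    by (rule summable_on_bounded_by(1)[OF summable_on_cmult_right[OF summable_max_power[OF assms(1,2)], of A]])
      (use powi_phi_le[OF assms] assms in \<open>auto simp: abs_mult\<close>)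
  then have "(\<lambda>n. Z powi (n + a) * phi \<zeta> (n + a)) summable_on UNIV"
    using summable_on_int_shift[of "\<lambda>n. Z powi n * phi \<zeta> n" a] by simp
  from summable_on_cmult_right[OF this, of "Z powi (- a)"]
  show ?thesis
    using assms(1) by (simp add: power_int_add power_int_minus field_simps)
qed

lemma summable_powi_abs_phi:
  assumes "0 < Z" "Z < 1"
  shows "(\<lambda>n. Z powi n * \<bar>phi Z (n + a)\<bar>) summable_on UNIV"
  using summable_on_abs_real[OF summable_powi_phi[OF assms, of Z a]] assms by (simp add: abs_mult)

section \<open>Orthogonality\<close>

lemma summable_powi_phi_phi:
  assumes "0 < Z" "Z < 1" "0 \<le> \<zeta>" "\<zeta> \<le> Z"
  shows "(\<lambda>n. Z powi n * phi \<zeta> (n + a) * phi \<zeta> (n + b)) summable_on UNIV"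
  by (rule summable_on_mult_bounded[OF summable_powi_phi[OF assms], where B = A]) (use assms abs_phi_le_A in auto)

lemma mult_Q_bounds:
  assumes "0 < Z" "Z < 1"
  shows "0 < Z * Q ^ n" "Z * Q ^ n < 1" "Z * Q ^ n \<le> Z"
proof -
  show le: "Z * Q ^ n \<le> Z"
    using assms Q_power_le1(1)[of n] by (intro mult_left_le) auto
  show "0 < Z * Q ^ n"
    using assms Q_pos by simp
  show "Z * Q ^ n < 1"
    by (rule le_less_trans[OF le assms(2)])
qed

text \<open>Both sums become quadratic in \<open>\<psi> = phi (Z * Q)\<close>. After shifting the
  right one by one index, the difference of the summands is 1 - Z times
  \<open>w n - w (n + 1)\<close>, whose total is zero.\<close>

lemma phi_norm_rec:
  assumes "0 < Z" "Z < 1"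
  shows "(\<Sum>\<^sub>\<infinity>n. Z powi n * phi Z n * phi Z (n + m))
    = Q powi m * (\<Sum>\<^sub>\<infinity>n. (Z * Q\<^sup>2) powi n * phi (Z * Q\<^sup>2) n * phi (Z * Q\<^sup>2) (n + m))"
proof -
  note q2 = mult_Q_bounds(1,2)[OF assms, of 2] and q1 = mult_Q_bounds[OF assms, of 1, simplified]
  define \<psi> where "\<psi> = phi (Z * Q)"
  define u where "u = (\<lambda>n. Z powi n * phi Z n * phi Z (n + m))"
  define v where "v = (\<lambda>n. Q powi m * ((Z * Q\<^sup>2) powi n * phi (Z * Q\<^sup>2) n * phi (Z * Q\<^sup>2) (n + m)))"
  define w where "w = (\<lambda>n. Z powi n * \<psi> n * \<psi> (n + m))"
  have su: "u summable_on UNIV"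
    using summable_powi_phi_phi[OF assms, of Z 0 m] assms by (simp add: u_def)
  have sv: "v summable_on UNIV"
    unfolding v_def using summable_powi_phi_phi[OF q2, of _ 0 m] q2 by (intro summable_on_cmult_right) simp
  have vs: "v (n + 1) = Z * (Z powi n * (\<psi> (n + 1) - \<psi> n) * (\<psi> (n + m + 1) - \<psi> (n + m)))" for n
  proof -
    have "(Z * Q\<^sup>2) powi (n + 1) = Z * Z powi n * Q powi (n + 1) * Q powi (n + 1)"
      using assms Q_pos by (simp add: power_int_mult_distrib power_int_add power2_eq_square)
    then have "v (n + 1) = Z * (Z powi n * (Q powi (n + 1) * phi (Z * Q * Q) (n + 1)) *
        (Q powi (n + m + 1) * phi (Z * Q * Q) (n + m + 1)))"
      using Q_pos by (simp add: v_def power_int_add power2_eq_square mult_ac add_ac)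
    also have "\<dots> = Z * (Z powi n * (\<psi> (n + 1) - \<psi> n) * (\<psi> (n + m + 1) - \<psi> (n + m)))"
      using phi_diff[of "Z * Q" "n + 1"] phi_diff[of "Z * Q" "n + m + 1"] by (simp add: \<psi>_def)
    finally show ?thesis .
  qed
  have us: "u n = Z powi n * (\<psi> n - Z * \<psi> (n + 1)) * (\<psi> (n + m) - Z * \<psi> (n + m + 1))" for n
    unfolding u_def \<psi>_def using phi_shift[of Z n] phi_shift[of Z "n + m"] by simp
  have eq: "u n - v (n + 1) = (1 - Z) * (w n - w (n + 1))" for n
  proof -
    have w1: "w (n + 1) = Z * (Z powi n * \<psi> (n + 1) * \<psi> (n + m + 1))"
      using assms by (simp add: w_def power_int_add mult_ac add_ac)
    \<comment> \<open>The mixed products \<open>x * y'\<close> and \<open>x' * y\<close>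
      cancel.\<close>
    have alg: "z * (x - Z * x') * (y - Z * y') - Z * (z * (x' - x) * (y' - y)) = (1 - Z) * (z * x * y - Z * (z * x' * y'))"
      for x x' y y' z :: real
      by (simp add: algebra_simps)
    show ?thesis
      unfolding us vs w1 unfolding w_def by (rule alg)
  qed
  have sv1: "(\<lambda>n. v (n + 1)) summable_on UNIV"
    using sv by (simp add: summable_on_int_shift)
  have sw: "w summable_on UNIV"
    unfolding w_def \<psi>_def using summable_powi_phi_phi[OF assms, of "Z * Q" 0 m] q1 by simp
  have sw1: "(\<lambda>n. w (n + 1)) summable_on UNIV"
    using sw by (simp add: summable_on_int_shift)
  have "infsum u UNIV - infsum v UNIV = (\<Sum>\<^sub>\<infinity>n. u n - v (n + 1))"
    using infsum_diff_real[OF su sv1] by (simp add: infsum_int_shift)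
  also have "\<dots> = (1 - Z) * (\<Sum>\<^sub>\<infinity>n. w n - w (n + 1))"
    unfolding eq using infsum_diff_real[OF sw sw1] 
    by (intro infsum_cmult_right) (use summable_on_add[OF sw summable_on_uminus[THEN iffD2, OF sw1]] in simp)
  also have "\<dots> = 0"
    using infsum_diff_real[OF sw sw1] by (simp add: infsum_int_shift)
  finally have "infsum u UNIV = infsum v UNIV"
    by simp
  also have "\<dots> = Q powi m * (\<Sum>\<^sub>\<infinity>n. (Z * Q\<^sup>2) powi n * phi (Z * Q\<^sup>2) n * phi (Z * Q\<^sup>2) (n + m))"
    unfolding v_def using summable_powi_phi_phi[OF q2, of _ 0 m] q2 by (intro infsum_cmult_right) simp
  finally show ?thesis
    by (simp add: u_def)
qed

lemma phi_norm_rec_iterate: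
  assumes "0 < Z" "Z < 1"
  shows "(\<Sum>\<^sub>\<infinity>n. Z powi n * phi Z n * phi Z (n + m))
    = (Q powi m) ^ k * (\<Sum>\<^sub>\<infinity>n. (Z * Q ^ (2 * k)) powi n * phi (Z * Q ^ (2 * k)) n * phi (Z * Q ^ (2 * k)) (n + m))"
proof (induction k)
  case (Suc k)
  have "Z * Q ^ (2 * k) * Q\<^sup>2 = Z * Q ^ (2 * Suc k)"
    by (simp add: power_add[symmetric] mult.assoc)
  with phi_norm_rec[OF mult_Q_bounds(1,2)[OF assms], of "2 * k" m] Suc show ?case
    by simp
qed simp

text \<open>The recurrence is iterated \<open>k\<close> times. For \<open>m > 0\<close> the
  prefactor Q^(mk) tends to 0 while the sums stay bounded uniformly in \<open>k\<close>. For
  \<open>m = 0\<close> the prefactor is 1, and dominated convergence leaves only the term at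
  \<open>n = 0\<close>, where \<open>phi\<close> tends to \<open>h 0 = 1\<close>.\<close>

lemma phi_orthogonal_0:
  assumes "0 < Z" "Z < 1" "m \<ge> 0"
  shows "(\<Sum>\<^sub>\<infinity>n. Z powi n * phi Z n * phi Z (n + m)) = (if m = 0 then 1 else 0)"
proof -
  define \<zeta> where "\<zeta> = (\<lambda>k. Z * Q ^ (2 * k))"
  define f where "f = (\<lambda>k n. \<zeta> k powi n * phi (\<zeta> k) n * phi (\<zeta> k) (n + m))"
  define w where "w = (\<lambda>n::int. A * max Z Q ^ nat \<bar>n\<bar> * A)"
  have \<zeta>: "0 < \<zeta> k" "\<zeta> k < 1" "\<zeta> k \<le> Z" for k
    using mult_Q_bounds[OF assms(1,2), of "2 * k"] by (simp_all add: \<zeta>_def)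
  have w: "w summable_on UNIV"
    unfolding w_def by (intro summable_on_cmult_left summable_on_cmult_right summable_max_power assms)
  have decay: "\<zeta> k powi n * \<bar>phi (\<zeta> k) n\<bar> \<le> A * max Z Q ^ nat \<bar>n\<bar>" for k n
  proof -
    have "\<zeta> k powi n * \<bar>phi (\<zeta> k) n\<bar> \<le> A * max (\<zeta> k) Q ^ nat \<bar>n\<bar>"
      using \<zeta>[of k] by (intro powi_phi_le) auto
    also have "\<dots> \<le> A * max Z Q ^ nat \<bar>n\<bar>"
      using \<zeta>[of k] A_pos Q_pos by (intro mult_left_mono power_mono) auto
    finally show ?thesis .
  qed
  have bound: "\<bar>f k n\<bar> \<le> w n" for k n
    using mult_mono[OF decay[of k n] abs_phi_le_A[of "\<zeta> k" "n + m"]] \<zeta>[of k] A_pos Q_pos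
    by (simp add: f_def w_def abs_mult)
  have eq: "(\<Sum>\<^sub>\<infinity>n. Z powi n * phi Z n * phi Z (n + m)) = (Q powi m) ^ k * (\<Sum>\<^sub>\<infinity>n. f k n)" for k
    using phi_norm_rec_iterate[OF assms(1,2), of m k] by (simp add: f_def \<zeta>_def)
  show ?thesis
  proof (cases "m = 0")
    case False
    have "Q powi m < 1"
      using False assms(3) Q_pos Q_power_le1(2)[of "nat m - 1"]
      by (cases "nat m") (auto simp: power_int_nonneg_exp)
    then have "(\<lambda>k. (Q powi m) ^ k * infsum w UNIV) \<longlonglongrightarrow> 0 * infsum w UNIV"
      using Q_pos by (intro tendsto_mult tendsto_const LIMSEQ_realpow_zero) auto
    then have "(\<lambda>k. (Q powi m) ^ k * infsum w UNIV) \<longlonglongrightarrow> 0"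
      by simp
    moreover have "norm (\<Sum>\<^sub>\<infinity>n. Z powi n * phi Z n * phi Z (n + m)) \<le> (Q powi m) ^ k * infsum w UNIV" for k
    proof -
      have "\<bar>\<Sum>\<^sub>\<infinity>n. f k n\<bar> \<le> infsum w UNIV"
        by (rule summable_on_bounded_by(3)[OF w bound])
      then have "(Q powi m) ^ k * \<bar>\<Sum>\<^sub>\<infinity>n. f k n\<bar> \<le> (Q powi m) ^ k * infsum w UNIV"
        using Q_pos by (intro mult_left_mono) auto
      then show ?thesis
        unfolding eq[of k] real_norm_def abs_mult using Q_pos by simp
    qed
    ultimately have "norm (\<Sum>\<^sub>\<infinity>n. Z powi n * phi Z n * phi Z (n + m)) \<le> 0"
      by (intro LIMSEQ_le_const) auto
    then show ?thesis
      using False by simp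
  next
    case True
    have \<zeta>0: "\<zeta> \<longlonglongrightarrow> 0"
    proof -
      have "(\<lambda>k. Z * (Q\<^sup>2) ^ k) \<longlonglongrightarrow> Z * 0"
        using Q_pos Q_lt1 by (intro tendsto_mult tendsto_const LIMSEQ_realpow_zero) (auto simp: power_less_one_iff)
      then show ?thesis
        by (simp add: \<zeta>_def power_mult)
    qed
    have lim: "(\<lambda>k. f k n) \<longlonglongrightarrow> (if n = 0 then 1 else 0)" for n
    proof -
      consider "n = 0" | "n > 0" | "n < 0"
        by linarith
      then show ?thesis
      proof cases
        case 1
        have "(\<lambda>k. phi (\<zeta> k) 0 - 1) \<longlonglongrightarrow> 0"
        proof (rule Lim_null_comparison)
          show "\<forall>\<^sub>F k in sequentially. norm (phi (\<zeta> k) 0 - 1) \<le> A * \<zeta> k"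
            using abs_phi_minus_h_le[of "\<zeta> _" 0] \<zeta> by (simp add: h_def less_imp_le)
          show "(\<lambda>k. A * \<zeta> k) \<longlonglongrightarrow> 0"
            using tendsto_mult[OF tendsto_const \<zeta>0, of A] by simp
        qed
        then have "(\<lambda>k. phi (\<zeta> k) 0) \<longlonglongrightarrow> 1"
          by (simp add: LIM_zero_iff)
        from tendsto_mult[OF this this] show ?thesis
          using 1 True by (simp add: f_def)
      next
        case 2
        have "(\<lambda>k. \<zeta> k ^ nat n * A * A) \<longlonglongrightarrow> 0 ^ nat n * A * A"
          by (intro tendsto_intros \<zeta>0)
        then have "(\<lambda>k. \<zeta> k ^ nat n * A * A) \<longlonglongrightarrow> 0"
          using 2 by (simp add: zero_power)
        moreover have "\<bar>f k n\<bar> \<le> \<zeta> k ^ nat n * A * A" for k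
          unfolding f_def using 2 \<zeta>[of k]
          by (intro abs_mult_le abs_phi_le_A) (auto simp: power_int_nonneg_exp)
        ultimately have "(\<lambda>k. f k n) \<longlonglongrightarrow> 0"
          by (rule tendsto_zero_bounded_by)
        then show ?thesis
          using 2 by simp
      next
        case 3
        \<comment> \<open>The weight contributes the factor \<zeta>^(-j), which blows up, but the
          two Bessel factors together contribute \<zeta>^(2j).\<close>
        define j where "j = nat (- n)"
        have j: "n = - int j" "j > 0"
          using 3 by (simp_all add: j_def)
        have "(\<lambda>k. A * A * \<zeta> k ^ j) \<longlonglongrightarrow> A * A * 0 ^ j"
          by (intro tendsto_intros \<zeta>0)
        then have "(\<lambda>k. A * A * \<zeta> k ^ j) \<longlonglongrightarrow> 0"
          using j by (simp add: zero_power)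
        moreover have "\<bar>f k n\<bar> \<le> A * A * \<zeta> k ^ j" for k
        proof -
          have d: "\<bar>phi (\<zeta> k) n\<bar> \<le> A * \<zeta> k ^ j"
          proof -
            have "A * (\<zeta> k * Q) ^ j \<le> A * \<zeta> k ^ j"
              using A_pos \<zeta>[of k] Q_pos Q_lt1 by (intro mult_left_mono power_mono mult_left_le) auto
            then show ?thesis
              using abs_phi_decay[of "\<zeta> k" n] \<zeta>[of k] by (simp add: j_def)
          qed
          have "\<bar>f k n\<bar> = \<zeta> k powi n * (\<bar>phi (\<zeta> k) n\<bar> * \<bar>phi (\<zeta> k) n\<bar>)"
            using True \<zeta>[of k] by (simp add: f_def abs_mult)
          also have "\<dots> \<le> \<zeta> k powi n * ((A * \<zeta> k ^ j) * (A * \<zeta> k ^ j))"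
            using \<zeta>[of k] A_pos d by (intro mult_left_mono mult_mono) auto
          also have "\<dots> = A * A * \<zeta> k ^ j"
            using \<zeta>[of k] by (simp add: j power_int_minus field_simps)
          finally show ?thesis .
        qed
        ultimately have "(\<lambda>k. f k n) \<longlonglongrightarrow> 0"
          by (rule tendsto_zero_bounded_by)
        then show ?thesis
          using 3 by simp
      qed
    qed
    have "(\<lambda>k. \<Sum>\<^sub>\<infinity>n. f k n) \<longlonglongrightarrow> (\<Sum>\<^sub>\<infinity>n::int. if n = 0 then 1 else 0)"
      by (rule infsum_tendsto_dominated[OF lim bound w])
    moreover have "(\<Sum>\<^sub>\<infinity>n::int. if n = 0 then 1 else 0) = (1::real)"
      using has_sum_finite_neutralI[of "{0::int}" UNIV "\<lambda>n. if n = 0 then 1 else 0" "1::real"]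
      by (intro infsumI) simp
    ultimately show ?thesis
      using True eq by (simp add: LIMSEQ_const_iff)
  qed
qed

lemma phi_orthogonal:
  assumes "0 < Z" "Z < 1"
  shows "(\<Sum>\<^sub>\<infinity>n. Z powi n * phi Z (n + a) * phi Z (n + b)) = (if a = b then Z powi (- a) else 0)"
proof -
  have *: "(\<Sum>\<^sub>\<infinity>n. Z powi n * phi Z (n + a) * phi Z (n + b)) = (if a = b then Z powi (- a) else 0)"
    if "a \<le> b" for a b
  proof -
    define f where "f = (\<lambda>n. Z powi n * phi Z n * phi Z (n + (b - a)))"
    have f: "f summable_on UNIV"
      using summable_powi_phi_phi[OF assms, of Z 0 "b - a"] assms by (simp add: f_def)
    have "Z powi n * phi Z (n + a) * phi Z (n + b) = Z powi (- a) * f (n + a)" for n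
      using assms by (simp add: f_def power_int_add power_int_minus)
    then have "(\<Sum>\<^sub>\<infinity>n. Z powi n * phi Z (n + a) * phi Z (n + b)) = Z powi (- a) * (\<Sum>\<^sub>\<infinity>n. f (n + a))"
      using f by (simp only:) (intro infsum_cmult_right, simp add: summable_on_int_shift)
    also have "(\<Sum>\<^sub>\<infinity>n. f (n + a)) = (if b - a = 0 then 1 else 0)"
      unfolding infsum_int_shift unfolding f_def by (rule phi_orthogonal_0[OF assms]) (use that in simp)
    finally show ?thesis
      by auto
  qed
  show ?thesis
  proof (cases "a \<le> b")
    case False
    then show ?thesis
      using *[of b a] by (simp add: mult_ac)
  qed (rule *)
qed

section \<open>The heat kernel\<close>

definition heat :: "real \<Rightarrow> int \<Rightarrow> int \<Rightarrow> real" where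
  "heat Z a b = (\<Sum>\<^sub>\<infinity>n. h n * Z powi n * phi Z (n + a) * phi Z (n + b))"

lemma h_powi_le:
  assumes "0 < Z" "Z \<le> Y"
  shows "\<bar>h n * Z powi n\<bar> \<le> H * Y ^ nat \<bar>n\<bar>"
proof (cases "n < 0")
  case True
  then show ?thesis
    using H_pos assms by (simp add: h_def)
next
  case False
  then have "Z powi n \<le> Y ^ nat \<bar>n\<bar>"
    using assms by (auto simp: power_int_nonneg_exp intro: power_mono)
  then have "h n * Z powi n \<le> H * Y ^ nat \<bar>n\<bar>"
    using h_nonneg[of n] h_le[of n] H_pos assms by (intro mult_mono) auto
  then show ?thesis
    using h_nonneg[of n] assms by simp
qed

lemma h_powi_summable:
  assumes "0 < Z" "Z < 1"
  shows "(\<lambda>n. h n * Z powi n) summable_on UNIV"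
  by (rule summable_on_bounded_by(1)[OF summable_on_cmult_right[OF summable_on_int_geometric[of Z], of H]])
    (use h_powi_le[OF assms(1) order_refl] assms in auto)

lemma heat_summable:
  assumes "0 < Z" "Z < 1" "0 \<le> \<zeta>" "\<zeta> \<le> Z"
  shows "(\<lambda>n. h n * Z powi n * phi \<zeta> (n + a) * phi \<zeta> (n + b)) summable_on UNIV"
  unfolding mult.assoc[of _ "phi _ _" "phi _ _"]
  by (rule summable_on_mult_bounded[OF h_powi_summable[OF assms(1,2)], where B = "A * A"])
     (use assms in \<open>auto intro!: abs_mult_le abs_phi_le_A\<close>)

text \<open>The algebra is that of \<open>phi_norm_rec\<close>, but shifting the index changes
  \<open>h n\<close> into \<open>h (n - 1)\<close>. By \<open>h_diff\<close> the defect is the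
  weight \<open>h n * (Z * Q) powi n\<close>, that is, a heat kernel with parameter
  \<open>Z * Q\<close>. Both coefficients are positive, so the sign can be carried back from small
  parameters.\<close>

lemma heat_rec:
  assumes "0 < Z" "Z < 1"
  shows "heat Z a b = Z * Q powi (a + b + 2) * heat (Z * Q\<^sup>2) (a + 1) (b + 1) + (1 - Z) * heat (Z * Q) a b"
proof -
  note q2 = mult_Q_bounds(1,2)[OF assms, of 2] and q1 = mult_Q_bounds[OF assms, of 1, simplified]
  define \<psi> where "\<psi> = phi (Z * Q)"
  define u where "u = (\<lambda>n. h n * Z powi n * phi Z (n + a) * phi Z (n + b))"
  define v where "v = (\<lambda>n. h n * (Z * Q\<^sup>2) powi n * phi (Z * Q\<^sup>2) (n + (a + 1)) * phi (Z * Q\<^sup>2) (n + (b + 1)))"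
  define w where "w = (\<lambda>n. h n * (Z * Q) powi n * \<psi> (n + a) * \<psi> (n + b))"
  define x where "x = (\<lambda>n. h n * Z powi n * \<psi> (n + a) * \<psi> (n + b))"
  define y where "y = (\<lambda>n. h (n - 1) * Z powi n * \<psi> (n + a) * \<psi> (n + b))"
  have su: "u summable_on UNIV"
    unfolding u_def using assms by (intro heat_summable) auto
  have sv: "v summable_on UNIV"
    unfolding v_def using q2 by (intro heat_summable) auto
  have sw: "w summable_on UNIV"
    unfolding w_def \<psi>_def using q1 by (intro heat_summable) auto
  have sx: "x summable_on UNIV"
    unfolding x_def \<psi>_def using assms q1 by (intro heat_summable) auto
  have xy: "x n - y n = w n" for n
  proof -
    have "x n - y n = (h n - h (n - 1)) * (Z powi n * \<psi> (n + a) * \<psi> (n + b))"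
      by (simp add: x_def y_def algebra_simps)
    also have "\<dots> = w n"
      unfolding h_diff by (simp add: w_def power_int_mult_distrib mult_ac)
    finally show ?thesis .
  qed
  have sy: "y summable_on UNIV"
    using summable_on_add[OF sx summable_on_uminus[THEN iffD2, OF sw]] xy by (simp add: algebra_simps)
  have y1: "y (n + 1) = Z * (h n * Z powi n * \<psi> (n + a + 1) * \<psi> (n + b + 1))" for n
    using assms by (simp add: y_def power_int_add mult_ac add_ac)
  have vs: "Z * Q powi (a + b + 2) * v n
      = Z * (h n * Z powi n * (\<psi> (n + a + 1) - \<psi> (n + a)) * (\<psi> (n + b + 1) - \<psi> (n + b)))" for n
  proof -
    have "Q powi (a + b + 2) * (Z * Q\<^sup>2) powi n = Z powi n * (Q powi (n + a + 1) * Q powi (n + b + 1))"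
      using assms Q_pos by (simp add: power_int_mult_distrib power_int_add power2_eq_square)
    then have "Z * Q powi (a + b + 2) * v n = Z * (h n * Z powi n * (Q powi (n + a + 1) * phi (Z * Q * Q) (n + a + 1)) *
        (Q powi (n + b + 1) * phi (Z * Q * Q) (n + b + 1)))"
      by (simp add: v_def power2_eq_square mult_ac add_ac)
    also have "\<dots> = Z * (h n * Z powi n * (\<psi> (n + a + 1) - \<psi> (n + a)) * (\<psi> (n + b + 1) - \<psi> (n + b)))"
      using phi_diff[of "Z * Q" "n + a + 1"] phi_diff[of "Z * Q" "n + b + 1"] by (simp add: \<psi>_def)
    finally show ?thesis .
  qed
  have us: "u n = h n * Z powi n * (\<psi> (n + a) - Z * \<psi> (n + a + 1)) * (\<psi> (n + b) - Z * \<psi> (n + b + 1))" for n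
    unfolding u_def \<psi>_def using phi_shift[of Z "n + a"] phi_shift[of Z "n + b"] by simp
  have alg: "z * (x - Z * x') * (y - Z * y') - Z * (z * (x' - x) * (y' - y)) = (1 - Z) * (z * x * y - Z * (z * x' * y'))"
    for x x' y y' z :: real
    by (simp add: algebra_simps)
  have eq: "u n - Z * Q powi (a + b + 2) * v n = (1 - Z) * (x n - y (n + 1))" for n
    unfolding us vs y1 unfolding x_def by (rule alg)
  have sv': "(\<lambda>n. Z * Q powi (a + b + 2) * v n) summable_on UNIV"
    by (intro summable_on_cmult_right sv)
  have sy1: "(\<lambda>n. y (n + 1)) summable_on UNIV"
    using sy by (simp add: summable_on_int_shift)
  have "infsum u UNIV - Z * Q powi (a + b + 2) * infsum v UNIV = (\<Sum>\<^sub>\<infinity>n. u n - Z * Q powi (a + b + 2) * v n)"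
    using infsum_diff_real[OF su sv'] infsum_cmult_right[OF sv, of "Z * Q powi (a + b + 2)"] by simp
  also have "\<dots> = (1 - Z) * (\<Sum>\<^sub>\<infinity>n. x n - y (n + 1))"
    unfolding eq
    by (intro infsum_cmult_right) (use summable_on_add[OF sx summable_on_uminus[THEN iffD2, OF sy1]] in simp)
  also have "(\<Sum>\<^sub>\<infinity>n. x n - y (n + 1)) = infsum x UNIV - infsum y UNIV"
    using infsum_diff_real[OF sx sy1] by (simp add: infsum_int_shift)
  also have "\<dots> = infsum w UNIV"
    using infsum_diff_real[OF sx sy] xy by simp
  finally show ?thesis
    by (simp add: heat_def u_def v_def w_def \<psi>_def)
qed

text \<open>For small \<open>\<zeta>\<close> the terms with \<open>n > 0\<close> carry a factor
  \<open>\<zeta>\<close>, those with \<open>n < 0\<close> vanish, and the term at 0 is within a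
  multiple of \<open>\<zeta>\<close> of \<open>h a * h b\<close>, which is nonnegative. The constant
  is uniform in \<open>a\<close> and \<open>b\<close> because \<open>heat_rec\<close> moves
  both.\<close>

lemma heat_lower_bound:
  assumes "0 < Z" "Z < 1"
  obtains C where "C \<ge> 0" "\<And>\<zeta> a b. 0 < \<zeta> \<Longrightarrow> \<zeta> \<le> Z \<Longrightarrow> - (C * \<zeta>) \<le> heat \<zeta> a b"
proof -
  \<comment> \<open>The first summand absorbs the term at \<open>n = 0\<close>, the second the terms
    with \<open>n > 0\<close>; its 1 / Z comes from splitting one factor \<open>\<zeta>\<close> off
    the power.\<close>
  define B where "B = A * (A + H) + H * A * A / Z"
  define S where "S = (\<Sum>\<^sub>\<infinity>n::int. Z ^ nat \<bar>n\<bar>)"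
  have B: "B \<ge> 0"
    using A_pos H_pos assms by (simp add: B_def)
  have s: "(\<lambda>n::int. Z ^ nat \<bar>n\<bar>) summable_on UNIV"
    using assms by (intro summable_on_int_geometric) auto
  have S: "S \<ge> 0"
    unfolding S_def using assms by (intro infsum_nonneg) auto
  show ?thesis
  proof (rule that[of "B * S"])
    show "0 \<le> B * S"
      using B S by simp
    fix \<zeta> a b assume \<zeta>: "0 < \<zeta>" "\<zeta> \<le> Z"
    have "- (B * \<zeta> * Z ^ nat \<bar>n\<bar>) \<le> h n * \<zeta> powi n * phi \<zeta> (n + a) * phi \<zeta> (n + b)" for n :: int
    proof -
      consider "n < 0" | "n = 0" | "n > 0"
        by linarith
      then show ?thesis
      proof cases
        case 1
        then show ?thesis
          using B \<zeta> by (simp add: h_def)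
      next
        case 2
        have d: "\<bar>phi \<zeta> m - h m\<bar> \<le> A * \<zeta>" for m
          using \<zeta> assms by (intro abs_phi_minus_h_le) auto
        have "\<bar>(phi \<zeta> a - h a) * phi \<zeta> b\<bar> \<le> A * \<zeta> * A"
          using \<zeta> assms by (intro abs_mult_le d abs_phi_le_A) auto
        moreover have "\<bar>h a * (phi \<zeta> b - h b)\<bar> \<le> H * (A * \<zeta>)"
          using h_nonneg[of a] h_le[of a] by (intro abs_mult_le d) auto
        moreover have "phi \<zeta> a * phi \<zeta> b = (phi \<zeta> a - h a) * phi \<zeta> b + h a * (phi \<zeta> b - h b) + h a * h b"
          by (simp add: algebra_simps)
        moreover have "0 \<le> h a * h b"
          by (simp add: h_nonneg)
        moreover have "A * (A + H) * \<zeta> = A * \<zeta> * A + H * (A * \<zeta>)"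
          by (simp add: algebra_simps)
        ultimately have "- (A * (A + H) * \<zeta>) \<le> phi \<zeta> a * phi \<zeta> b"
          by linarith
        moreover have "A * (A + H) * \<zeta> \<le> B * \<zeta>"
          using \<zeta> A_pos H_pos assms by (intro mult_right_mono) (auto simp: B_def)
        ultimately show ?thesis
          using 2 by (simp add: h_def)
      next
        case 3
        have "\<zeta> powi n = \<zeta> * \<zeta> ^ (nat n - 1)"
          using 3 by (simp add: power_int_nonneg_exp flip: power_Suc)
        also have "\<dots> \<le> \<zeta> * Z ^ (nat n - 1)"
          using \<zeta> by (intro mult_left_mono power_mono) auto
        also have "Z ^ (nat n - 1) = Z ^ nat \<bar>n\<bar> / Z"
          using 3 assms by (simp add: power_diff)
        finally have z: "\<zeta> powi n \<le> \<zeta> * (Z ^ nat \<bar>n\<bar> / Z)" .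
        have "\<bar>h n * \<zeta> powi n * phi \<zeta> (n + a) * phi \<zeta> (n + b)\<bar> \<le> H * (\<zeta> * (Z ^ nat \<bar>n\<bar> / Z)) * A * A"
          using z h_nonneg[of n] h_le[of n] \<zeta> assms by (intro abs_mult_le abs_phi_le_A) auto
        also have "\<dots> = H * A * A / Z * (\<zeta> * Z ^ nat \<bar>n\<bar>)"
          by simp
        also have "\<dots> \<le> B * (\<zeta> * Z ^ nat \<bar>n\<bar>)"
          using \<zeta> A_pos H_pos assms by (intro mult_right_mono) (auto simp: B_def)
        finally show ?thesis
          by (simp add: mult_ac)
      qed
    qed
    then have "(\<Sum>\<^sub>\<infinity>n::int. - (B * \<zeta> * Z ^ nat \<bar>n\<bar>)) \<le> heat \<zeta> a b"
      unfolding heat_def using \<zeta> assms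
      by (intro infsum_mono heat_summable) (auto intro!: summable_on_uminus[THEN iffD2] summable_on_cmult_right s)
    also have "(\<Sum>\<^sub>\<infinity>n::int. - (B * \<zeta> * Z ^ nat \<bar>n\<bar>)) = - (B * \<zeta> * S)"
      unfolding infsum_uminus S_def using infsum_cmult_right[OF s, of "B * \<zeta>"] by simp
    finally show "- (B * S * \<zeta>) \<le> heat \<zeta> a b"
      by (simp add: mult_ac)
  qed
qed

text \<open>
  By \<open>heat_lower_bound\<close> the kernel with parameter \<open>Z * Q ^ N\<close> is at least \<open>- C * Z * Q ^ N\<close>, and
  running \<open>heat_rec\<close> from there back to \<open>Z\<close> enlarges this defect by at most the factor \<open>v 0\<close>,
  uniformly in \<open>N\<close>.
\<close>

lemma heat_nonneg:
  assumes "0 < Z" "Z < 1"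
  shows "0 \<le> heat Z a b"
proof -
  obtain C where C: "C \<ge> 0" "\<And>\<zeta> a b. 0 < \<zeta> \<Longrightarrow> \<zeta> \<le> Z \<Longrightarrow> - (C * \<zeta>) \<le> heat \<zeta> a b"
    using heat_lower_bound[OF assms] by blast
  define c where "c = Z * Q powi (a + b + 2)"
  \<comment> \<open>The exponent is \<open>c\<close> times the sum of Q^k over k >= M, so
    \<open>v M\<close> dominates the product of the factors 1 + c Q^k, the cost of all recurrence
    steps from \<open>M\<close> on.\<close>
  define v where "v = (\<lambda>M. exp (c * Q ^ M / (1 - Q)))"
  have c: "c > 0"
    using assms Q_pos by (simp add: c_def)
  have v1: "v M \<ge> 1" for M
    using c Q_pos Q_lt1 by (simp add: v_def)
  have vrec: "v (Suc M) * (1 + c * Q ^ M) \<le> v M" for M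
  proof -
    have "v (Suc M) * exp (c * Q ^ M) = v M"
      using Q_lt1 by (simp add: v_def exp_add[symmetric] field_simps)
    moreover have "1 + c * Q ^ M \<le> exp (c * Q ^ M)"
      by (rule exp_ge_add_one_self)
    ultimately show ?thesis
      using mult_left_mono[of "1 + c * Q ^ M" "exp (c * Q ^ M)" "v (Suc M)"] v1[of "Suc M"] by simp
  qed
  have vmono: "v (Suc M) \<le> v M" for M
    using c Q_pos Q_lt1 Q_power_le1 by (auto simp: v_def intro!: divide_right_mono mult_left_mono mult_left_le_one_le)
  \<comment> \<open>The term with parameter \<open>Z * Q\<^sup>2\<close> in \<open>heat_rec\<close>
    raises both indices by one, hence the offset \<open>i\<close>. A positive offset only shrinks
    the power of \<open>Q\<close> in the coefficient, so one \<open>c\<close> serves for all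
    \<open>i\<close>.\<close>
  have claim: "- (C * (Z * Q ^ N) * v M) \<le> heat (Z * Q ^ M) (a + int i) (b + int i)" for N M i
  proof (induction "N - M" arbitrary: M i rule: less_induct)
    case less
    note bM = mult_Q_bounds[OF assms, of M]
    define \<epsilon> where "\<epsilon> = C * (Z * Q ^ N)"
    have \<epsilon>: "\<epsilon> \<ge> 0"
      using C assms Q_pos by (simp add: \<epsilon>_def)
    show ?case
    proof (cases "N \<le> M")
      case True
      have "C * (Z * Q ^ M) \<le> \<epsilon>"
        unfolding \<epsilon>_def using C(1) assms Q_pos Q_lt1 True by (intro mult_left_mono power_decreasing) auto
      also have "\<epsilon> \<le> \<epsilon> * v M"
        using \<epsilon> v1[of M] by (simp add: mult_left_le mult_le_cancel_left1)
      finally show ?thesis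
        using C(2)[OF bM(1,3), of "a + int i" "b + int i"] by (simp add: \<epsilon>_def)
    next
      case False
      define x where "x = heat (Z * Q ^ Suc M) (a + int i) (b + int i)"
      define y where "y = heat (Z * Q ^ Suc (Suc M)) (a + int (Suc i)) (b + int (Suc i))"
      have IHx: "- (\<epsilon> * v (Suc M)) \<le> x"
        unfolding x_def \<epsilon>_def using False by (intro less) auto
      have IHy: "- (\<epsilon> * v (Suc (Suc M))) \<le> y"
        unfolding y_def \<epsilon>_def using False by (intro less) auto
      have "\<epsilon> * v (Suc (Suc M)) \<le> \<epsilon> * v (Suc M)"
        using \<epsilon> vmono by (intro mult_left_mono) auto
      with IHy have IHy': "- (\<epsilon> * v (Suc M)) \<le> y"
        by linarith
      define d where "d = Z * Q ^ M * Q powi (a + int i + (b + int i) + 2)"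
      have d: "0 \<le> d" "d \<le> c * Q ^ M"
      proof -
        show "0 \<le> d"
          using assms Q_pos by (simp add: d_def)
        have "Q powi (a + int i + (b + int i) + 2) \<le> Q powi (a + b + 2)"
          using Q_pos Q_lt1 by (intro power_int_decreasing) auto
        then show "d \<le> c * Q ^ M"
          unfolding d_def c_def using assms Q_pos by (simp add: mult_ac mult_left_mono)
      qed
      have "heat (Z * Q ^ M) (a + int i) (b + int i) = d * y + (1 - Z * Q ^ M) * x"
        using heat_rec[OF bM(1,2), of "a + int i" "b + int i"]
        by (simp add: d_def x_def y_def power2_eq_square mult_ac add_ac)
      moreover have "d * (- (\<epsilon> * v (Suc M))) \<le> d * y"
        using d IHy' by (intro mult_left_mono) auto
      moreover have "(1 - Z * Q ^ M) * (- (\<epsilon> * v (Suc M))) \<le> (1 - Z * Q ^ M) * x"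
        using bM IHx by (intro mult_left_mono) auto
      moreover have "\<epsilon> * (v (Suc M) * (1 + c * Q ^ M)) \<le> \<epsilon> * v M"
        using \<epsilon> vrec by (intro mult_left_mono) auto
      moreover have "d * (\<epsilon> * v (Suc M)) \<le> c * Q ^ M * (\<epsilon> * v (Suc M))"
        using d \<epsilon> v1[of "Suc M"] by (intro mult_right_mono mult_nonneg_nonneg) auto
      moreover have "0 \<le> Z * Q ^ M * (\<epsilon> * v (Suc M))"
        using bM(1) \<epsilon> v1[of "Suc M"] by (intro mult_nonneg_nonneg less_imp_le[OF bM(1)]) auto
      moreover have "d * (- (\<epsilon> * v (Suc M))) = - (d * (\<epsilon> * v (Suc M)))"
        "(1 - Z * Q ^ M) * (- (\<epsilon> * v (Suc M))) = Z * Q ^ M * (\<epsilon> * v (Suc M)) - \<epsilon> * v (Suc M)"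
        "\<epsilon> * (v (Suc M) * (1 + c * Q ^ M)) = \<epsilon> * v (Suc M) + c * Q ^ M * (\<epsilon> * v (Suc M))"
        by (simp_all add: algebra_simps)
      ultimately show ?thesis
        unfolding \<epsilon>_def[symmetric] by linarith
    qed
  qed
  have "(\<lambda>N. - (C * (Z * Q ^ N) * v 0)) \<longlonglongrightarrow> - (C * (Z * 0) * v 0)"
    using Q_pos Q_lt1 by (intro tendsto_intros LIMSEQ_realpow_zero) auto
  then have "- (C * (Z * 0) * v 0) \<le> heat Z a b"
    by (rule LIMSEQ_le_const2) (use claim[of _ 0 0] in auto)
  then show ?thesis
    by simp
qed

text \<open>Half of the weight Z^n is spent on \<open>phi Z (n + d)\<close>, at the price Z^(-d/2);
  the other half gives convergence. Against \<open>Z powi d\<close> this still leaves Z^(d/2),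
  enough for the exchange of sums in \<open>heat_heat\<close>.\<close>

lemma heat_abs_bound:
  assumes "0 < Z" "Z < 1"
  obtains C where "C \<ge> 0" "\<And>a d. \<bar>heat Z a d\<bar> \<le> C * Z powr (- (1/2 * real_of_int d))"
proof -
  define \<rho> where "\<rho> = Z powr (1/2)"
  have \<rho>: "0 \<le> \<rho>" "\<rho> < 1"
    using assms powr_less_mono2[of "1/2" Z 1] by (simp_all add: \<rho>_def)
  define W where "W = (\<Sum>\<^sub>\<infinity>n::int. \<rho> ^ nat \<bar>n\<bar>)"
  have s: "(\<lambda>n::int. \<rho> ^ nat \<bar>n\<bar>) summable_on UNIV"
    by (rule summable_on_int_geometric[OF \<rho>])
  have W: "W \<ge> 0"
    unfolding W_def using \<rho> by (intro infsum_nonneg) auto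
  show ?thesis
  proof (rule that[of "H * A * A * W"])
    show "0 \<le> H * A * A * W"
      using H_pos A_pos W by simp
    fix a d
    have "\<bar>heat Z a d\<bar> \<le> (\<Sum>\<^sub>\<infinity>n::int. (H * A * A * Z powr (- (1/2 * real_of_int d))) * \<rho> ^ nat \<bar>n\<bar>)"
      unfolding heat_def
    proof (rule summable_on_bounded_by(3))
      show "(\<lambda>n::int. (H * A * A * Z powr (- (1/2 * real_of_int d))) * \<rho> ^ nat \<bar>n\<bar>) summable_on UNIV"
        by (intro summable_on_cmult_right s)
      fix n
      show "\<bar>h n * Z powi n * phi Z (n + a) * phi Z (n + d)\<bar>
          \<le> (H * A * A * Z powr (- (1/2 * real_of_int d))) * \<rho> ^ nat \<bar>n\<bar>"
      proof (cases "n < 0")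
        case True
        then show ?thesis
          using H_pos A_pos \<rho> by (simp add: h_def)
      next
        case False
        define x where "x = Z powr (1/2 * real_of_int (n + d))"
        have x: "x > 0" "x * \<bar>phi Z (n + d)\<bar> \<le> A"
          using assms powr_phi_le_A[of Z "1/2" "n + d"] by (simp_all add: x_def)
        have "\<bar>phi Z (n + d)\<bar> \<le> A / x"
          using x by (simp add: field_simps)
        moreover have "\<bar>h n * Z powi n\<bar> \<le> H * Z ^ nat \<bar>n\<bar>"
          by (rule h_powi_le) (use assms in auto)
        moreover have "\<bar>phi Z (n + a)\<bar> \<le> A"
          using assms by (intro abs_phi_le_A) auto
        ultimately have "\<bar>h n * Z powi n * phi Z (n + a) * phi Z (n + d)\<bar> \<le> H * Z ^ nat \<bar>n\<bar> * A * (A / x)"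
          by (metis abs_mult_le)
        also have "\<dots> = H * A * A * (Z ^ nat \<bar>n\<bar> / x)"
          by simp
        also have "Z ^ nat \<bar>n\<bar> / x = Z powr (- (1/2 * real_of_int d)) * \<rho> ^ nat \<bar>n\<bar>"
        proof -
          have "Z ^ nat \<bar>n\<bar> = Z powr real_of_int n"
            using False assms by (simp add: powr_int)
          moreover have "\<rho> ^ nat \<bar>n\<bar> = Z powr (1/2 * real_of_int n)"
            using False assms by (simp add: \<rho>_def powr_power mult.commute)
          ultimately show ?thesis
            using assms by (simp add: x_def powr_diff[symmetric] powr_add[symmetric] field_simps)
        qed
        also have "H * A * A * (Z powr (- (1/2 * real_of_int d)) * \<rho> ^ nat \<bar>n\<bar>)
            = (H * A * A * Z powr (- (1/2 * real_of_int d))) * \<rho> ^ nat \<bar>n\<bar>"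
          by simp
        finally show ?thesis .
      qed
    qed
    also have "\<dots> = H * A * A * W * Z powr (- (1/2 * real_of_int d))"
      unfolding W_def using infsum_cmult_right[OF s, of "H * A * A * Z powr (- (1/2 * real_of_int d))"]
      by (simp add: mult_ac)
    finally show "\<bar>heat Z a d\<bar> \<le> H * A * A * W * Z powr (- (1/2 * real_of_int d))" .
  qed
qed

text \<open>As a sequence in \<open>d\<close>, \<open>heat Z a d\<close> is the transform of
  \<open>h n * phi Z (n + a)\<close>, and orthogonality inverts the transform.\<close>

lemma heat_phi:
  assumes "0 < Z" "Z < 1"
  shows "(\<Sum>\<^sub>\<infinity>d. Z powi d * heat Z a d * phi Z (d + m)) = h m * phi Z (m + a)"
proof -
  define f where "f = (\<lambda>d n. (Z powi d * phi Z (d + m)) * (h n * Z powi n * phi Z (n + a) * phi Z (n + d)))"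
  have sf: "(\<lambda>n. h n * Z powi n * phi Z (n + a) * phi Z (n + d)) summable_on UNIV" for d
    by (rule heat_summable) (use assms in auto)
  have sp: "(\<lambda>d. Z powi d * phi Z (d + m) * phi Z (d + n)) summable_on UNIV" for n
    by (rule summable_powi_phi_phi) (use assms in auto)
  have "(\<Sum>\<^sub>\<infinity>d. Z powi d * heat Z a d * phi Z (d + m)) = (\<Sum>\<^sub>\<infinity>d. \<Sum>\<^sub>\<infinity>n. f d n)"
    unfolding f_def infsum_cmult_right[OF sf] heat_def by (simp add: mult_ac)
  also have "\<dots> = (\<Sum>\<^sub>\<infinity>n. \<Sum>\<^sub>\<infinity>d. f d n)"
  proof (rule infsum_swap_product)
    show "\<bar>f d n\<bar> \<le> (Z powi d * \<bar>phi Z (d + m)\<bar>) * (A * A * \<bar>h n * Z powi n\<bar>)" for d n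
    proof -
      have 1: "\<bar>(h n * Z powi n) * phi Z (n + a) * phi Z (n + d)\<bar> \<le> \<bar>h n * Z powi n\<bar> * A * A"
        using assms by (intro abs_mult_le abs_phi_le_A) auto
      have 2: "\<bar>Z powi d * phi Z (d + m)\<bar> \<le> Z powi d * \<bar>phi Z (d + m)\<bar>"
        using assms by (simp add: abs_mult)
      have "\<bar>f d n\<bar> \<le> (Z powi d * \<bar>phi Z (d + m)\<bar>) * (\<bar>h n * Z powi n\<bar> * A * A)"
        unfolding f_def by (rule abs_mult_le[OF 2 1])
      then show ?thesis
        by (simp add: mult_ac)
    qed
    show "(\<lambda>n. A * A * \<bar>h n * Z powi n\<bar>) summable_on UNIV"
      by (intro summable_on_cmult_right summable_on_abs_real h_powi_summable assms)
  qed (rule summable_powi_abs_phi[OF assms])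
  also have "\<dots> = (\<Sum>\<^sub>\<infinity>n. h n * Z powi n * phi Z (n + a) * (if m = n then Z powi (- m) else 0))"
  proof (rule infsum_cong)
    fix n
    have "(\<Sum>\<^sub>\<infinity>d. f d n) = (\<Sum>\<^sub>\<infinity>d. (h n * Z powi n * phi Z (n + a)) * (Z powi d * phi Z (d + m) * phi Z (d + n)))"
      by (simp add: f_def mult_ac add_ac)
    also have "\<dots> = h n * Z powi n * phi Z (n + a) * (if m = n then Z powi (- m) else 0)"
      unfolding infsum_cmult_right[OF sp] phi_orthogonal[OF assms] ..
    finally show "(\<Sum>\<^sub>\<infinity>d. f d n) = h n * Z powi n * phi Z (n + a) * (if m = n then Z powi (- m) else 0)" .
  qed
  also have "\<dots> = h m * phi Z (m + a)"
    using has_sum_finite_neutralI[of "{m}" UNIV "\<lambda>n. h n * Z powi n * phi Z (n + a) * (if m = n then Z powi (- m) else 0)"] assms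
    by (intro infsumI) (auto simp: power_int_minus field_simps)
  finally show ?thesis .
qed

lemma heat_heat:
  assumes "0 < Z" "Z < 1"
  shows "(\<lambda>d. Z powi d * heat Z a d * heat Z m (m + d)) summable_on UNIV"
    and "(\<Sum>\<^sub>\<infinity>d. Z powi d * heat Z a d * heat Z m (m + d))
      = (\<Sum>\<^sub>\<infinity>k. h k * Z powi k * phi Z (k + m) * (h (k + m) * phi Z (k + m + a)))"
proof -
  obtain C where C: "C \<ge> 0" "\<And>a d. \<bar>heat Z a d\<bar> \<le> C * Z powr (- (1/2 * real_of_int d))"
    using heat_abs_bound[OF assms] by blast
  define S where "S = (\<Sum>\<^sub>\<infinity>n. Z powr (1/2 * real_of_int n) * \<bar>phi Z n\<bar>)"
  define \<rho> where "\<rho> = Z powr (1/2)"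
  have \<rho>: "0 \<le> \<rho>" "\<rho> < 1"
    using assms powr_less_mono2[of "1/2" Z 1] by (simp_all add: \<rho>_def)
  define f where "f = (\<lambda>k d. (Z powi d * heat Z a d) * (h k * Z powi k * phi Z (k + m) * phi Z (k + (m + d))))"
  define c where "c = (\<lambda>k. C * A * \<bar>h k * Z powi k\<bar>)"
  define g where "g = (\<lambda>k d. c k * (Z powr (1/2 * real_of_int d) * \<bar>phi Z (d + (k + m))\<bar>))"
  have sg: "g k summable_on UNIV" for k
    unfolding g_def by (intro summable_on_cmult_right summable_powr_phi_shift) (use assms in auto)
  have fg: "\<bar>f k d\<bar> \<le> g k d" for k d
  proof -
    have zd: "Z powi d = Z powr (1/2 * real_of_int d) * Z powr (1/2 * real_of_int d)"
      using assms by (simp add: powr_add[symmetric] powr_real_of_int' flip: powr_real_of_int')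
    have "Z powi d * \<bar>heat Z a d\<bar> \<le> Z powi d * (C * Z powr (- (1/2 * real_of_int d)))"
      using assms C(2) by (intro mult_left_mono) auto
    also have "\<dots> = C * Z powr (1/2 * real_of_int d)"
      using assms by (simp add: zd powr_minus field_simps)
    finally have 1: "\<bar>Z powi d * heat Z a d\<bar> \<le> C * Z powr (1/2 * real_of_int d)"
      using assms by (simp add: abs_mult)
    have 2: "\<bar>h k * Z powi k * phi Z (k + m) * phi Z (k + (m + d))\<bar> \<le> \<bar>h k * Z powi k\<bar> * A * \<bar>phi Z (d + (k + m))\<bar>"
      using assms by (intro abs_mult_le abs_phi_le_A) (auto simp: add_ac)
    show ?thesis
      using abs_mult_le[OF 1 2] by (simp add: f_def g_def c_def mult_ac)
  qed
  define u where "u = (\<lambda>k::int. (C * A * H * Z powr (- (1/2 * real_of_int m)) * S) * \<rho> ^ nat \<bar>k\<bar>)"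
  have S: "S \<ge> 0"
    unfolding S_def by (intro infsum_nonneg) auto
  have gu: "infsum (g k) UNIV \<le> u k" for k
  proof -
    have "infsum (g k) UNIV = c k * (Z powr (- (1/2 * real_of_int (k + m))) * S)"
      unfolding g_def S_def using summable_powr_phi_shift[OF assms, of "1/2" "k + m"]
      by (subst infsum_cmult_right) auto
    also have "\<dots> \<le> u k"
    proof (cases "k < 0")
      case True
      then show ?thesis
        using C A_pos H_pos S \<rho> by (simp add: c_def u_def h_def)
    next
      case False
      have "c k \<le> C * A * (H * Z ^ nat \<bar>k\<bar>)"
        unfolding c_def using h_powi_le[OF assms(1) order_refl, of k] C A_pos by (intro mult_left_mono) auto
      then have "c k * (Z powr (- (1/2 * real_of_int (k + m))) * S)
          \<le> C * A * (H * Z ^ nat \<bar>k\<bar>) * (Z powr (- (1/2 * real_of_int (k + m))) * S)"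
        using S by (intro mult_right_mono) auto
      also have "Z ^ nat \<bar>k\<bar> * Z powr (- (1/2 * real_of_int (k + m))) = Z powr (- (1/2 * real_of_int m)) * \<rho> ^ nat \<bar>k\<bar>"
      proof -
        have "Z ^ nat \<bar>k\<bar> = Z powr real_of_int k"
          using False assms by (simp add: powr_int)
        moreover have "\<rho> ^ nat \<bar>k\<bar> = Z powr (1/2 * real_of_int k)"
          using False assms by (simp add: \<rho>_def powr_power mult.commute)
        ultimately show ?thesis
          using assms by (simp add: powr_add[symmetric] field_simps)
      qed
      then have "C * A * (H * Z ^ nat \<bar>k\<bar>) * (Z powr (- (1/2 * real_of_int (k + m))) * S) = u k"
        by (simp add: u_def mult_ac)
      finally show ?thesis .
    qed
    finally show ?thesis .
  qed
  have u: "u summable_on UNIV"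
    unfolding u_def by (intro summable_on_cmult_right summable_on_int_geometric \<rho>)
  have sfs: "(\<lambda>(k, d). f k d) summable_on UNIV \<times> UNIV"
    by (rule summable_on_Times_bounded_by[OF fg sg gu u])
  have sh: "(\<lambda>k. h k * Z powi k * phi Z (k + m) * phi Z (k + (m + d))) summable_on UNIV" for d
    by (rule heat_summable) (use assms in auto)
  have e: "Z powi d * heat Z a d * heat Z m (m + d) = (\<Sum>\<^sub>\<infinity>k. f k d)" for d
    unfolding f_def infsum_cmult_right[OF sh] by (simp add: heat_def)
  have sfs': "(\<lambda>(d, k). f k d) summable_on UNIV \<times> UNIV"
    using sfs summable_on_swap[of "\<lambda>(k, d). f k d" UNIV UNIV] by simp
  show "(\<lambda>d. Z powi d * heat Z a d * heat Z m (m + d)) summable_on UNIV"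
    unfolding e using summable_on_Sigma_banach[OF sfs'] by simp
  have "(\<Sum>\<^sub>\<infinity>d. Z powi d * heat Z a d * heat Z m (m + d)) = (\<Sum>\<^sub>\<infinity>k. \<Sum>\<^sub>\<infinity>d. f k d)"
    unfolding e by (rule infsum_swap_banach[OF sfs'])
  also have "\<dots> = (\<Sum>\<^sub>\<infinity>k. h k * Z powi k * phi Z (k + m) * (h (k + m) * phi Z (k + m + a)))"
  proof (rule infsum_cong)
    fix k
    define t where "t = (\<lambda>d. Z powi d * heat Z a d * phi Z (d + (k + m)))"
    have ft: "f k d = (h k * Z powi k * phi Z (k + m)) * t d" for d
      by (simp add: f_def t_def mult_ac add_ac)
    show "(\<Sum>\<^sub>\<infinity>d. f k d) = h k * Z powi k * phi Z (k + m) * (h (k + m) * phi Z (k + m + a))"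
      unfolding ft infsum_cmult_right' unfolding t_def by (simp add: heat_phi[OF assms] add_ac)
  qed
  finally show "(\<Sum>\<^sub>\<infinity>d. Z powi d * heat Z a d * heat Z m (m + d))
      = (\<Sum>\<^sub>\<infinity>k. h k * Z powi k * phi Z (k + m) * (h (k + m) * phi Z (k + m + a)))" .
qed

text \<open>
  The sum of \<open>Z powi d * heat Z a d\<close> over all \<open>d\<close> cannot be exchanged with the sum defining \<open>heat\<close>.
  It is tested against the positive sequence \<open>heat Z m (m + d)\<close>, which tends to a constant as
  \<open>m\<close> grows.
\<close>

lemma heat_row_sum_le:
  assumes "0 < Z" "Z < 1" "finite J"
  shows "(\<Sum>d\<in>J. Z powi d * heat Z a d) \<le> H"
proof -
  define \<kappa> where "\<kappa> = H * euler Z"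
  define G where "G = (\<Sum>\<^sub>\<infinity>n. h n * Z powi n)"
  have \<kappa>: "\<kappa> > 0"
    using H_pos qpoch_inf_pos assms by (simp add: \<kappa>_def euler_eq)
  note hZ = h_powi_summable[OF assms(1,2)]
  have "sum (\<lambda>n. h n * Z powi n) {0} \<le> G"
    unfolding G_def by (rule finite_sum_le_infsum[OF hZ]) (use h_nonneg assms in auto)
  then have G: "G > 0"
    by (simp add: h_def)
  have p: "(\<lambda>m. phi Z (n + int m)) \<longlonglongrightarrow> \<kappa>" for n
    unfolding \<kappa>_def by (rule phi_tendsto)
  have l1: "(\<lambda>m. heat Z (int m) (int m + d)) \<longlonglongrightarrow> (\<Sum>\<^sub>\<infinity>n. h n * Z powi n * \<kappa> * \<kappa>)" for d
    unfolding heat_def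
  proof (rule infsum_tendsto_dominated[where w = "\<lambda>n. \<bar>h n * Z powi n\<bar> * A * A"])
    show "(\<lambda>m. h n * Z powi n * phi Z (n + int m) * phi Z (n + (int m + d))) \<longlonglongrightarrow> h n * Z powi n * \<kappa> * \<kappa>" for n
      using p[of n] p[of "n + d"] by (intro tendsto_mult tendsto_const) (simp_all add: add_ac)
    show "\<bar>h n * Z powi n * phi Z (n + int m) * phi Z (n + (int m + d))\<bar> \<le> \<bar>h n * Z powi n\<bar> * A * A" for n m
      using assms by (intro abs_mult_le abs_phi_le_A) auto
  qed (intro summable_on_cmult_left summable_on_abs_real hZ)
  have l2: "(\<lambda>m. \<Sum>\<^sub>\<infinity>k. h k * Z powi k * phi Z (k + int m) * (h (k + int m) * phi Z (k + int m + a)))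
      \<longlonglongrightarrow> (\<Sum>\<^sub>\<infinity>k. h k * Z powi k * \<kappa> * (H * \<kappa>))"
  proof (rule infsum_tendsto_dominated[where w = "\<lambda>n. \<bar>h n * Z powi n\<bar> * A * (H * A)"])
    show "(\<lambda>m. h n * Z powi n * phi Z (n + int m) * (h (n + int m) * phi Z (n + int m + a)))
        \<longlonglongrightarrow> h n * Z powi n * \<kappa> * (H * \<kappa>)" for n
      using p[of n] p[of "n + a"] h_tendsto[of n] by (intro tendsto_mult tendsto_const) (simp_all add: add_ac)
    show "\<bar>h n * Z powi n * phi Z (n + int m) * (h (n + int m) * phi Z (n + int m + a))\<bar>
        \<le> \<bar>h n * Z powi n\<bar> * A * (H * A)" for n m
      using assms h_nonneg[of "n + int m"] h_le[of "n + int m"] by (intro abs_mult_le abs_phi_le_A) auto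
  qed (intro summable_on_cmult_left summable_on_abs_real hZ)
  \<comment> \<open>Restricting the full sum to \<open>J\<close> is where nonnegativity of
    \<open>heat\<close> enters. In the limit the left side carries the factor G \<kappa>^2 and the
    right side is H G \<kappa>^2, the extra \<open>H\<close> being the limit of
    \<open>h\<close>.\<close>
  have "(\<Sum>d\<in>J. Z powi d * heat Z a d * (\<Sum>\<^sub>\<infinity>n. h n * Z powi n * \<kappa> * \<kappa>))
      \<le> (\<Sum>\<^sub>\<infinity>k. h k * Z powi k * \<kappa> * (H * \<kappa>))"
  proof (rule LIMSEQ_le)
    show "(\<lambda>m. \<Sum>d\<in>J. Z powi d * heat Z a d * heat Z (int m) (int m + d))
        \<longlonglongrightarrow> (\<Sum>d\<in>J. Z powi d * heat Z a d * (\<Sum>\<^sub>\<infinity>n. h n * Z powi n * \<kappa> * \<kappa>))"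
      by (intro tendsto_sum tendsto_mult tendsto_const l1)
    show "\<exists>N. \<forall>m\<ge>N. (\<Sum>d\<in>J. Z powi d * heat Z a d * heat Z (int m) (int m + d))
        \<le> (\<Sum>\<^sub>\<infinity>k. h k * Z powi k * phi Z (k + int m) * (h (k + int m) * phi Z (k + int m + a)))"
      unfolding heat_heat(2)[OF assms(1,2), symmetric] using assms heat_nonneg[OF assms(1,2)]
      by (intro exI allI impI finite_sum_le_infsum heat_heat) auto
  qed (rule l2)
  moreover have "(\<Sum>\<^sub>\<infinity>n. h n * Z powi n * \<kappa> * \<kappa>) = G * \<kappa> * \<kappa>"
    "(\<Sum>\<^sub>\<infinity>n. h n * Z powi n * \<kappa> * (H * \<kappa>)) = G * \<kappa> * (H * \<kappa>)"
    unfolding G_def infsum_cmult_left' by simp_all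
  ultimately have "(\<Sum>d\<in>J. Z powi d * heat Z a d) * (G * \<kappa> * \<kappa>) \<le> G * \<kappa> * (H * \<kappa>)"
    by (simp only: sum_distrib_right)
  then have "(\<Sum>d\<in>J. Z powi d * heat Z a d) * (G * \<kappa> * \<kappa>) \<le> H * (G * \<kappa> * \<kappa>)"
    by (simp only: mult_ac)
  then show ?thesis
    using G \<kappa> by simp
qed

section \<open>The product kernel\<close>

definition triple :: "real \<Rightarrow> int \<Rightarrow> int \<Rightarrow> int \<Rightarrow> real" where
  "triple Z a b d = (\<Sum>\<^sub>\<infinity>n. Z powi n * phi Z (n + a) * phi Z (n + b) * phi Z (n + d))"

lemma triple_perm: "triple Z a b d = triple Z b a d" "triple Z a b d = triple Z a d b"
  by (simp_all add: triple_def mult_ac)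

text \<open>The factor \<open>phi Z (n + d)\<close> is expanded and \<open>n\<close> is shifted by
  \<open>d + int l\<close>, so that \<open>h\<close> is evaluated at the summation index; what
  remains for each \<open>l\<close> is a heat kernel.\<close>

lemma triple_expand:
  assumes "0 < Z" "Z < 1"
  defines "t \<equiv> \<lambda>a b d l. ecoeff l * Z ^ l * (Z powi (- (d + int l)) * heat Z (b - d - int l) (a - d - int l))"
  shows "t a b d summable_on UNIV" "triple Z a b d = (\<Sum>\<^sub>\<infinity>l. t a b d l)"
proof -
  define u where "u = (\<lambda>n. Z powi n * phi Z (n + a) * phi Z (n + b))"
  define f where "f = (\<lambda>n l. u n * (ecoeff l * Z ^ l * h (n + d + int l)))"
  have u: "u summable_on UNIV"
    unfolding u_def by (rule summable_powi_phi_phi) (use assms in auto)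
  have v: "(\<lambda>l. H * (\<bar>ecoeff l\<bar> * Z ^ l)) summable_on UNIV"
    using ecoeff_summable_on[of Z] assms by (intro summable_on_cmult_right) simp
  have bound: "\<bar>f n l\<bar> \<le> \<bar>u n\<bar> * (H * (\<bar>ecoeff l\<bar> * Z ^ l))" for n l
  proof -
    have "\<bar>u n * ((ecoeff l * Z ^ l) * h (n + d + int l))\<bar> \<le> \<bar>u n\<bar> * ((\<bar>ecoeff l\<bar> * Z ^ l) * H)"
      using h_nonneg[of "n + d + int l"] h_le[of "n + d + int l"] assms
      by (intro abs_mult_le) (auto simp: abs_mult)
    then show ?thesis
      by (simp add: f_def mult_ac)
  qed
  have inner: "(\<Sum>\<^sub>\<infinity>n. f n l) = t a b d l" for l
  proof -
    define w where "w = (\<lambda>n. h n * Z powi n * phi Z (n + (b - d - int l)) * phi Z (n + (a - d - int l)))"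
    have e: "f n l = (ecoeff l * Z ^ l * Z powi (- (d + int l))) * w (n + (d + int l))" for n
      using assms by (simp add: f_def u_def w_def power_int_add power_int_diff power_int_minus field_simps)
    have "(\<Sum>\<^sub>\<infinity>n. f n l) = (ecoeff l * Z ^ l * Z powi (- (d + int l))) * infsum w UNIV"
      unfolding e infsum_cmult_right' infsum_int_shift ..
    then show ?thesis
      by (simp add: t_def heat_def w_def mult_ac)
  qed
  have sfs: "(\<lambda>(n, l). f n l) summable_on UNIV \<times> UNIV"
    by (rule summable_on_bounded_by(1)[OF summable_on_Times_mult[OF summable_on_abs_real[OF u] v]]) (use bound in auto)
  have sfs': "(\<lambda>(l, n). f n l) summable_on UNIV \<times> UNIV"
    using sfs summable_on_swap[of "\<lambda>(n, l). f n l" UNIV UNIV] by simp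
  show "t a b d summable_on UNIV"
    using summable_on_Sigma_banach[OF sfs'] inner by simp
  have "triple Z a b d = (\<Sum>\<^sub>\<infinity>n. \<Sum>\<^sub>\<infinity>l. f n l)"
    unfolding f_def infsum_cmult_right' by (simp add: triple_def u_def phi_def)
  also have "\<dots> = (\<Sum>\<^sub>\<infinity>l. \<Sum>\<^sub>\<infinity>n. f n l)"
    by (rule infsum_swap_banach[OF sfs])
  finally show "triple Z a b d = (\<Sum>\<^sub>\<infinity>l. t a b d l)"
    by (simp add: inner)
qed

text \<open>After the expansion every \<open>l\<close> contributes a reindexed piece of a heat row,
  of mass at most \<open>H\<close>, and only \<open>ecoeff\<close> needs absolute values. Taking
  \<open>J\<close> finite allows the exchange with the sum over \<open>l\<close> before summability
  in \<open>a\<close> is known.\<close>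

lemma triple_sum_le:
  assumes "0 < Z" "Z < 1" "finite J"
  shows "(\<Sum>a\<in>J. Z powi a * \<bar>triple Z a b d\<bar>) \<le> H * euler (- Z)"
proof -
  define t where "t = (\<lambda>a l. ecoeff l * Z ^ l * (Z powi (- (d + int l)) * heat Z (b - d - int l) (a - d - int l)))"
  have s: "t a summable_on UNIV" for a
    unfolding t_def by (rule triple_expand(1)[OF assms(1,2)])
  have sa: "(\<lambda>l. Z powi a * \<bar>t a l\<bar>) summable_on UNIV" for a
    by (intro summable_on_cmult_right summable_on_abs_real s)
  have "(\<Sum>a\<in>J. Z powi a * \<bar>triple Z a b d\<bar>) \<le> (\<Sum>a\<in>J. \<Sum>\<^sub>\<infinity>l. Z powi a * \<bar>t a l\<bar>)"
  proof (rule sum_mono)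
    fix a
    have "\<bar>triple Z a b d\<bar> \<le> (\<Sum>\<^sub>\<infinity>l. \<bar>t a l\<bar>)"
      unfolding triple_expand(2)[OF assms(1,2)]
      by (rule summable_on_bounded_by(3)[OF summable_on_abs_real[OF s]]) (simp add: t_def)
    then show "Z powi a * \<bar>triple Z a b d\<bar> \<le> (\<Sum>\<^sub>\<infinity>l. Z powi a * \<bar>t a l\<bar>)"
      unfolding infsum_cmult_right' using assms by (intro mult_left_mono) auto
  qed
  also have "\<dots> = (\<Sum>\<^sub>\<infinity>l. \<Sum>a\<in>J. Z powi a * \<bar>t a l\<bar>)"
    using infsum_sum_real(2)[where J = J, OF sa] by simp
  also have "\<dots> \<le> (\<Sum>\<^sub>\<infinity>l. H * (\<bar>ecoeff l\<bar> * Z ^ l))"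
  proof (rule infsum_mono)
    show "(\<lambda>l. \<Sum>a\<in>J. Z powi a * \<bar>t a l\<bar>) summable_on UNIV"
      by (rule infsum_sum_real(1)[OF sa])
    show "(\<lambda>l. H * (\<bar>ecoeff l\<bar> * Z ^ l)) summable_on UNIV"
      using ecoeff_summable_on[of Z] assms by (intro summable_on_cmult_right) simp
    fix l
    define J' where "J' = (\<lambda>a. a - d - int l) ` J"
    have "Z powi a * \<bar>t a l\<bar> = (\<bar>ecoeff l\<bar> * Z ^ l) * (Z powi (a - d - int l) * heat Z (b - d - int l) (a - d - int l))" for a
      using assms heat_nonneg[OF assms(1,2), of "b - d - int l" "a - d - int l"]
      by (simp add: t_def abs_mult power_int_diff power_int_minus power_int_add field_simps)
    then have "(\<Sum>a\<in>J. Z powi a * \<bar>t a l\<bar>)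
        = (\<bar>ecoeff l\<bar> * Z ^ l) * (\<Sum>a\<in>J. Z powi (a - d - int l) * heat Z (b - d - int l) (a - d - int l))"
      by (simp add: sum_distrib_left)
    also have "(\<Sum>a\<in>J. Z powi (a - d - int l) * heat Z (b - d - int l) (a - d - int l))
        = (\<Sum>a\<in>J'. Z powi a * heat Z (b - d - int l) a)"
      unfolding J'_def by (subst sum.reindex) (auto simp: inj_on_def)
    also have "(\<bar>ecoeff l\<bar> * Z ^ l) * \<dots> \<le> (\<bar>ecoeff l\<bar> * Z ^ l) * H"
      using assms by (intro mult_left_mono heat_row_sum_le) (auto simp: J'_def)
    finally show "(\<Sum>a\<in>J. Z powi a * \<bar>t a l\<bar>) \<le> H * (\<bar>ecoeff l\<bar> * Z ^ l)"
      by (simp only: mult_ac)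
  qed
  also have "\<dots> = H * euler (- Z)"
    using assms unfolding infsum_cmult_right' by (simp add: infsum_abs_ecoeff)
  finally show ?thesis .
qed

text \<open>The product formula: in the variable \<open>a\<close>, \<open>triple\<close> is the
  transform of \<open>phi Z (n + b) * phi Z (n + d)\<close>, and orthogonality inverts it.\<close>

lemma triple_phi:
  assumes "0 < Z" "Z < 1"
  shows "(\<Sum>\<^sub>\<infinity>a. Z powi a * triple Z a b d * phi Z (a + m)) = phi Z (m + b) * phi Z (m + d)"
proof -
  define f where "f = (\<lambda>a n. (Z powi a * phi Z (a + m)) * (Z powi n * phi Z (n + a) * phi Z (n + b) * phi Z (n + d)))"
  have "(\<Sum>\<^sub>\<infinity>a. Z powi a * triple Z a b d * phi Z (a + m)) = (\<Sum>\<^sub>\<infinity>a. \<Sum>\<^sub>\<infinity>n. f a n)"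
    unfolding f_def infsum_cmult_right' triple_def by (simp add: mult_ac)
  also have "\<dots> = (\<Sum>\<^sub>\<infinity>n. \<Sum>\<^sub>\<infinity>a. f a n)"
  proof (rule infsum_swap_product)
    show "\<bar>f a n\<bar> \<le> \<bar>Z powi a * phi Z (a + m)\<bar> * (\<bar>Z powi n * phi Z (n + b) * phi Z (n + d)\<bar> * A)" for a n
    proof -
      have "\<bar>(Z powi a * phi Z (a + m)) * ((Z powi n * phi Z (n + b) * phi Z (n + d)) * phi Z (n + a))\<bar>
          \<le> \<bar>Z powi a * phi Z (a + m)\<bar> * (\<bar>Z powi n * phi Z (n + b) * phi Z (n + d)\<bar> * A)"
        using assms by (intro abs_mult_le abs_phi_le_A) auto
      then show ?thesis
        by (simp add: f_def mult_ac)
    qed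
    show "(\<lambda>a. \<bar>Z powi a * phi Z (a + m)\<bar>) summable_on UNIV"
      by (intro summable_on_abs_real summable_powi_phi) (use assms in auto)
    show "(\<lambda>n. \<bar>Z powi n * phi Z (n + b) * phi Z (n + d)\<bar> * A) summable_on UNIV"
      by (intro summable_on_cmult_left summable_on_abs_real summable_powi_phi_phi) (use assms in auto)
  qed
  also have "\<dots> = (\<Sum>\<^sub>\<infinity>n. Z powi n * phi Z (n + b) * phi Z (n + d) * (if m = n then Z powi (- m) else 0))"
  proof (rule infsum_cong)
    fix n
    have "(\<Sum>\<^sub>\<infinity>a. f a n) = (\<Sum>\<^sub>\<infinity>a. (Z powi n * phi Z (n + b) * phi Z (n + d)) * (Z powi a * phi Z (a + m) * phi Z (a + n)))"
      by (simp add: f_def mult_ac add_ac)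
    then show "(\<Sum>\<^sub>\<infinity>a. f a n) = Z powi n * phi Z (n + b) * phi Z (n + d) * (if m = n then Z powi (- m) else 0)"
      unfolding infsum_cmult_right' phi_orthogonal[OF assms] .
  qed
  also have "\<dots> = phi Z (m + b) * phi Z (m + d)"
    using has_sum_finite_neutralI[of "{m}" UNIV "\<lambda>n. Z powi n * phi Z (n + b) * phi Z (n + d) * (if m = n then Z powi (- m) else 0)"] assms
    by (intro infsumI) (auto simp: power_int_minus field_simps)
  finally show ?thesis .
qed

text \<open>As \<open>m\<close> tends to infinity in the product formula, every \<open>phi\<close>
  becomes \<open>\<kappa>\<close>, so \<open>\<kappa>\<close> times the row sum equals
  \<kappa>^2.\<close>

lemma triple_row_sum:
  assumes "0 < Z" "Z < 1"
  shows "(\<lambda>a. Z powi a * \<bar>triple Z a b d\<bar>) summable_on UNIV"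
    and "(\<Sum>\<^sub>\<infinity>a. Z powi a * triple Z a b d) = H * euler Z"
proof -
  show s: "(\<lambda>a. Z powi a * \<bar>triple Z a b d\<bar>) summable_on UNIV"
    by (rule summable_on_finite_sums_le(1)[OF _ triple_sum_le[OF assms]]) (use assms in auto)
  define \<kappa> where "\<kappa> = H * euler Z"
  have \<kappa>: "\<kappa> > 0"
    using H_pos qpoch_inf_pos assms by (simp add: \<kappa>_def euler_eq)
  have p: "(\<lambda>m. phi Z (n + int m)) \<longlonglongrightarrow> \<kappa>" for n
    unfolding \<kappa>_def by (rule phi_tendsto)
  have "(\<lambda>m. \<Sum>\<^sub>\<infinity>a. Z powi a * triple Z a b d * phi Z (a + int m)) \<longlonglongrightarrow> (\<Sum>\<^sub>\<infinity>a. Z powi a * triple Z a b d * \<kappa>)"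
  proof (rule infsum_tendsto_dominated[where w = "\<lambda>a. Z powi a * \<bar>triple Z a b d\<bar> * A"])
    show "\<bar>Z powi a * triple Z a b d * phi Z (a + int m)\<bar> \<le> Z powi a * \<bar>triple Z a b d\<bar> * A" for m a
      using assms by (intro abs_mult_le abs_phi_le_A) (auto simp: abs_mult)
  qed (intro tendsto_mult tendsto_const p summable_on_cmult_left s)+
  moreover have "(\<lambda>m. phi Z (int m + b) * phi Z (int m + d)) \<longlonglongrightarrow> \<kappa> * \<kappa>"
    using p[of b] p[of d] by (intro tendsto_mult) (simp_all add: add_ac)
  ultimately have "(\<Sum>\<^sub>\<infinity>a. Z powi a * triple Z a b d * \<kappa>) = \<kappa> * \<kappa>"
    unfolding triple_phi[OF assms] by (rule LIMSEQ_unique)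
  then have "(\<Sum>\<^sub>\<infinity>a. Z powi a * triple Z a b d) = \<kappa>"
    unfolding infsum_cmult_left' using \<kappa> by simp
  then show "(\<Sum>\<^sub>\<infinity>a. Z powi a * triple Z a b d) = H * euler Z"
    by (simp add: \<kappa>_def)
qed

section \<open>The transform on sequences\<close>

definition lp :: "real \<Rightarrow> real \<Rightarrow> (int \<Rightarrow> real) \<Rightarrow> bool" where
  "lp Z p F \<longleftrightarrow> (\<lambda>n. Z powi n * \<bar>F n\<bar> powr p) summable_on UNIV"

definition four :: "real \<Rightarrow> (int \<Rightarrow> real) \<Rightarrow> int \<Rightarrow> real" where
  "four Z F m = (\<Sum>\<^sub>\<infinity>n. Z powi n * F n * phi Z (n + m))"

text \<open>A bound on \<open>four\<close> alone would not justify exchanging its defining sum with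
  another one; this majorant survives such an exchange.\<close>

definition absfour :: "real \<Rightarrow> (int \<Rightarrow> real) \<Rightarrow> int \<Rightarrow> real" where
  "absfour Z F m = (\<Sum>\<^sub>\<infinity>n. \<bar>Z powi n * F n * phi Z (n + m)\<bar>)"

text \<open>A single term of a nonnegative series is at most its sum.\<close>

lemma lp_decay:
  assumes "0 < Z" "1 \<le> p" "lp Z p F"
  obtains B where "B \<ge> 0" "\<And>n. \<bar>F n\<bar> \<le> B * Z powr (- (real_of_int n / p))"
proof (rule that)
  define P where "P = (\<Sum>\<^sub>\<infinity>n. Z powi n * \<bar>F n\<bar> powr p)"
  show "0 \<le> P powr (1 / p)"
    by simp
  fix n
  have "sum (\<lambda>n. Z powi n * \<bar>F n\<bar> powr p) {n} \<le> P"
    unfolding P_def by (rule finite_sum_le_infsum) (use assms in \<open>auto simp: lp_def\<close>)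
  then have "Z powr real_of_int n * \<bar>F n\<bar> powr p \<le> P"
    using assms(1) by (simp add: powr_real_of_int')
  then have "(Z powr real_of_int n * \<bar>F n\<bar> powr p) powr (1 / p) \<le> P powr (1 / p)"
    using assms by (intro powr_mono2) auto
  moreover have "(Z powr real_of_int n * \<bar>F n\<bar> powr p) powr (1 / p) = Z powr (real_of_int n / p) * \<bar>F n\<bar>"
    using assms by (simp add: powr_mult powr_powr)
  ultimately show "\<bar>F n\<bar> \<le> P powr (1 / p) * Z powr (- (real_of_int n / p))"
    using assms(1) by (simp add: powr_minus field_simps)
qed

text \<open>For \<open>p > 1\<close>, \<open>lp_decay\<close> leaves the positive fraction
  \<open>\<theta> = 1 - 1 / p\<close> of the weight, and shifting by \<open>m\<close> costs the
  stated power. For \<open>p = 1\<close> this fraction is 0, and boundedness of \<open>phi\<close>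
  takes over.\<close>

lemma absfour_bound:
  assumes "0 < Z" "Z < 1" "1 \<le> p" "lp Z p F"
  shows "(\<lambda>n. Z powi n * F n * phi Z (n + m)) summable_on UNIV"
    and "\<exists>C\<ge>0. \<forall>m. absfour Z F m \<le> C * Z powr (- ((1 - 1 / p) * real_of_int m))"
proof -
  have "(\<forall>m. (\<lambda>n. Z powi n * F n * phi Z (n + m)) summable_on UNIV) \<and>
    (\<exists>C\<ge>0. \<forall>m. absfour Z F m \<le> C * Z powr (- ((1 - 1 / p) * real_of_int m)))"
  proof (cases "p = 1")
    case True
    have "\<bar>Z powi n * F n * phi Z (n + m)\<bar> \<le> Z powi n * \<bar>F n\<bar> * A" for n m
      using assms by (intro abs_mult_le abs_phi_le_A) (auto simp: abs_mult)
    moreover have s: "(\<lambda>n. Z powi n * \<bar>F n\<bar> * A) summable_on UNIV"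
      using assms True by (intro summable_on_cmult_left) (simp add: lp_def)
    ultimately have "(\<lambda>n. Z powi n * F n * phi Z (n + m)) summable_on UNIV"
      "absfour Z F m \<le> (\<Sum>\<^sub>\<infinity>n. Z powi n * \<bar>F n\<bar> * A)" for m
      unfolding absfour_def
      using summable_on_bounded_by[OF s, of "\<lambda>n. Z powi n * F n * phi Z (n + m)"] by (auto intro!: infsum_mono)
    moreover have "0 \<le> (\<Sum>\<^sub>\<infinity>n. Z powi n * \<bar>F n\<bar> * A)"
      using assms A_pos by (intro infsum_nonneg) auto
    ultimately show ?thesis
      using True assms by auto
  next
    case False
    define \<theta> where "\<theta> = 1 - 1 / p"
    have \<theta>: "0 < \<theta>" "\<theta> \<le> 1"
      using False assms by (auto simp: \<theta>_def)
    obtain B where B: "B \<ge> 0" "\<And>n. \<bar>F n\<bar> \<le> B * Z powr (- (real_of_int n / p))"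
      using lp_decay[OF assms(1,3,4)] by blast
    define S where "S = (\<Sum>\<^sub>\<infinity>n. Z powr (\<theta> * real_of_int n) * \<bar>phi Z n\<bar>)"
    have le: "\<bar>Z powi n * F n * phi Z (n + m)\<bar> \<le> B * (Z powr (\<theta> * real_of_int n) * \<bar>phi Z (n + m)\<bar>)" for n m
    proof -
      have "Z powi n * \<bar>F n\<bar> \<le> Z powr real_of_int n * (B * Z powr (- (real_of_int n / p)))"
        using assms(1) B by (auto simp: powr_real_of_int' intro!: mult_left_mono)
      also have "\<dots> = B * Z powr (\<theta> * real_of_int n)"
        by (simp add: \<theta>_def powr_add[symmetric] algebra_simps)
      finally have "Z powi n * \<bar>F n\<bar> * \<bar>phi Z (n + m)\<bar> \<le> B * Z powr (\<theta> * real_of_int n) * \<bar>phi Z (n + m)\<bar>"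
        by (rule mult_right_mono) simp
      then show ?thesis
        using assms(1) by (simp add: abs_mult mult_ac)
    qed
    have s: "(\<lambda>n. B * (Z powr (\<theta> * real_of_int n) * \<bar>phi Z (n + m)\<bar>)) summable_on UNIV" for m
      by (intro summable_on_cmult_right summable_powr_phi_shift assms \<theta>)
    have "absfour Z F m \<le> B * S * Z powr (- (\<theta> * real_of_int m))" for m
    proof -
      have "absfour Z F m \<le> (\<Sum>\<^sub>\<infinity>n. B * (Z powr (\<theta> * real_of_int n) * \<bar>phi Z (n + m)\<bar>))"
        unfolding absfour_def
        by (rule infsum_mono[OF summable_on_bounded_by(2)[OF s[of m] le] s le])
      also have "\<dots> = B * S * Z powr (- (\<theta> * real_of_int m))"
        unfolding infsum_cmult_right' summable_powr_phi_shift(2)[OF assms(1,2) \<theta>] by (simp add: S_def)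
      finally show ?thesis .
    qed
    moreover have "0 \<le> B * S"
      unfolding S_def using B by (intro mult_nonneg_nonneg infsum_nonneg) auto
    ultimately show ?thesis
      unfolding \<theta>_def[symmetric] using summable_on_bounded_by(1)[OF s le] by blast
  qed
  then show "(\<lambda>n. Z powi n * F n * phi Z (n + m)) summable_on UNIV"
    and "\<exists>C\<ge>0. \<forall>m. absfour Z F m \<le> C * Z powr (- ((1 - 1 / p) * real_of_int m))"
    by auto
qed

lemma absfour_nonneg: "0 \<le> absfour Z F m"
  unfolding absfour_def by (intro infsum_nonneg) auto

lemma abs_four_le:
  assumes "0 < Z" "Z < 1" "1 \<le> p" "lp Z p F"
  shows "\<bar>four Z F m\<bar> \<le> absfour Z F m"
  unfolding four_def absfour_def
  by (rule summable_on_bounded_by(3)[OF summable_on_abs_real[OF absfour_bound(1)[OF assms]]]) simp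

end

section \<open>Translation and convolution of sequences at fixed exponents\<close>

locale q_young = q_base +
  fixes Z p r s :: real and F G :: "int \<Rightarrow> real"
  assumes Z: "0 < Z" "Z < 1"
    and exps: "1 \<le> p" "1 \<le> r" "1 \<le> s" "1 / p + 1 / r - 1 = 1 / s"
    and F: "lp Z p F" and G: "lp Z r G"
begin

definition trans :: "int \<Rightarrow> int \<Rightarrow> real" where
  "trans a b = (\<Sum>\<^sub>\<infinity>n. Z powi n * four Z F n * phi Z (n + b) * phi Z (n + a))"

definition conv :: "int \<Rightarrow> real" where
  "conv = four Z (\<lambda>n. four Z F n * four Z G n)"

text \<open>The two transforms grow with exponents 1 - 1/p and 1 - 1/r, so the weight keeps 1/p +
  1/r - 1 = 1/s, which is positive.\<close>

lemma absfour_prod_summable: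
  "(\<lambda>n. Z powi n * absfour Z F n * absfour Z G n * \<bar>phi Z (n + a)\<bar>) summable_on UNIV"
proof -
  obtain C where C: "C \<ge> 0" "\<And>m. absfour Z F m \<le> C * Z powr (- ((1 - 1 / p) * real_of_int m))"
    using absfour_bound(2)[OF Z exps(1) F] by blast
  obtain D where D: "D \<ge> 0" "\<And>m. absfour Z G m \<le> D * Z powr (- ((1 - 1 / r) * real_of_int m))"
    using absfour_bound(2)[OF Z exps(2) G] by blast
  show ?thesis
  proof (rule summable_on_bounded_by(1))
    show "(\<lambda>n. (C * D) * (Z powr (1 / s * real_of_int n) * \<bar>phi Z (n + a)\<bar>)) summable_on UNIV"
      using exps Z by (intro summable_on_cmult_right summable_powr_phi_shift) auto
    fix n
    have "absfour Z F n * absfour Z G n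
        \<le> (C * Z powr (- ((1 - 1 / p) * real_of_int n))) * (D * Z powr (- ((1 - 1 / r) * real_of_int n)))"
      using C D absfour_nonneg by (intro mult_mono) auto
    from mult_left_mono[OF this, of "Z powr real_of_int n"]
    have "Z powi n * (absfour Z F n * absfour Z G n)
        \<le> (C * D) * (Z powr real_of_int n * Z powr (- ((1 - 1 / p) * real_of_int n)) * Z powr (- ((1 - 1 / r) * real_of_int n)))"
      using Z by (simp add: powr_real_of_int' mult_ac)
    also have "Z powr real_of_int n * Z powr (- ((1 - 1 / p) * real_of_int n)) * Z powr (- ((1 - 1 / r) * real_of_int n))
        = Z powr (1 / s * real_of_int n)"
    proof -
      have "real_of_int n + - ((1 - 1 / p) * real_of_int n) + - ((1 - 1 / r) * real_of_int n)
          = (1 / p + 1 / r - 1) * real_of_int n"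
        by (simp add: algebra_simps)
      then show ?thesis
        unfolding powr_add[symmetric] exps(4) by simp
    qed
    finally have "Z powi n * (absfour Z F n * absfour Z G n) * \<bar>phi Z (n + a)\<bar>
        \<le> (C * D) * Z powr (1 / s * real_of_int n) * \<bar>phi Z (n + a)\<bar>"
      by (rule mult_right_mono) simp
    then show "\<bar>Z powi n * absfour Z F n * absfour Z G n * \<bar>phi Z (n + a)\<bar>\<bar>
        \<le> (C * D) * (Z powr (1 / s * real_of_int n) * \<bar>phi Z (n + a)\<bar>)"
      using Z absfour_nonneg by (simp add: abs_mult mult_ac)
  qed
qed

lemma conv_summable:
  "(\<lambda>n. Z powi n * (four Z F n * four Z G n) * phi Z (n + a)) summable_on UNIV"
proof (rule summable_on_bounded_by(1)[OF absfour_prod_summable])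
  fix n
  have "\<bar>Z powi n * (four Z F n * four Z G n) * phi Z (n + a)\<bar> \<le> Z powi n * (absfour Z F n * absfour Z G n) * \<bar>phi Z (n + a)\<bar>"
    using Z abs_four_le[OF Z exps(1) F] abs_four_le[OF Z exps(2) G]
    by (intro abs_mult_le order_refl) auto
  then show "\<bar>Z powi n * (four Z F n * four Z G n) * phi Z (n + a)\<bar> \<le> Z powi n * absfour Z F n * absfour Z G n * \<bar>phi Z (n + a)\<bar>"
    by (simp add: mult_ac)
qed

lemma absfour_phi_phi_summable:
  "(\<lambda>n. Z powi n * absfour Z F n * \<bar>phi Z (n + b) * phi Z (n + a)\<bar>) summable_on UNIV"
proof -
  obtain C where C: "C \<ge> 0" "\<And>m. absfour Z F m \<le> C * Z powr (- ((1 - 1 / p) * real_of_int m))"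
    using absfour_bound(2)[OF Z exps(1) F] by blast
  show ?thesis
  proof (rule summable_on_bounded_by(1))
    show "(\<lambda>n. (C * A) * (Z powr (1 / p * real_of_int n) * \<bar>phi Z (n + a)\<bar>)) summable_on UNIV"
      using exps Z by (intro summable_on_cmult_right summable_powr_phi_shift) auto
    fix n
    have "Z powi n * absfour Z F n \<le> Z powr real_of_int n * (C * Z powr (- ((1 - 1 / p) * real_of_int n)))"
      using Z C by (auto simp: powr_real_of_int' intro!: mult_left_mono)
    also have "\<dots> = C * Z powr (1 / p * real_of_int n)"
      by (simp add: powr_add[symmetric] algebra_simps)
    finally have 1: "\<bar>Z powi n * absfour Z F n\<bar> \<le> C * Z powr (1 / p * real_of_int n)"
      using Z absfour_nonneg by simp
    have 2: "\<bar>\<bar>phi Z (n + b) * phi Z (n + a)\<bar>\<bar> \<le> A * \<bar>phi Z (n + a)\<bar>"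
      using Z abs_phi_le_A[of Z "n + b"] by (simp add: abs_mult mult_right_mono)
    show "\<bar>Z powi n * absfour Z F n * \<bar>phi Z (n + b) * phi Z (n + a)\<bar>\<bar>
        \<le> (C * A) * (Z powr (1 / p * real_of_int n) * \<bar>phi Z (n + a)\<bar>)"
      using abs_mult_le[OF 1 2] by (simp only: mult_ac)
  qed
qed

lemma trans_summable: "(\<lambda>n. Z powi n * four Z F n * phi Z (n + b) * phi Z (n + a)) summable_on UNIV"
proof (rule summable_on_bounded_by(1)[OF absfour_phi_phi_summable])
  fix n
  have "\<bar>Z powi n * four Z F n * (phi Z (n + b) * phi Z (n + a))\<bar> \<le> Z powi n * absfour Z F n * \<bar>phi Z (n + b) * phi Z (n + a)\<bar>"
    using Z abs_four_le[OF Z exps(1) F] by (rule_tac abs_mult_le[OF abs_mult_le order_refl]) auto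
  then show "\<bar>Z powi n * four Z F n * phi Z (n + b) * phi Z (n + a)\<bar> \<le> Z powi n * absfour Z F n * \<bar>phi Z (n + b) * phi Z (n + a)\<bar>"
    by (simp only: mult.assoc)
qed

text \<open>Only the transform of \<open>G\<close> is expanded; the transform of \<open>F\<close>
  stays a factor and becomes part of the translation after the exchange.\<close>

lemma conv_eq_trans:
  shows "(\<lambda>b. Z powi b * trans a b * G b) summable_on UNIV"
    and "conv a = (\<Sum>\<^sub>\<infinity>b. Z powi b * trans a b * G b)"
proof -
  define f where "f = (\<lambda>n b. (Z powi n * four Z F n * phi Z (n + a)) * (Z powi b * G b * phi Z (b + n)))"
  have sg: "(\<lambda>b. Z powi b * G b * phi Z (b + n)) summable_on UNIV" for n
    by (rule absfour_bound(1)[OF Z exps(2) G])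
  have sfs: "(\<lambda>(n, b). f n b) summable_on UNIV \<times> UNIV"
  proof (rule summable_on_Times_bounded_by)
    show "\<bar>f n b\<bar> \<le> \<bar>Z powi n * four Z F n * phi Z (n + a)\<bar> * \<bar>Z powi b * G b * phi Z (b + n)\<bar>" for n b
      by (simp add: f_def abs_mult)
    show "(\<lambda>b. \<bar>Z powi n * four Z F n * phi Z (n + a)\<bar> * \<bar>Z powi b * G b * phi Z (b + n)\<bar>) summable_on UNIV" for n
      by (intro summable_on_cmult_right summable_on_abs_real sg)
    show "(\<Sum>\<^sub>\<infinity>b. \<bar>Z powi n * four Z F n * phi Z (n + a)\<bar> * \<bar>Z powi b * G b * phi Z (b + n)\<bar>)
        \<le> Z powi n * absfour Z F n * absfour Z G n * \<bar>phi Z (n + a)\<bar>" for n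
    proof -
      have "\<bar>Z powi n * four Z F n * phi Z (n + a)\<bar> * absfour Z G n \<le> Z powi n * absfour Z F n * \<bar>phi Z (n + a)\<bar> * absfour Z G n"
        using Z abs_four_le[OF Z exps(1) F] absfour_nonneg
        by (intro mult_right_mono abs_mult_le) auto
      then show ?thesis
        unfolding infsum_cmult_right' by (simp add: absfour_def mult_ac)
    qed
  qed (rule absfour_prod_summable)
  have sfs': "(\<lambda>(b, n). f n b) summable_on UNIV \<times> UNIV"
    using sfs summable_on_swap[of "\<lambda>(n, b). f n b" UNIV UNIV] by simp
  have t: "Z powi b * trans a b * G b = (\<Sum>\<^sub>\<infinity>n. f n b)" for b
  proof -
    have "f n b = (Z powi b * G b) * (Z powi n * four Z F n * phi Z (n + b) * phi Z (n + a))" for n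
      by (simp add: f_def mult_ac add_ac)
    then have "(\<Sum>\<^sub>\<infinity>n. f n b) = (Z powi b * G b) * trans a b"
      by (simp only: infsum_cmult_right' trans_def)
    then show ?thesis
      by (simp only: mult_ac)
  qed
  show "(\<lambda>b. Z powi b * trans a b * G b) summable_on UNIV"
    unfolding t using summable_on_Sigma_banach[OF sfs'] by simp
  have "conv a = (\<Sum>\<^sub>\<infinity>n. \<Sum>\<^sub>\<infinity>b. f n b)"
    unfolding f_def infsum_cmult_right' by (simp add: conv_def four_def mult_ac)
  also have "\<dots> = (\<Sum>\<^sub>\<infinity>b. Z powi b * trans a b * G b)"
    unfolding t by (rule infsum_swap_banach[OF sfs])
  finally show "conv a = (\<Sum>\<^sub>\<infinity>b. Z powi b * trans a b * G b)" .
qed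

text \<open>Expanding the transform of \<open>F\<close> identifies \<open>triple\<close> as the
  kernel of the translation; this links its sign to positivity of the operator.\<close>

lemma trans_eq_triple: "trans a b = (\<Sum>\<^sub>\<infinity>d. Z powi d * F d * triple Z a b d)"
proof -
  define f where "f = (\<lambda>n d. (Z powi n * phi Z (n + b) * phi Z (n + a)) * (Z powi d * F d * phi Z (d + n)))"
  have sF: "(\<lambda>d. Z powi d * F d * phi Z (d + n)) summable_on UNIV" for n
    by (rule absfour_bound(1)[OF Z exps(1) F])
  have "trans a b = (\<Sum>\<^sub>\<infinity>n. \<Sum>\<^sub>\<infinity>d. f n d)"
    unfolding f_def infsum_cmult_right' by (simp add: trans_def four_def mult_ac)
  also have "\<dots> = (\<Sum>\<^sub>\<infinity>d. \<Sum>\<^sub>\<infinity>n. f n d)"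
  proof (rule infsum_swap_bounded_by)
    show "\<bar>f n d\<bar> \<le> \<bar>Z powi n * phi Z (n + b) * phi Z (n + a)\<bar> * \<bar>Z powi d * F d * phi Z (d + n)\<bar>" for n d
      by (simp add: f_def abs_mult)
    show "(\<lambda>d. \<bar>Z powi n * phi Z (n + b) * phi Z (n + a)\<bar> * \<bar>Z powi d * F d * phi Z (d + n)\<bar>) summable_on UNIV" for n
      by (intro summable_on_cmult_right summable_on_abs_real sF)
    show "(\<Sum>\<^sub>\<infinity>d. \<bar>Z powi n * phi Z (n + b) * phi Z (n + a)\<bar> * \<bar>Z powi d * F d * phi Z (d + n)\<bar>)
        \<le> Z powi n * absfour Z F n * \<bar>phi Z (n + b) * phi Z (n + a)\<bar>" for n
      unfolding infsum_cmult_right' using Z by (simp add: absfour_def abs_mult mult_ac)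
  qed (rule absfour_phi_phi_summable)
  also have "\<dots> = (\<Sum>\<^sub>\<infinity>d. Z powi d * F d * triple Z a b d)"
  proof (rule infsum_cong)
    fix d
    have "f n d = (Z powi d * F d) * (Z powi n * phi Z (n + a) * phi Z (n + b) * phi Z (n + d))" for n
      by (simp add: f_def mult_ac add_ac)
    then show "(\<Sum>\<^sub>\<infinity>n. f n d) = Z powi d * F d * triple Z a b d"
      by (simp only: infsum_cmult_right' triple_def)
  qed
  finally show ?thesis .
qed

text \<open>The convolution with absolute values everywhere. It dominates \<open>conv\<close>, and
  unlike \<bar>conv\<bar> it also controls the inner double sum when \<open>conv\<close> is
  transformed.\<close>

definition envelope :: "int \<Rightarrow> real" where
  "envelope a = (\<Sum>\<^sub>\<infinity>(b, d). Z powi b * Z powi d * \<bar>G b\<bar> * \<bar>F d\<bar> * \<bar>triple Z a b d\<bar>)"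

context
  fixes M :: real
  assumes M: "\<And>b d. (\<Sum>\<^sub>\<infinity>a. Z powi a * \<bar>triple Z a b d\<bar>) \<le> M"
begin

lemma envelope_young:
  shows "\<And>a. (\<lambda>(b, d). Z powi b * Z powi d * \<bar>G b\<bar> * \<bar>F d\<bar> * \<bar>triple Z a b d\<bar>) summable_on UNIV"
    and "(\<lambda>a. Z powi a * envelope a powr s) summable_on UNIV"
    and "(\<Sum>\<^sub>\<infinity>a. Z powi a * envelope a powr s) powr (1 / s)
      \<le> M * (\<Sum>\<^sub>\<infinity>n. Z powi n * \<bar>G n\<bar> powr r) powr (1 / r) * (\<Sum>\<^sub>\<infinity>n. Z powi n * \<bar>F n\<bar> powr p) powr (1 / p)"
proof -
  have e: "1 / r + 1 / p - 1 = 1 / s"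
    using exps(4) by simp
  \<comment> \<open>Symmetry of the kernel reduces all three marginals to the one in the first
    index.\<close>
  have rot: "triple Z a b d = triple Z b a d" "triple Z a b d = triple Z d a b" for a b d
    using triple_perm by metis+
  note s = triple_row_sum(1)[OF Z]
  have K: "(\<lambda>b. Z powi b * \<bar>triple Z a b d\<bar>) summable_on UNIV" "(\<Sum>\<^sub>\<infinity>b. Z powi b * \<bar>triple Z a b d\<bar>) \<le> M"
    "(\<lambda>d. Z powi d * \<bar>triple Z a b d\<bar>) summable_on UNIV" "(\<Sum>\<^sub>\<infinity>d. Z powi d * \<bar>triple Z a b d\<bar>) \<le> M" for a b d
    using s[of a d] M[of a d] s[of a b] M[of a b] by (simp_all add: rot(1)[of a _ d] rot(2)[of a b])
  show "\<And>a. (\<lambda>(b, d). Z powi b * Z powi d * \<bar>G b\<bar> * \<bar>F d\<bar> * \<bar>triple Z a b d\<bar>) summable_on UNIV"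
    "(\<lambda>a. Z powi a * envelope a powr s) summable_on UNIV"
    "(\<Sum>\<^sub>\<infinity>a. Z powi a * envelope a powr s) powr (1 / s)
      \<le> M * (\<Sum>\<^sub>\<infinity>n. Z powi n * \<bar>G n\<bar> powr r) powr (1 / r) * (\<Sum>\<^sub>\<infinity>n. Z powi n * \<bar>F n\<bar> powr p) powr (1 / p)"
    unfolding envelope_def
    using young_kernel[OF exps(2,1,3) e, of "\<lambda>n. \<bar>G n\<bar>" "\<lambda>n. \<bar>F n\<bar>" "\<lambda>n. Z powi n" "\<lambda>a b d. \<bar>triple Z a b d\<bar>" M]
      Z F G s M K by (auto simp: lp_def)
qed

lemma conv_eq_triple:
  shows "(\<lambda>(b, d). Z powi b * Z powi d * G b * F d * triple Z a b d) summable_on UNIV"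
    and "conv a = (\<Sum>\<^sub>\<infinity>(b, d). Z powi b * Z powi d * G b * F d * triple Z a b d)"
    and "\<bar>conv a\<bar> \<le> envelope a"
proof -
  have le: "\<bar>case bd of (b, d) \<Rightarrow> Z powi b * Z powi d * G b * F d * triple Z a b d\<bar>
      \<le> (case bd of (b, d) \<Rightarrow> Z powi b * Z powi d * \<bar>G b\<bar> * \<bar>F d\<bar> * \<bar>triple Z a b d\<bar>)" for bd
    using Z by (cases bd) (simp add: abs_mult)
  note b = summable_on_bounded_by[OF envelope_young(1) le]
  show s: "(\<lambda>(b, d). Z powi b * Z powi d * G b * F d * triple Z a b d) summable_on UNIV"
    by (rule b(1))
  have "conv a = (\<Sum>\<^sub>\<infinity>b. \<Sum>\<^sub>\<infinity>d. Z powi b * Z powi d * G b * F d * triple Z a b d)"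
  proof -
    have "Z powi b * trans a b * G b = (\<Sum>\<^sub>\<infinity>d. Z powi b * Z powi d * G b * F d * triple Z a b d)" for b
    proof -
      have "Z powi b * Z powi d * G b * F d * triple Z a b d = (Z powi b * G b) * (Z powi d * F d * triple Z a b d)" for d
        by (simp only: mult_ac)
      then have "(\<Sum>\<^sub>\<infinity>d. Z powi b * Z powi d * G b * F d * triple Z a b d) = (Z powi b * G b) * trans a b"
        by (simp only: infsum_cmult_right' trans_eq_triple)
      then show ?thesis
        by (simp only: mult_ac)
    qed
    then show ?thesis
      by (simp only: conv_eq_trans)
  qed
  also have "\<dots> = (\<Sum>\<^sub>\<infinity>(b, d). Z powi b * Z powi d * G b * F d * triple Z a b d)"
    using infsum_Sigma'_banach[of "\<lambda>b d. Z powi b * Z powi d * G b * F d * triple Z a b d" UNIV "\<lambda>_. UNIV"] s by simp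
  finally show c: "conv a = (\<Sum>\<^sub>\<infinity>(b, d). Z powi b * Z powi d * G b * F d * triple Z a b d)" .
  show "\<bar>conv a\<bar> \<le> envelope a"
    unfolding c envelope_def by (rule b(3))
qed

lemma envelope_nonneg: "0 \<le> envelope a"
  unfolding envelope_def using Z by (intro infsum_nonneg) auto

lemma lp_envelope: "lp Z s envelope"
  using envelope_young(2) envelope_nonneg by (simp add: lp_def)

lemma conv_powr_le: "Z powi a * \<bar>conv a\<bar> powr s \<le> Z powi a * envelope a powr s"
  using conv_eq_triple(3) Z exps by (intro mult_left_mono powr_mono2) auto

lemma lp_conv: "lp Z s conv"
  unfolding lp_def by (rule summable_on_bounded_by(1)[OF envelope_young(2)]) (use conv_powr_le Z in auto)

lemma conv_norm_le:
  "(\<Sum>\<^sub>\<infinity>a. Z powi a * \<bar>conv a\<bar> powr s) powr (1 / s)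
    \<le> M * (\<Sum>\<^sub>\<infinity>n. Z powi n * \<bar>F n\<bar> powr p) powr (1 / p) * (\<Sum>\<^sub>\<infinity>n. Z powi n * \<bar>G n\<bar> powr r) powr (1 / r)"
proof -
  have "(\<Sum>\<^sub>\<infinity>a. Z powi a * \<bar>conv a\<bar> powr s) \<le> (\<Sum>\<^sub>\<infinity>a. Z powi a * envelope a powr s)"
    using lp_conv by (intro infsum_mono envelope_young(2) conv_powr_le) (simp add: lp_def)
  then have "(\<Sum>\<^sub>\<infinity>a. Z powi a * \<bar>conv a\<bar> powr s) powr (1 / s) \<le> (\<Sum>\<^sub>\<infinity>a. Z powi a * envelope a powr s) powr (1 / s)"
    using Z exps by (intro powr_mono2 infsum_nonneg) auto
  with envelope_young(3) show ?thesis
    by (simp add: mult_ac)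
qed

text \<open>The envelope satisfies \<open>lp Z s\<close>, so its own transform converges absolutely
  and justifies the exchange; then \<open>triple_phi\<close> factorises the kernel.\<close>

lemma four_conv: "four Z conv m = four Z F m * four Z G m"
proof -
  define T where "T = (\<lambda>a (b, d). Z powi b * Z powi d * G b * F d * triple Z a b d)"
  define E where "E = (\<lambda>a (b, d). Z powi b * Z powi d * \<bar>G b\<bar> * \<bar>F d\<bar> * \<bar>triple Z a b d\<bar>)"
  have TE: "\<bar>T a bd\<bar> \<le> E a bd" for a bd
    using Z by (cases bd) (simp add: T_def E_def abs_mult)
  have sE: "E a summable_on UNIV" for a
    unfolding E_def by (rule envelope_young(1))
  have "four Z conv m = (\<Sum>\<^sub>\<infinity>a. \<Sum>\<^sub>\<infinity>bd. (Z powi a * phi Z (a + m)) * T a bd)"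
    unfolding infsum_cmult_right' four_def conv_eq_triple(2) by (simp add: T_def mult_ac)
  also have "\<dots> = (\<Sum>\<^sub>\<infinity>bd. \<Sum>\<^sub>\<infinity>a. (Z powi a * phi Z (a + m)) * T a bd)"
  proof (rule infsum_swap_bounded_by)
    show "\<bar>(Z powi a * phi Z (a + m)) * T a bd\<bar> \<le> \<bar>Z powi a * phi Z (a + m)\<bar> * E a bd" for a bd
      by (intro abs_mult_le order_refl TE)
    show "(\<lambda>bd. \<bar>Z powi a * phi Z (a + m)\<bar> * E a bd) summable_on UNIV" for a
      by (intro summable_on_cmult_right sE)
    show "(\<Sum>\<^sub>\<infinity>bd. \<bar>Z powi a * phi Z (a + m)\<bar> * E a bd) \<le> \<bar>Z powi a * envelope a * phi Z (a + m)\<bar>" for a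
      unfolding infsum_cmult_right' using envelope_nonneg[of a] by (simp add: envelope_def E_def abs_mult mult_ac)
    show "(\<lambda>a. \<bar>Z powi a * envelope a * phi Z (a + m)\<bar>) summable_on UNIV"
      by (intro summable_on_abs_real absfour_bound(1)[OF Z exps(3) lp_envelope])
  qed
  also have "\<dots> = (\<Sum>\<^sub>\<infinity>(b, d). (Z powi b * G b * phi Z (b + m)) * (Z powi d * F d * phi Z (d + m)))"
  proof (rule infsum_cong)
    fix bd :: "int \<times> int"
    obtain b d where bd: "bd = (b, d)"
      by (cases bd)
    have "(Z powi a * phi Z (a + m)) * T a bd
        = (Z powi b * Z powi d * G b * F d) * (Z powi a * triple Z a b d * phi Z (a + m))" for a
      by (simp add: T_def bd mult_ac)
    then have "(\<Sum>\<^sub>\<infinity>a. (Z powi a * phi Z (a + m)) * T a bd)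
        = (Z powi b * Z powi d * G b * F d) * (phi Z (m + b) * phi Z (m + d))"
      by (simp only: infsum_cmult_right' triple_phi[OF Z])
    then show "(\<Sum>\<^sub>\<infinity>a. (Z powi a * phi Z (a + m)) * T a bd)
        = (case bd of (b, d) \<Rightarrow> (Z powi b * G b * phi Z (b + m)) * (Z powi d * F d * phi Z (d + m)))"
      by (simp add: bd mult_ac add_ac)
  qed
  also have "\<dots> = four Z F m * four Z G m"
    using infsum_Times_mult[OF absfour_bound(1)[OF Z exps(2) G, of m] absfour_bound(1)[OF Z exps(1) F, of m]]
    by (simp add: four_def mult.commute)
  finally show ?thesis .
qed

end

end

section \<open>The q-Bessel Fourier transform\<close>

context q_base
begin

text \<open>1 / (Z; Q)_k equals (Z Q^k; Q)_inf / (Z; Q)_inf. Expanding the numerator by Euler gives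
  a double series; summing over \<open>k\<close> first yields
  \<open>euler (Q powi (n + int l + 1))\<close>, which is \<open>h (n + int l) / H\<close>.\<close>

lemma bessel_has_sum:
  assumes "0 < Z" "Z < 1"
  shows "((\<lambda>k. ecoeff k * (Q powi (n + 1)) ^ k / qpoch Z Q k) has_sum (phi Z n / (H * euler Z))) UNIV"
proof -
  define x where "x = Q powi (n + 1)"
  have x: "x > 0"
    using Q_pos by (simp add: x_def)
  have eZ: "euler Z > 0"
    using qpoch_inf_pos assms by (simp add: euler_eq)
  define f where "f = (\<lambda>k l. (ecoeff k * x ^ k) * (ecoeff l * (Z * Q ^ k) ^ l))"
  have sfs: "(\<lambda>(k, l). f k l) summable_on UNIV \<times> UNIV"
  proof (rule summable_on_bounded_by(1))
    show "(\<lambda>(k, l). (\<bar>ecoeff k\<bar> * \<bar>x\<bar> ^ k) * (\<bar>ecoeff l\<bar> * \<bar>Z\<bar> ^ l)) summable_on UNIV \<times> UNIV"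
      by (intro summable_on_Times_mult ecoeff_summable_on)
    fix kl :: "nat \<times> nat"
    obtain k l where kl: "kl = (k, l)"
      by (cases kl)
    have "\<bar>f k l\<bar> = (\<bar>ecoeff k\<bar> * \<bar>x\<bar> ^ k) * (\<bar>ecoeff l\<bar> * (Z * Q ^ k) ^ l)"
      using x assms Q_pos by (simp add: f_def abs_mult power_abs)
    also have "\<dots> \<le> (\<bar>ecoeff k\<bar> * \<bar>x\<bar> ^ k) * (\<bar>ecoeff l\<bar> * \<bar>Z\<bar> ^ l)"
      using assms mult_Q_bounds[OF assms, of k] by (intro mult_left_mono power_mono) auto
    finally show "\<bar>case kl of (k, l) \<Rightarrow> f k l\<bar> \<le> (case kl of (k, l) \<Rightarrow> (\<bar>ecoeff k\<bar> * \<bar>x\<bar> ^ k) * (\<bar>ecoeff l\<bar> * \<bar>Z\<bar> ^ l))"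
      by (simp add: kl)
  qed
  have row: "(\<Sum>\<^sub>\<infinity>l. f k l) = euler Z * (ecoeff k * x ^ k / qpoch Z Q k)" for k
  proof -
    have "(\<Sum>\<^sub>\<infinity>l. f k l) = ecoeff k * x ^ k * euler (Z * Q ^ k)"
      unfolding f_def infsum_cmult_right' using infsumI[OF euler_has_sum[of "Z * Q ^ k"]] by simp
    then show ?thesis
      using euler_qpoch[of Z k] qpoch_pos[of Z k] assms by simp
  qed
  have col: "(\<Sum>\<^sub>\<infinity>k. f k l) = ecoeff l * Z ^ l * h (n + int l) / H" for l
  proof -
    have "f k l = (ecoeff l * Z ^ l) * (ecoeff k * (x * Q ^ l) ^ k)" for k
      by (simp add: f_def power_mult_distrib power_mult[symmetric] mult_ac)
    then have "(\<Sum>\<^sub>\<infinity>k. f k l) = (ecoeff l * Z ^ l) * euler (x * Q ^ l)"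
      using infsumI[OF euler_has_sum[of "x * Q ^ l"]] by (simp only: infsum_cmult_right')
    moreover have "x * Q ^ l = Q powi (n + int l + 1)"
      using Q_pos by (simp add: x_def power_int_add)
    ultimately show ?thesis
      using h_eq_euler[of "n + int l"] H_pos by simp
  qed
  have s0: "(\<lambda>k. inverse (euler Z) * (\<Sum>\<^sub>\<infinity>l. f k l)) summable_on UNIV"
    using summable_on_Sigma_banach[OF sfs] by (intro summable_on_cmult_right) simp
  have s: "(\<lambda>k. ecoeff k * x ^ k / qpoch Z Q k) summable_on UNIV"
  proof -
    have "inverse (euler Z) * (\<Sum>\<^sub>\<infinity>l. f k l) = ecoeff k * x ^ k / qpoch Z Q k" for k
      using eZ by (simp add: row)
    then show ?thesis
      using s0 by (simp only:)
  qed
  have "euler Z * (\<Sum>\<^sub>\<infinity>k. ecoeff k * x ^ k / qpoch Z Q k) = (\<Sum>\<^sub>\<infinity>l. \<Sum>\<^sub>\<infinity>k. f k l)"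
    unfolding infsum_swap_banach[OF sfs, symmetric] row infsum_cmult_right' ..
  also have "\<dots> = phi Z n / H"
    unfolding col by (simp add: divide_inverse infsum_cmult_left' phi_def)
  finally have "(\<Sum>\<^sub>\<infinity>k. ecoeff k * x ^ k / qpoch Z Q k) = phi Z n / (H * euler Z)"
    using eZ H_pos by (simp add: field_simps)
  with has_sum_infsum[OF s] show ?thesis
    by (simp add: x_def)
qed

end

section \<open>From functions on the q-lattice to integer sequences\<close>

locale q_bessel =
  fixes q \<nu> :: real
  assumes q: "0 < q" "q < 1" and \<nu>: "\<nu> > - 1"
begin

sublocale q_base "q\<^sup>2"
  by unfold_locales (use q in \<open>auto simp: power_less_one_iff\<close>)

definition Z :: real where "Z = q powr (2 * \<nu> + 2)"

text \<open>The limit of \<open>phi Z\<close> at plus infinity, where the Bessel argument tends to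
  0; dividing by it normalises the Bessel function to 1 at 0. It is also \<open>c_const\<close>
  times 1 - q.\<close>

definition \<kappa> :: real where "\<kappa> = H * euler Z"

definition seq :: "(real \<Rightarrow> real) \<Rightarrow> int \<Rightarrow> real" where
  "seq f n = f (q powi n)"

lemma Z: "0 < Z" "Z < 1"
  using q \<nu> powr_less_mono2[of "2 * \<nu> + 2" q 1] by (simp_all add: Z_def)

lemma \<kappa>_pos: "0 < \<kappa>"
  using H_pos qpoch_inf_pos Z by (simp add: \<kappa>_def euler_eq)

lemma bessel_eq_phi: "q_bessel_j q \<nu> (q powi m * q powi n) = phi Z (n + m) / \<kappa>"
proof -
  have e: "(- 1) ^ k * (q ^ (k * (k + 1)) / (qpoch (q powr (2 * \<nu> + 2)) (q\<^sup>2) k * qpoch (q\<^sup>2) (q\<^sup>2) k))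
        * (q powi m * q powi n) ^ (2 * k)
      = ecoeff k * (q\<^sup>2 powi (n + m + 1)) ^ k / qpoch Z (q\<^sup>2) k" for k
  proof -
    \<comment> \<open>The exponent splits into the triangular one of \<open>ecoeff\<close> and one
      factor Q^k, which accounts for the + 1 in the argument.\<close>
    have "k * (k + 1) = 2 * (\<Sum>i<k. i) + 2 * k"
      by (induction k) auto
    then have "q ^ (k * (k + 1)) = (q\<^sup>2) ^ (\<Sum>i<k. i) * (q\<^sup>2) ^ k"
      by (simp only: power_add power_mult)
    moreover have "(q powi m * q powi n) ^ (2 * k) * (q\<^sup>2) ^ k = (q\<^sup>2 powi (n + m + 1)) ^ k"
    proof -
      have "(q powi m * q powi n)\<^sup>2 * q\<^sup>2 = q\<^sup>2 powi (n + m + 1)"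
        using q by (simp add: power_int_add power2_eq_square power_int_mult_distrib)
      then show ?thesis
        by (simp only: power_mult power_mult_distrib[symmetric])
    qed
    ultimately show ?thesis
      by (simp add: ecoeff_def Z_def mult_ac)
  qed
  have "q_bessel_j q \<nu> (q powi m * q powi n) = (\<Sum>k. ecoeff k * (q\<^sup>2 powi (n + m + 1)) ^ k / qpoch Z (q\<^sup>2) k)"
    unfolding q_bessel_j_def e ..
  also have "\<dots> = phi Z (n + m) / \<kappa>"
    unfolding \<kappa>_def by (rule sums_unique[symmetric], rule has_sum_imp_sums, rule bessel_has_sum[OF Z])
  finally show ?thesis .
qed

lemma powi_weight: "q powi n * (q powi n) powr (2 * \<nu> + 1) = Z powi n"
proof -
  have "q powi n = q powr real_of_int n" "Z powi n = Z powr real_of_int n"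
    using q Z by (simp_all add: powr_real_of_int')
  then show ?thesis
    using q by (simp add: Z_def powr_powr powr_add[symmetric] algebra_simps)
qed

lemma jackson_integrable_iff:
  "jackson_integrable q (\<lambda>t. g t * t powr (2 * \<nu> + 1)) \<longleftrightarrow> (\<lambda>n. Z powi n * g (q powi n)) summable_on UNIV"
proof -
  have "q powi n * (g (q powi n) * (q powi n) powr (2 * \<nu> + 1)) = Z powi n * g (q powi n)" for n
    by (simp flip: powi_weight)
  then show ?thesis
    by (simp only: jackson_integrable_def)
qed

lemma jackson_integral_eq:
  "jackson_integral q (\<lambda>t. g t * t powr (2 * \<nu> + 1)) = (1 - q) * (\<Sum>\<^sub>\<infinity>n. Z powi n * g (q powi n))"
proof -
  have "q powi n * (g (q powi n) * (q powi n) powr (2 * \<nu> + 1)) = Z powi n * g (q powi n)" for n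
    by (simp flip: powi_weight)
  then show ?thesis
    by (simp only: jackson_integral_def)
qed

lemma c_const_eq: "c_const q \<nu> * (1 - q) = \<kappa>"
  using q by (simp add: c_const_def \<kappa>_def H_def euler_eq Z_def)

lemma mem_Lq_iff: "f \<in> Lq q p \<nu> \<longleftrightarrow> lp Z p (seq f)"
  by (simp add: Lq_def jackson_integrable_iff lp_def seq_def)

lemma Lq_norm_eq:
  "Lq_norm q p \<nu> f = (1 - q) powr (1 / p) * (\<Sum>\<^sub>\<infinity>n. Z powi n * \<bar>seq f n\<bar> powr p) powr (1 / p)"
  unfolding Lq_norm_def jackson_integral_eq seq_def
  by (rule powr_mult)

lemma summable_div_\<kappa>_iff: "(\<lambda>n. f n / \<kappa>) summable_on UNIV \<longleftrightarrow> f summable_on UNIV" for f :: "int \<Rightarrow> real"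
  using summable_on_cmult_left[of f UNIV "1 / \<kappa>"] summable_on_cmult_left[of "\<lambda>n. f n / \<kappa>" UNIV \<kappa>] \<kappa>_pos
  by auto

lemma fourier_integrable_iff:
  "jackson_integrable q (\<lambda>t. f t * q_bessel_j q \<nu> (q powi m * t) * t powr (2 * \<nu> + 1))
    \<longleftrightarrow> (\<lambda>n. Z powi n * seq f n * phi Z (n + m)) summable_on UNIV"
  unfolding jackson_integrable_iff bessel_eq_phi
  using summable_div_\<kappa>_iff[of "\<lambda>n. Z powi n * seq f n * phi Z (n + m)"] by (simp add: seq_def mult_ac)

lemma q_fourier_exists_iff:
  "q_fourier_exists q \<nu> f \<longleftrightarrow> (\<forall>m. (\<lambda>n. Z powi n * seq f n * phi Z (n + m)) summable_on UNIV)"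
  by (auto simp: q_fourier_exists_def Rq_def fourier_integrable_iff)

lemma q_fourier_eq: "q_fourier q \<nu> f (q powi m) = four Z (seq f) m"
proof -
  have "q_fourier q \<nu> f (q powi m) = \<kappa> * (\<Sum>\<^sub>\<infinity>n. Z powi n * (f (q powi n) * (phi Z (n + m) / \<kappa>)))"
    unfolding q_fourier_def jackson_integral_eq bessel_eq_phi
    by (simp flip: c_const_eq)
  also have "\<dots> = four Z (seq f) m"
    unfolding infsum_cmult_right'[symmetric] using \<kappa>_pos by (simp add: four_def seq_def mult_ac)
  finally show ?thesis .
qed

lemma seq_q_fourier: "seq (q_fourier q \<nu> f) = four Z (seq f)"
  by (simp add: fun_eq_iff seq_def q_fourier_eq)

lemma seq_mult: "seq (\<lambda>t. f t * g t) = (\<lambda>n. seq f n * seq g n)"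
  by (simp add: seq_def fun_eq_iff)

lemma translation_integrable_iff:
  "jackson_integrable q (\<lambda>t. q_fourier q \<nu> f t * q_bessel_j q \<nu> (q powi b * t) * q_bessel_j q \<nu> (q powi a * t) * t powr (2 * \<nu> + 1))
    \<longleftrightarrow> (\<lambda>n. Z powi n * four Z (seq f) n * phi Z (n + b) * phi Z (n + a)) summable_on UNIV"
  unfolding jackson_integrable_iff bessel_eq_phi q_fourier_eq
  using summable_div_\<kappa>_iff[of "\<lambda>n. Z powi n * four Z (seq f) n * phi Z (n + b) * phi Z (n + a) / \<kappa>"]
    summable_div_\<kappa>_iff[of "\<lambda>n. Z powi n * four Z (seq f) n * phi Z (n + b) * phi Z (n + a)"]
  by (simp add: mult_ac)

lemma q_translation_eq:
  "q_translation q \<nu> (q powi a) f (q powi b)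
    = (\<Sum>\<^sub>\<infinity>n. Z powi n * four Z (seq f) n * phi Z (n + b) * phi Z (n + a)) / \<kappa>"
proof -
  have "q_translation q \<nu> (q powi a) f (q powi b)
      = \<kappa> * (\<Sum>\<^sub>\<infinity>n. Z powi n * (four Z (seq f) n * (phi Z (n + b) / \<kappa>) * (phi Z (n + a) / \<kappa>)))"
    unfolding q_translation_def jackson_integral_eq bessel_eq_phi q_fourier_eq
    by (simp flip: c_const_eq)
  also have "(\<lambda>n. Z powi n * (four Z (seq f) n * (phi Z (n + b) / \<kappa>) * (phi Z (n + a) / \<kappa>)))
      = (\<lambda>n. (1 / (\<kappa> * \<kappa>)) * (Z powi n * four Z (seq f) n * phi Z (n + b) * phi Z (n + a)))"
    by (simp add: fun_eq_iff)
  finally show ?thesis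
    unfolding infsum_cmult_right' using \<kappa>_pos by simp
qed

text \<open>Translating the indicator of the lattice point \<open>q powi d\<close> reduces
  \<open>trans_eq_triple\<close> to a single kernel entry times a positive weight. The indicator
  lies in the space of exponent 1, so the sequence results apply with all exponents equal to
  1.\<close>

lemma triple_nonneg:
  assumes "\<And>x. x \<in> Rq q \<Longrightarrow> q_translation_positive q \<nu> x"
  shows "0 \<le> triple Z a b d"
proof -
  define f where "f = (\<lambda>t. if t = q powi d then 1 else 0 :: real)"
  define \<delta> where "\<delta> = (\<lambda>n. if n = d then 1 else 0 :: real)"
  have f: "seq f = \<delta>"
    using q power_int_strict_decreasing[of _ _ q] by (auto simp: seq_def f_def \<delta>_def fun_eq_iff) (metis less_irrefl linorder_neqE)
  have "(\<lambda>n. Z powi n * \<bar>\<delta> n\<bar> powr 1) summable_on UNIV \<longleftrightarrow> (\<lambda>n. Z powi n * \<bar>\<delta> n\<bar> powr 1) summable_on {d}"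
    by (rule summable_on_cong_neutral) (auto simp: \<delta>_def)
  then have lp: "lp Z 1 \<delta>"
    by (simp add: lp_def)
  interpret q_young "q\<^sup>2" Z 1 1 1 \<delta> \<delta>
    by unfold_locales (use Z lp in auto)
  have "0 \<le> q_translation q \<nu> (q powi a) f (q powi b)"
  proof -
    have "f \<in> Lq q 1 \<nu>"
      using lp f by (simp add: mem_Lq_iff)
    moreover have "q powi a \<in> Rq q" "q powi b \<in> Rq q"
      by (auto simp: Rq_def)
    ultimately show ?thesis
      using assms[of "q powi a"] unfolding q_translation_positive_def f_def
      by (auto simp: f_def[abs_def])
  qed
  then have "0 \<le> trans a b / \<kappa>"
    by (simp add: q_translation_eq f trans_def)
  moreover have "trans a b = Z powi d * triple Z a b d"
    unfolding trans_eq_triple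
    using has_sum_finite_neutralI[of "{d}" UNIV "\<lambda>n. Z powi n * \<delta> n * triple Z a b n"]
    by (intro infsumI) (auto simp: \<delta>_def)
  moreover have "0 < Z powi d"
    using Z by simp
  ultimately show ?thesis
    using \<kappa>_pos by (simp add: zero_le_divide_iff zero_le_mult_iff)
qed

text \<open>The two sides differ by the factor (-Q; Q)_inf, all of whose factors exceed 1.\<close>

lemma B_const_ge: "H * euler (- Z) \<le> B_const q \<nu> * (1 - q)"
proof -
  have "1 * (qpoch_inf (- Z) (q\<^sup>2) * H) \<le> qpoch_inf (- (q\<^sup>2)) (q\<^sup>2) * (qpoch_inf (- Z) (q\<^sup>2) * H)"
    using qpoch_inf_ge1[of "- (q\<^sup>2)"] qpoch_inf_ge1[of "- Z"] H_pos Z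
    by (intro mult_right_mono) (auto intro!: mult_nonneg_nonneg)
  then show ?thesis
    using q by (simp add: B_const_def euler_eq H_def Z_def mult_ac)
qed

end

theorem theorem5:
  fixes q \<nu> p r s :: real and f g :: "real \<Rightarrow> real"
  assumes "0 < q" and "q < 1" and "\<nu> > -1"
    and "p \<ge> 1" and "r \<ge> 1" and "s \<ge> 1"
    and "1 / p + 1 / r - 1 = 1 / s"
    and "f \<in> Lq q p \<nu>" and "g \<in> Lq q r \<nu>"
  shows "q_conv_exists q \<nu> f g \<and>
    (\<forall>x\<in>Rq q. q_translation_exists q \<nu> x f \<and>
       jackson_integrable q (\<lambda>y. q_translation q \<nu> x f y * g y * y powr (2 * \<nu> + 1)) \<and>
       q_conv q \<nu> f g x =
         c_const q \<nu> * jackson_integral q (\<lambda>y. q_translation q \<nu> x f y * g y * y powr (2 * \<nu> + 1))) \<and>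
    q_conv q \<nu> f g \<in> Lq q s \<nu> \<and>
    q_fourier_exists q \<nu> (q_conv q \<nu> f g) \<and>
    (\<forall>x\<in>Rq q. q_fourier q \<nu> (q_conv q \<nu> f g) x = q_fourier q \<nu> f x * q_fourier q \<nu> g x) \<and>
    (s \<ge> 2 \<longrightarrow> Lq_norm q s \<nu> (q_conv q \<nu> f g) \<le> B_const q \<nu> * Lq_norm q p \<nu> f * Lq_norm q r \<nu> g) \<and>
    ((\<forall>x\<in>Rq q. q_translation_positive q \<nu> x) \<longrightarrow>
       Lq_norm q s \<nu> (q_conv q \<nu> f g) \<le> c_const q \<nu> * Lq_norm q p \<nu> f * Lq_norm q r \<nu> g)"
proof -
  interpret q_bessel q \<nu>
    by unfold_locales (use assms in auto)
  have fg: "lp Z p (seq f)" "lp Z r (seq g)"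
    using assms by (simp_all add: mem_Lq_iff)
  interpret q_young "q\<^sup>2" Z p r s "seq f" "seq g"
    by unfold_locales (use Z assms fg in auto)
  have conv: "seq (q_conv q \<nu> f g) = conv"
    by (simp add: q_conv_def seq_q_fourier seq_mult conv_def)
  have B: "(\<Sum>\<^sub>\<infinity>a. Z powi a * \<bar>triple Z a b d\<bar>) \<le> H * euler (- Z)" for b d
    by (rule infsum_le_finite_sums[OF triple_row_sum(1)[OF Z]]) (rule triple_sum_le[OF Z])
  \<comment> \<open>The bound carries 1 - q because kernel sums are plain sums while norms use
    Jackson integrals; the powers of 1 - q balance by 1/s + 1 = 1/p + 1/r.\<close>
  have norm: "Lq_norm q s \<nu> (q_conv q \<nu> f g) \<le> K * Lq_norm q p \<nu> f * Lq_norm q r \<nu> g"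
    if M: "\<And>b d. (\<Sum>\<^sub>\<infinity>a. Z powi a * \<bar>triple Z a b d\<bar>) \<le> K * (1 - q)" for K
  proof -
    have "Lq_norm q s \<nu> (q_conv q \<nu> f g)
        \<le> (1 - q) powr (1 / s) * (K * (1 - q) * (\<Sum>\<^sub>\<infinity>n. Z powi n * \<bar>seq f n\<bar> powr p) powr (1 / p)
          * (\<Sum>\<^sub>\<infinity>n. Z powi n * \<bar>seq g n\<bar> powr r) powr (1 / r))"
      unfolding Lq_norm_eq conv by (intro mult_left_mono conv_norm_le[OF M]) auto
    also have "\<dots> = ((1 - q) powr (1 / s) * (1 - q)) * (K * (\<Sum>\<^sub>\<infinity>n. Z powi n * \<bar>seq f n\<bar> powr p) powr (1 / p)
          * (\<Sum>\<^sub>\<infinity>n. Z powi n * \<bar>seq g n\<bar> powr r) powr (1 / r))"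
      by (simp only: mult_ac)
    also have "(1 - q) powr (1 / s) * (1 - q) = (1 - q) powr (1 / p) * (1 - q) powr (1 / r)"
    proof -
      have "(1 - q) powr (1 / s) * (1 - q) powr 1 = (1 - q) powr (1 / p) * (1 - q) powr (1 / r)"
        unfolding powr_add[symmetric] using assms(7) by (intro arg_cong2[of _ _ _ _ "(powr)"]) auto
      then show ?thesis
        using assms by simp
    qed
    finally show ?thesis
      by (simp only: Lq_norm_eq mult_ac)
  qed
  have "q_conv_exists q \<nu> f g"
    using absfour_bound(1)[OF Z assms(4) fg(1)] absfour_bound(1)[OF Z assms(5) fg(2)] conv_summable
    by (simp add: q_conv_exists_def q_fourier_exists_iff seq_mult seq_q_fourier)
  moreover have "q_translation_exists q \<nu> x f \<and>
       jackson_integrable q (\<lambda>y. q_translation q \<nu> x f y * g y * y powr (2 * \<nu> + 1)) \<and>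
       q_conv q \<nu> f g x =
         c_const q \<nu> * jackson_integral q (\<lambda>y. q_translation q \<nu> x f y * g y * y powr (2 * \<nu> + 1))"
    if xR: "x \<in> Rq q" for x
  proof -
    obtain a where x: "x = q powi a"
      using xR by (auto simp: Rq_def)
    have t: "q_translation q \<nu> x f (q powi b) = trans a b / \<kappa>" for b
      by (simp add: x q_translation_eq trans_def)
    have "q_translation_exists q \<nu> x f"
      using absfour_bound(1)[OF Z assms(4) fg(1)] trans_summable
      by (auto simp: q_translation_exists_def q_fourier_exists_iff x translation_integrable_iff Rq_def)
    moreover have "jackson_integrable q (\<lambda>y. q_translation q \<nu> x f y * g y * y powr (2 * \<nu> + 1))"
      unfolding jackson_integrable_iff t using summable_div_\<kappa>_iff[THEN iffD2, OF conv_eq_trans(1)[of a]]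
      by (simp add: seq_def mult_ac)
    moreover have "q_conv q \<nu> f g x = c_const q \<nu> * jackson_integral q (\<lambda>y. q_translation q \<nu> x f y * g y * y powr (2 * \<nu> + 1))"
    proof -
      have "c_const q \<nu> * jackson_integral q (\<lambda>y. q_translation q \<nu> x f y * g y * y powr (2 * \<nu> + 1))
          = \<kappa> * (\<Sum>\<^sub>\<infinity>n. Z powi n * (trans a n / \<kappa> * g (q powi n)))"
        unfolding jackson_integral_eq t by (simp flip: c_const_eq)
      also have "\<dots> = conv a"
        unfolding conv_eq_trans(2) infsum_cmult_right'[symmetric] using \<kappa>_pos by (simp add: seq_def mult_ac)
      also have "conv a = q_conv q \<nu> f g x"
        by (simp add: conv[symmetric] seq_def x)
      finally show ?thesis ..
    qed
    ultimately show ?thesis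
      by blast
  qed
  moreover have "q_conv q \<nu> f g \<in> Lq q s \<nu>"
    by (simp add: mem_Lq_iff conv lp_conv[OF B])
  moreover have "q_fourier_exists q \<nu> (q_conv q \<nu> f g)"
    using absfour_bound(1)[OF Z assms(6) lp_conv[OF B]] by (simp add: q_fourier_exists_iff conv)
  moreover have "q_fourier q \<nu> (q_conv q \<nu> f g) x = q_fourier q \<nu> f x * q_fourier q \<nu> g x" if "x \<in> Rq q" for x
    using that by (auto simp: Rq_def q_fourier_eq conv four_conv[OF B])
  moreover have "Lq_norm q s \<nu> (q_conv q \<nu> f g) \<le> B_const q \<nu> * Lq_norm q p \<nu> f * Lq_norm q r \<nu> g"
    by (rule norm) (rule order_trans[OF B B_const_ge])
  moreover have "Lq_norm q s \<nu> (q_conv q \<nu> f g) \<le> c_const q \<nu> * Lq_norm q p \<nu> f * Lq_norm q r \<nu> g"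
    if pos: "\<forall>x\<in>Rq q. q_translation_positive q \<nu> x"
  proof (rule norm)
    fix b d
    have "\<bar>triple Z a b d\<bar> = triple Z a b d" for a
      using triple_nonneg pos by simp
    then show "(\<Sum>\<^sub>\<infinity>a. Z powi a * \<bar>triple Z a b d\<bar>) \<le> c_const q \<nu> * (1 - q)"
      by (simp add: triple_row_sum(2)[OF Z] c_const_eq \<kappa>_def)
  qed
  ultimately show ?thesis
    by blast
qed

end
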